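(* Let $\mathfrak{g}=\mathfrak{g}_L\ltimes\mathfrak{h}$ be a sympathetic, non-semisimple Lie algebra with simple Levi subalgebra $\mathfrak{g}_L$ and $\mathfrak{h}=\mathrm{Rad}(\mathfrak{g})$. Let $\mathfrak{h}=V_{n_1}\oplus\cdots\oplus V_{n_k}$ be a decomposition into simple $\mathfrak{g}_L$-modules such that whenever $[V_{n_i},V_{n_j}]\neq 0$ there is a unique $p\in\{1,\dots,k\}$ with $[V_{n_i},V_{n_j}]=V_{n_p}$, and suppose that if $k\geq 5$ then $Z(\mathfrak{h})$ is a simple $\mathfrak{g}_L$-module. Then $\dim(\mathfrak{g})\geq 15$.
   Context: All Lie algebras and vector spaces are finite dimensional over $\mathbb{C}$. A Lie algebra $\mathfrak{g}$ is sympathetic if $Z(\mathfrak{g})=0$, $\mathfrak{g}=[\mathfrak{g},\mathfrak{g}]$ and $\mathrm{Der}(\mathfrak{g})=\mathrm{ad}(\mathfrak{g})$. $\mathfrak{g}=\mathfrak{g}_L\ltimes\mathfrak{h}$ is a Levi decomposition, and $\mathfrak{h}$ is a $\mathfrak{g}_L$-module via the Lie bracket. The $V_{n_i}$ are simple submodules of $\mathfrak{h}$ of highest weight $n_i$; distinct summands may be isomorphic. $[A,B]$ denotes the linear span of all brackets $[a,b]$, $a\in A$, $b\in B$. *)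

theory Defs
  imports Complex_Main "HOL-Library.FuncSet"
begin

locale lie_algebra = vector_space scale
  for scale :: "complex \<Rightarrow> 'a::ab_group_add \<Rightarrow> 'a" +
  fixes bracket :: "'a \<Rightarrow> 'a \<Rightarrow> 'a"
  assumes linear_bracket_right: "Vector_Spaces.linear scale scale (\<lambda>y. bracket x y)"
    and linear_bracket_left: "Vector_Spaces.linear scale scale (\<lambda>x. bracket x y)"
    and bracket_self: "bracket x x = 0"
    and jacobi: "bracket x (bracket y z) + bracket y (bracket z x) + bracket z (bracket x y) = 0"
begin

text \<open>The Lie algebra itself is the whole type, that is, the set \<open>UNIV\<close>. Subalgebras, ideals and
  modules are sets of its elements, so that the notions below can be used both for the whole
  algebra (\<open>A = UNIV\<close>) and for its subalgebras \<open>A\<close>.\<close>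

definition bracket_span :: "'a set \<Rightarrow> 'a set \<Rightarrow> 'a set" where
  "bracket_span A B = span {bracket a b | a b. a \<in> A \<and> b \<in> B}"

definition lie_subalgebra :: "'a set \<Rightarrow> bool" where
  "lie_subalgebra A \<longleftrightarrow> subspace A \<and> (\<forall>x\<in>A. \<forall>y\<in>A. bracket x y \<in> A)"

definition lie_ideal :: "'a set \<Rightarrow> 'a set \<Rightarrow> bool" where
  "lie_ideal I A \<longleftrightarrow> subspace I \<and> I \<subseteq> A \<and> (\<forall>x\<in>A. \<forall>y\<in>I. bracket x y \<in> I)"

definition center :: "'a set \<Rightarrow> 'a set" where
  "center A = {x \<in> A. \<forall>y\<in>A. bracket x y = 0}"

definition solvable :: "'a set \<Rightarrow> bool" where
  "solvable A \<longleftrightarrow> (\<exists>n. ((\<lambda>D. bracket_span D D) ^^ n) A = {0})"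

text \<open>\<open>R\<close> is the largest solvable ideal of \<open>A\<close>.\<close>

definition is_radical :: "'a set \<Rightarrow> 'a set \<Rightarrow> bool" where
  "is_radical R A \<longleftrightarrow> lie_ideal R A \<and> solvable R \<and> (\<forall>I. lie_ideal I A \<and> solvable I \<longrightarrow> I \<subseteq> R)"

definition semisimple :: "'a set \<Rightarrow> bool" where
  "semisimple A \<longleftrightarrow> lie_subalgebra A \<and> is_radical {0} A"

definition simple :: "'a set \<Rightarrow> bool" where
  "simple A \<longleftrightarrow> lie_subalgebra A \<and> bracket_span A A \<noteq> {0} \<and>
     (\<forall>I. lie_ideal I A \<longrightarrow> I = {0} \<or> I = A)"

definition levi_decomposition :: "'a set \<Rightarrow> 'a set \<Rightarrow> bool" where
  "levi_decomposition L R \<longleftrightarrow> semisimple L \<and> is_radical R UNIV \<and>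
     L \<inter> R = {0} \<and> (\<forall>x. \<exists>l\<in>L. \<exists>r\<in>R. x = l + r)"

definition derivations :: "('a \<Rightarrow> 'a) set" where
  "derivations = {D. Vector_Spaces.linear scale scale D \<and>
     (\<forall>x y. D (bracket x y) = bracket (D x) y + bracket x (D y))}"

text \<open>Here \<open>range bracket\<close> is the set of all \<open>ad x = bracket x\<close>.\<close>

definition sympathetic :: bool where
  "sympathetic \<longleftrightarrow> center UNIV = {0} \<and> bracket_span UNIV UNIV = UNIV \<and> derivations = range bracket"

definition submodule :: "'a set \<Rightarrow> 'a set \<Rightarrow> bool" where
  "submodule L W \<longleftrightarrow> subspace W \<and> (\<forall>x\<in>L. \<forall>w\<in>W. bracket x w \<in> W)"

definition simple_module :: "'a set \<Rightarrow> 'a set \<Rightarrow> bool" where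
  "simple_module L W \<longleftrightarrow> submodule L W \<and> W \<noteq> {0} \<and>
     (\<forall>U. submodule L U \<and> U \<subseteq> W \<longrightarrow> U = {0} \<or> U = W)"

text \<open>\<open>W\<close> is the internal direct sum of the subspaces \<open>V i\<close>: the summation map from the product of
  the \<open>V i\<close> to \<open>W\<close> is bijective.\<close>

definition direct_sum :: "'i set \<Rightarrow> ('i \<Rightarrow> 'a set) \<Rightarrow> 'a set \<Rightarrow> bool" where
  "direct_sum I V W \<longleftrightarrow> (\<forall>i\<in>I. subspace (V i)) \<and> bij_betw (\<lambda>v. \<Sum>i\<in>I. v i) (Pi\<^sub>E I V) W"

end

locale fin_dim_lie_algebra = lie_algebra +
  assumes finite_dimensional: "\<exists>B. finite B \<and> span B = UNIV"

end

theory Submission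
  imports Defs "HOL-Computational_Algebra.Fundamental_Theorem_Algebra"
begin

text \<open>Since \<open>h = [g, h]\<close> (as \<open>g\<close> is perfect), Lie's theorem forces \<open>h\<close> to be nilpotent. Suppose
  that integers \<open>w\<^sub>i\<close> satisfy \<open>w\<^sub>p = w\<^sub>i + w\<^sub>j\<close> whenever \<open>[V\<^sub>i, V\<^sub>j] = V\<^sub>p\<close>. Acting by \<open>w\<^sub>i\<close> on \<open>V\<^sub>i\<close> and by
  \<open>0\<close> on the Levi subalgebra is then a derivation. It is inner, and commutes with the Levi
  subalgebra, which has trivial centre, so it comes from an element of \<open>h\<close> and is nilpotent; hence
  all \<open>w\<^sub>i\<close> vanish. So the table of brackets of the \<open>V\<^sub>i\<close> admits no nonzero grading; in particular
  it is not graded by the depth in the lower central series, and \<open>h\<close> needs at least two generating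
  summands. Trivial summands are neither generating nor central. Together with the consequences
  of the Jacobi identity and of the representation theory of \<open>sl\<^sub>2\<close> for indices and dimensions, this
  rules out all tables with \<open>dim h \<le> 11\<close>, which settles \<open>dim g\<^sub>L = 3\<close>. A Levi subalgebra of larger
  dimension has no simple module of dimension 2, so \<open>dim h \<le> 10\<close> leaves only the dimensions 1 and
  3, and such tables satisfy the same constraints.\<close>

section \<open>Tables of brackets\<close>

text \<open>The bound 11 is 14 - 3: a simple Levi subalgebra has dimension at least 3, so a total
  dimension of at most 14 leaves at most 11 for the radical. The recurring move is to exhibit
  integer weights that are compatible with the table and not all zero. With four summands the centre
  of the radical is not assumed to be simple, so this shape is treated by itself. With at least
  five, the central index is unique, and the summands are sorted into trivial ones, even-dimensional
  ones, and odd-dimensional ones of dimension at least 3. At least four summands are nontrivial and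
  at least one is of the last kind; the budget 2 * even + 3 * odd + trivial \<le> 11 then leaves
  very few shapes. On indices the Jacobi identity is only a disjunction: a nonzero term forces one
  of the other two terms into the same summand. The assumptions \<open>jac_triv\<close>,
  \<open>sym_triv\<close> and \<open>cubic_triv\<close> come from looking at vectors inside the
  summands and decide cases that the disjunction leaves open.\<close>

text \<open>\<open>I\<close> indexes the simple summands and \<open>d i\<close> is the dimension of \<open>V\<^sub>i\<close>. The equation \<open>br i j = p\<close> stands
  for \<open>[V\<^sub>i, V\<^sub>j] = V\<^sub>p\<close>, with \<open>0\<close> (not an index) for the zero bracket; in \<open>wt\<close> the weights are only
  constrained along nonzero brackets. In the assumption \<open>nil\<close> the set of all indices reached from
  \<open>J\<close> plays the role of \<open>[h, V\<^sub>J]\<close>.\<close>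

locale bracket_table_base =
  fixes I :: "'b::zero set" and br :: "'b \<Rightarrow> 'b \<Rightarrow> 'b" and d :: "'b \<Rightarrow> nat"
  assumes fin_I: "finite I" and zero_I: "0 \<notin> I" and I_ne: "I \<noteq> {}"
    and br_in: "br i j \<noteq> 0 \<Longrightarrow> br i j \<in> I"
    and br_out: "i \<notin> I \<Longrightarrow> br i j = 0"
    and br_comm: "br i j = br j i"
    and jac: "br (br i j) l = p \<Longrightarrow> p \<noteq> 0 \<Longrightarrow> br (br j l) i = p \<or> br (br l i) j = p"
    and nil: "J \<subseteq> I \<Longrightarrow> {p. p \<noteq> 0 \<and> (\<exists>i j. j \<in> J \<and> p = br i j)} = J \<Longrightarrow> J = {}"
    and wt: "(\<And>i j. br i j \<noteq> 0 \<Longrightarrow> w (br i j) = w i + w j) \<Longrightarrow> i \<in> I \<Longrightarrow> w i = (0::int)"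
    and d_pos: "i \<in> I \<Longrightarrow> d i \<ge> 1"
    and triv_nongen: "i \<in> I \<Longrightarrow> d i = 1 \<Longrightarrow> \<exists>j l. br j l = i"
    and central_nontriv: "i \<in> I \<Longrightarrow> (\<And>j. br i j = 0) \<Longrightarrow> d i \<noteq> 1"
begin

lemma br_out': "j \<notin> I \<Longrightarrow> br i j = 0"
  using br_out br_comm by metis

lemma br_0 [simp]: "br 0 i = 0" "br i 0 = 0"
  using br_out br_out' zero_I by auto

lemma br_mem: assumes "br i j \<noteq> 0" shows "i \<in> I" "j \<in> I" "br i j \<in> I"
proof -
  show "i \<in> I" using assms br_out[of i j] by (cases "i \<in> I") auto
  show "j \<in> I" using assms br_out'[of j i] by (cases "j \<in> I") auto
  show "br i j \<in> I" using assms br_in by blast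
qed

fun lv :: "nat \<Rightarrow> 'b set" where
  "lv 0 = I"
| "lv (Suc s) = {p. p \<noteq> 0 \<and> (\<exists>i j. j \<in> lv s \<and> p = br i j)}"

declare lv.simps(2) [simp del]

lemma lv_SucI: "j \<in> lv s \<Longrightarrow> p = br i j \<Longrightarrow> p \<noteq> 0 \<Longrightarrow> p \<in> lv (Suc s)"
  by (auto simp: lv.simps(2))

lemma lv_SucE: assumes "p \<in> lv (Suc s)" obtains i j where "j \<in> lv s" "p = br i j" "p \<noteq> 0"
  using assms by (auto simp: lv.simps(2))

lemma lv_sub: "lv s \<subseteq> I"
  using br_mem(3) by (cases s) (auto elim!: lv_SucE)

lemma lv_dec: "lv (Suc s) \<subseteq> lv s"
proof (induction s)
  case 0 show ?case using lv_sub[of 1] by simp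
next
  case (Suc s)
  show ?case
  proof
    fix p assume "p \<in> lv (Suc (Suc s))"
    then obtain i j where "j \<in> lv (Suc s)" "p = br i j" "p \<noteq> 0" by (rule lv_SucE)
    then show "p \<in> lv (Suc s)" using Suc lv_SucI[of j s] by auto
  qed
qed

text \<open>By \<open>nil\<close> a nonempty level cannot reproduce itself, so each step loses an
  index. This is the nilpotency of the radical, read off the table.\<close>

lemma lv_card: "card (lv s) \<le> card I - s"
proof (induction s)
  case 0 show ?case by simp
next
  case (Suc s)
  have f: "finite (lv s)" using lv_sub finite_subset fin_I by blast
  show ?case
  proof (cases "lv s = {}")
    case True then show ?thesis using lv_dec[of s] by simp
  next
    case False
    then have "lv (Suc s) \<noteq> lv s" using nil[OF lv_sub, of s] unfolding lv.simps(2) by metis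
    then have "card (lv (Suc s)) < card (lv s)" using lv_dec[of s] f psubset_card_mono by blast
    then show ?thesis using Suc by linarith
  qed
qed

lemma lv_empty: "lv (card I) = {}"
  using lv_card[of "card I"] lv_sub[of "card I"] finite_subset[OF _ fin_I] by fastforce

lemma lv_mono: "s \<le> r \<Longrightarrow> lv r \<subseteq> lv s"
  by (induction r rule: dec_induct) (use lv_dec in blast)+

text \<open>The analogue of the inclusion of [h^s, h^r] in h^(s+r) for the lower central series; the
  extra \<open>Suc\<close> comes from counting its terms from 0. The left factor is
  \<open>br u i'\<close>, and the Jacobi identity moves \<open>u\<close> to the outside or to the
  right factor, which is why \<open>j\<close> and \<open>r\<close> vary in the induction.\<close>

lemma lv_add: "i \<in> lv s \<Longrightarrow> j \<in> lv r \<Longrightarrow> br i j \<noteq> 0 \<Longrightarrow> br i j \<in> lv (Suc (s + r))"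
proof (induction s arbitrary: i j r)
  case 0 then show ?case using lv_SucI[OF 0(2) refl] by simp
next
  case (Suc s)
  obtain u i' where i: "i' \<in> lv s" "i = br u i'" using Suc.prems(1) by (rule lv_SucE)
  define p where "p = br i j"
  have p: "br (br u i') j = p" "p \<noteq> 0" using Suc i p_def by auto
  from jac[OF p] show ?case
  proof
    assume h: "br (br i' j) u = p"
    then have "br i' j \<noteq> 0" using h p(2) br_0 by (cases "br i' j = 0") simp_all
    then have ij: "br i' j \<in> lv (Suc (s + r))" using Suc i by blast
    have "br u (br i' j) = p" using h br_comm[of u "br i' j"] by simp
    then have "br u (br i' j) \<in> lv (Suc (Suc (s + r)))" using p(2) ij by (intro lv_SucI[OF ij refl]) simp
    then show ?thesis using h p_def br_comm[of u "br i' j"] by simp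
  next
    assume h: "br (br j u) i' = p"
    then have "br u j \<noteq> 0" using h p(2) br_comm[of u j] by (cases "br u j = 0") simp_all
    then have "br u j \<in> lv (Suc r)" using Suc.prems(2) by (intro lv_SucI[OF _ refl])
    moreover have h': "br i' (br u j) = p" using h br_comm by metis
    ultimately have "br i' (br u j) \<in> lv (Suc (s + Suc r))" using Suc.IH i p by blast
    then show ?thesis using h' p_def by simp
  qed
qed

text \<open>\<open>lv s\<close> are the summands of the \<open>s\<close>-th term of the lower central series of \<open>h\<close>, counted from \<open>0\<close>; the
  summands of depth \<open>1\<close> generate \<open>h\<close>, and \<open>0\<close> has depth \<open>0\<close>.\<close>

definition dep :: "'b \<Rightarrow> nat" where
  "dep i = (LEAST s. i \<notin> lv s)"

lemma lv_iff: "i \<in> lv s \<longleftrightarrow> s < dep i"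
proof -
  have "i \<notin> lv (card I)" using lv_empty by simp
  then have n: "i \<notin> lv (dep i)" unfolding dep_def by (rule LeastI)
  show ?thesis
  proof
    assume "i \<in> lv s" then show "s < dep i" using n lv_mono by (meson in_mono not_le)
  next
    assume "s < dep i" then show "i \<in> lv s" unfolding dep_def using not_less_Least by blast
  qed
qed

lemma dep_pos: "i \<in> I \<longleftrightarrow> dep i \<ge> 1"
  using lv_iff[of i 0] by auto

lemma dep_add: assumes "br i j \<noteq> 0" shows "dep i + dep j \<le> dep (br i j)"
proof -
  have "dep i \<ge> 1" "dep j \<ge> 1" using br_mem[OF assms] dep_pos by auto
  then have "i \<in> lv (dep i - 1)" "j \<in> lv (dep j - 1)" using lv_iff by auto
  from lv_add[OF this assms] have "Suc (dep i - 1 + (dep j - 1)) < dep (br i j)" using lv_iff by blast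
  then show ?thesis using \<open>dep i \<ge> 1\<close> \<open>dep j \<ge> 1\<close> by linarith
qed

text \<open>A factor \<open>j\<close> of depth at least \<open>dep p - 1\<close> exists by
  construction of the levels. The estimate \<open>dep_add\<close> then leaves no slack: the other
  factor is a generator and \<open>j\<close> has exactly this depth.\<close>

lemma dep_split: assumes "dep p \<ge> 2" shows "\<exists>g j. br g j = p \<and> dep g = 1 \<and> dep j = dep p - 1"
proof -
  have "p \<in> lv (Suc (dep p - 2))" using assms by (subst lv_iff) simp
  then obtain g j where gj: "j \<in> lv (dep p - 2)" "p = br g j" "p \<noteq> 0" by (rule lv_SucE)
  have "dep j > dep p - 2" using gj lv_iff by blast
  moreover have "dep g + dep j \<le> dep p" "dep g \<ge> 1" using dep_add gj br_mem dep_pos by auto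
  ultimately have "dep g = 1 \<and> dep j = dep p - 1" using assms by linarith
  then show ?thesis using gj by auto
qed

lemma dep_br: "br i j \<noteq> 0 \<Longrightarrow> dep (br i j) > dep i \<and> dep (br i j) > dep j"
  using dep_add[of i j] br_mem[of i j] dep_pos by fastforce

text \<open>A trivial summand is the value of a bracket, and such a value has depth at least
  2.\<close>

lemma gen_nontriv: assumes "dep g = 1" shows "d g \<ge> 2"
proof -
  have g: "g \<in> I" using assms dep_pos by auto
  have "d g \<noteq> 1"
  proof
    assume "d g = 1"
    then obtain j l where jl: "br j l = g" using triv_nongen g by blast
    then have "br j l \<noteq> 0" using jl g zero_I by metis
    then show False using dep_add[of j l] br_mem(1,2)[of j l] dep_pos[of j] dep_pos[of l] assms jl by auto
  qed
  then show ?thesis using d_pos[OF g] by linarith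
qed

text \<open>Induction on the depth of \<open>j\<close>: once \<open>j\<close> is the bracket of a
  generator with a shallower index, the Jacobi identity leaves only brackets of \<open>x\<close>
  that are already known to vanish.\<close>

lemma central_gens: assumes "\<And>g. dep g = 1 \<Longrightarrow> br x g = 0" shows "br x j = 0"
proof (induction "dep j" arbitrary: j rule: less_induct)
  case less
  show ?case
  proof (cases "dep j \<ge> 2")
    case True
    then obtain g i where gi: "br g i = j" "dep g = 1" "dep i = dep j - 1" using dep_split by blast
    have xi: "br i x = 0" using less[of i] gi True br_comm by (metis One_nat_def Suc_pred diff_less dep_pos gi(3) le_trans one_le_numeral zero_less_one order_less_le_trans)
    have xg: "br x g = 0" using assms gi by blast
    show ?thesis
    proof (rule ccontr)
      assume n: "br x j \<noteq> 0"
      then have "br (br g i) x = br x j" using gi br_comm by metis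
      from jac[OF this n] show False using xi xg n by auto
    qed
  next
    case False
    then have "dep j = 1 \<or> j \<notin> I" using dep_pos[of j] by linarith
    then show ?thesis using assms br_out' by blast
  qed
qed

lemma wt': 
  assumes "\<And>i j. i \<in> I \<Longrightarrow> j \<in> I \<Longrightarrow> br i j \<noteq> 0 \<Longrightarrow> w (br i j) = w i + w j" "i \<in> I"
  shows "w i = (0::int)"
proof (rule wt[OF _ assms(2)])
  fix i j assume "br i j \<noteq> 0" then show "w (br i j) = w i + w j" using assms(1) br_mem by blast
qed

lemma strict: "\<exists>i j. br i j \<noteq> 0 \<and> dep (br i j) > dep i + dep j"
proof (rule ccontr)
  assume c: "\<not> ?thesis"
  obtain p where p: "p \<in> I" using I_ne by blast
  have "(int (dep p)) = 0"
  proof (rule wt[of "\<lambda>i. int (dep i)"])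
    fix i j assume "br i j \<noteq> 0"
    then show "int (dep (br i j)) = int (dep i) + int (dep j)" using c dep_add[of i j] by fastforce
  qed (rule p)
  then show False using dep_pos[of p] p by auto
qed

text \<open>If there were a single generator, then \<open>dep\<close> would be a weight.\<close>

lemma two_gens: "\<exists>a b. a \<noteq> b \<and> dep a = 1 \<and> dep b = 1"
proof (rule ccontr)
  assume c: "\<not> ?thesis"
  from strict obtain i j where ij: "br i j \<noteq> 0" "dep (br i j) > dep i + dep j" by auto
  have ex: "\<exists>g. dep g = 1"
  proof -
    obtain p where "p \<in> I" using I_ne by blast
    then have p: "dep p \<ge> 1" using dep_pos by blast
    show ?thesis
    proof (cases "dep p \<ge> 2")
      case True then show ?thesis using dep_split[of p] by auto
    next
      case False then have "dep p = 1" using p by linarith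
      then show ?thesis by blast
    qed
  qed
  then obtain a where a: "dep a = 1" by blast
  have au: "g = a" if "dep g = 1" for g
  proof (rule ccontr)
    assume "g \<noteq> a" then show False using c a that by metis
  qed
  \<comment> \<open>With a single generator \<open>a\<close>, two indices of the same depth are both
    \<open>br a\<close> of an index one level before, so each level has at most one index.\<close>
  have lev: "dep p = s \<Longrightarrow> dep q = s \<Longrightarrow> s \<ge> 1 \<Longrightarrow> p = q" for p q s
  proof (induction s arbitrary: p q)
    case 0 then show ?case by simp
  next
    case (Suc s)
    show ?case
    proof (cases "s = 0")
      case True
      then have "p = a" "q = a" using Suc.prems au[of p] au[of q] by simp_all
      then show ?thesis by simp
    next
      case False
      then have "dep p \<ge> 2" "dep q \<ge> 2" using Suc.prems by simp_all
      obtain g i where 1: "br g i = p" "dep g = 1" "dep i = dep p - 1" using dep_split[OF \<open>dep p \<ge> 2\<close>] by auto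
      obtain g' i' where 2: "br g' i' = q" "dep g' = 1" "dep i' = dep q - 1" using dep_split[OF \<open>dep q \<ge> 2\<close>] by auto
      have "dep i = s" "dep i' = s" "s \<ge> 1" using 1(3) 2(3) Suc.prems(1,2) False by simp_all
      then have "i = i'" using Suc.IH by blast
      then show ?thesis using 1(1) 2(1) au[OF 1(2)] au[OF 2(2)] by metis
    qed
  qed
  \<comment> \<open>Depths have no gaps: splitting off generators from \<open>p\<close> meets every
    smaller positive depth.\<close>
  have lower: "dep p = Suc s \<Longrightarrow> r < Suc s \<Longrightarrow> r \<ge> 1 \<Longrightarrow> \<exists>q. dep q = r" for p s r
  proof (induction s arbitrary: p)
    case 0 then show ?case by simp
  next
    case (Suc s)
    have "dep p \<ge> 2" using Suc.prems by simp
    then obtain g q where q: "dep q = dep p - 1" using dep_split[of p] by auto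
    show ?case
    proof (cases "r = Suc s")
      case True then show ?thesis using q Suc.prems by auto
    next
      case False then show ?thesis using Suc.IH[of q] q Suc.prems by simp
    qed
  qed
  \<comment> \<open>Induction on the depth of the left factor. For the generator \<open>a\<close>,
    the depth \<open>dep j + 1\<close> is occupied, and by uniqueness within levels its index is
    \<open>br a j\<close>. A deeper \<open>i\<close> is \<open>br a i'\<close>, and the Jacobi
    identity leads back to shallower left factors.\<close>
  have add: "br i j \<noteq> 0 \<Longrightarrow> dep i = s \<Longrightarrow> dep (br i j) = dep i + dep j" for i j s
  proof (induction s arbitrary: i j rule: less_induct)
    case (less s)
    have s: "s \<ge> 1" "dep j \<ge> 1" using br_mem[OF less(2)] less(3) dep_pos by auto
    have ge: "dep (br i j) \<ge> dep i + dep j" using dep_add[OF less(2)] .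
    show ?case
    proof (cases "s = 1")
      case True
      then have ia: "i = a" using less(3) au by simp
      define r where "r = Suc (dep j)"
      have ger: "dep (br i j) \<ge> r" using ge r_def less(3) True by simp
      have "\<exists>q. dep q = r"
      proof (cases "dep (br i j) = r")
        case True then show ?thesis by blast
      next
        case False
        have "dep (br i j) = Suc (dep (br i j) - 1)" using ger r_def by simp
        moreover have "r < Suc (dep (br i j) - 1)" using False ger by simp
        ultimately show ?thesis using lower[of "br i j" "dep (br i j) - 1" r] r_def by simp
      qed
      then obtain q where q: "dep q = r" by blast
      then have "dep q \<ge> 2" using r_def s by simp
      then obtain g i' where gi: "br g i' = q" "dep g = 1" "dep i' = dep q - 1" using dep_split[of q] by auto
      then have "i' = j" using lev[of i' "dep j" j] s q r_def by simp
      then have "br i j = q" using gi au[OF gi(2)] ia by simp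
      then show ?thesis using q r_def less(3) True by simp
    next
      case False
      then have "dep i \<ge> 2" using less(3) s by simp
      then obtain g i' where g: "br g i' = i" "dep g = 1" "dep i' = dep i - 1" using dep_split[of i] by auto
      then have i': "br a i' = i" "dep i' = s - 1" using au less(3) by auto
      define p where "p = br i j"
      have p: "br (br a i') j = p" "p \<noteq> 0" using i' less(2) p_def by auto
      have lt: "s - 1 < s" "1 < s" using s False by auto
      from jac[OF p] show ?thesis
      proof
        assume h: "br (br i' j) a = p"
        then have n: "br i' j \<noteq> 0" using p(2) br_0 by (cases "br i' j = 0") auto
        have d1: "dep (br i' j) = (s - 1) + dep j" using less.IH[OF lt(1) n i'(2)] i'(2) by simp
        have h': "br a (br i' j) = p" using h br_comm[of a] by simp
        then have "dep (br a (br i' j)) = 1 + dep (br i' j)"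
          using less.IH[OF lt(2), of a "br i' j"] a p(2) by simp
        then show ?thesis using h' p_def less(3) s d1 by simp
      next
        assume h: "br (br j a) i' = p"
        then have n: "br a j \<noteq> 0" using p(2) br_0 br_comm[of a j] by (cases "br a j = 0") auto
        have d1: "dep (br a j) = 1 + dep j" using less.IH[OF lt(2) n a] a by simp
        have h': "br i' (br a j) = p" using h br_comm[of i'] br_comm[of a j] by simp
        then have "dep p = (s - 1) + dep (br a j)" using less.IH[OF lt(1), of i' "br a j"] i' p(2) by simp
        then show ?thesis using p_def less(3) s d1 by simp
      qed
    qed
  qed
  show False using ij(2) add[OF ij(1) refl] by simp
qed

lemma top_central: "i \<in> I \<Longrightarrow> (\<And>j. j \<in> I \<Longrightarrow> dep j \<le> dep i) \<Longrightarrow> br i j = 0"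
  using dep_br[of i j] br_in[of i j] by fastforce

text \<open>A bracket at which the depth is not additive has a value of depth at least 3. Splitting
  this once and adding a second generator gives four different indices.\<close>

lemma four_indices: "\<exists>a b c p. a \<noteq> b \<and> dep a = 1 \<and> dep b = 1 \<and> br a c = p \<and> dep p \<ge> 3 \<and> dep c = dep p - 1
  \<and> {a,b,c,p} \<subseteq> I \<and> card {a,b,c,p} = 4"
proof -
  from strict obtain i j where ij: "br i j \<noteq> 0" "dep (br i j) > dep i + dep j" by auto
  define p where "p = br i j"
  have "dep i \<ge> 1" "dep j \<ge> 1" using br_mem[OF ij(1)] dep_pos by blast+
  then have p: "dep p \<ge> 3" using ij(2) unfolding p_def by linarith
  then have "dep p \<ge> 2" by linarith
  then obtain g c where gc: "br g c = p" "dep g = 1" "dep c = dep p - 1" using dep_split by blast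
  obtain a b where ab: "a \<noteq> b" "dep a = 1" "dep b = 1" using two_gens by blast
  obtain b' where b: "g \<noteq> b'" "dep b' = 1" using ab by metis
  have sub: "{g,b',c,p} \<subseteq> I" using gc b p dep_pos[of g] dep_pos[of b'] dep_pos[of c] dep_pos[of p] by auto
  have "c \<noteq> g" "c \<noteq> b'" "c \<noteq> p" "p \<noteq> g" "p \<noteq> b'" using gc b p by auto
  then have "card {g,b',c,p} = 4" using b by simp
  then show ?thesis using gc b p sub by blast
qed

lemma card_ge_4: "card I \<ge> 4"
  using four_indices card_mono[OF fin_I] by metis

text \<open>Two generators and a central index of maximal depth are nontrivial, hence here of
  dimension at least 3. A summand of dimension at least 4 among them, with a fourth index, needs 4 +
  3 + 3 + 1 = 11 dimensions; outside them it needs 13.\<close>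

lemma odd_dims:
  assumes no2: "\<And>i. i \<in> I \<Longrightarrow> d i \<noteq> 2" and s: "sum d I \<le> 10" and i: "i \<in> I"
  shows "d i = 1 \<or> d i = 3"
proof (rule ccontr)
  assume "\<not> ?thesis"
  then have di: "d i \<ge> 4" using no2[OF i] d_pos[OF i] by linarith
  have "Max (dep ` I) \<in> dep ` I" using fin_I I_ne by simp
  then obtain z where z: "z \<in> I" "dep z = Max (dep ` I)" by auto
  then have zt: "dep j \<le> dep z" if "j \<in> I" for j using that fin_I by simp
  then have "br z j = 0" for j using top_central z(1) by blast
  then have "d z \<noteq> 1" using central_nontriv[OF z(1)] by blast
  then have dz: "d z \<ge> 3" using no2[OF z(1)] d_pos[OF z(1)] by linarith
  obtain a b c p where ab: "a \<noteq> b" "dep a = 1" "dep b = 1" "dep p \<ge> 3" "{a,b,c,p} \<subseteq> I" using four_indices by blast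
  then have aI: "a \<in> I" "b \<in> I" by auto
  have dab: "d a \<ge> 3" "d b \<ge> 3" using gen_nontriv[OF ab(2)] gen_nontriv[OF ab(3)] no2 aI by fastforce+
  have "dep z \<ge> 3" using zt[of p] ab by auto
  then have zab: "z \<noteq> a" "z \<noteq> b" using ab by auto
  have sub: "{a,b,z} \<subseteq> I" using aI z by blast
  show False
  proof (cases "i \<in> {a,b,z}")
    case True
    have c3: "card {a,b,z} = 3" using ab(1) zab by simp
    then have "\<not> I \<subseteq> {a,b,z}" using card_mono[of "{a,b,z}" I] card_ge_4 by fastforce
    then obtain j where j: "j \<in> I" "j \<notin> {a,b,z}" by blast
    have "sum d (insert j {a,b,z}) \<le> sum d I" by (rule sum_mono2[OF fin_I]) (use j sub in auto)
    then have "d j + (d a + (d b + d z)) \<le> 10" using j ab(1) zab s by simp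
    then show False using d_pos[OF j(1)] dab dz di True by auto
  next
    case False
    have "sum d (insert i {a,b,z}) \<le> sum d I" by (rule sum_mono2[OF fin_I]) (use i sub in auto)
    then have "d i + (d a + (d b + d z)) \<le> 10" using False ab(1) zab s by simp
    then show False using dab dz di by linarith
  qed
qed

end

text \<open>In \<open>sym_triv\<close>, the bracket of \<open>[t, V\<^sub>i]\<close> and \<open>V\<^sub>i\<close> would otherwise be a symmetric
  and invariant, hence zero, form on the two-dimensional \<open>V\<^sub>i\<close>. In \<open>cubic_triv\<close>, the Jacobi identity
  yields \<open>3 [t, s] = 0\<close> if both \<open>br t b\<close> and \<open>br s a\<close> are \<open>c\<close>.\<close>

locale bracket_table = bracket_table_base I br d for I :: "'b::zero set" and br d +
  assumes central_uniq: "card I \<ge> 5 \<Longrightarrow> i \<in> I \<Longrightarrow> j \<in> I \<Longrightarrow> (\<And>l. br i l = 0) \<Longrightarrow> (\<And>l. br j l = 0) \<Longrightarrow> i = j"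
    and triv_act: "br i j \<noteq> 0 \<Longrightarrow> d i = 1 \<Longrightarrow> d (br i j) = d j"
    and triv_dual: "br i j \<noteq> 0 \<Longrightarrow> d (br i j) = 1 \<Longrightarrow> d i = d j"
    and parity: "br i j \<noteq> 0 \<Longrightarrow> odd (d i + d j + d (br i j))"
    and sq_odd: "br i i \<noteq> 0 \<Longrightarrow> odd (d i) \<Longrightarrow> d (br i i) \<noteq> 1"
    and sq_two: "br i i \<noteq> 0 \<Longrightarrow> d i = 2 \<Longrightarrow> d (br i i) = 1"
    and sq_triv: "d i = 1 \<Longrightarrow> br i i = 0"
    and jac_triv: "br (br i j) l = p \<Longrightarrow> p \<noteq> 0 \<Longrightarrow> d (br i j) = 1 \<Longrightarrow> d l \<ge> 2 \<Longrightarrow>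
       br j l = 0 \<or> d (br j l) = 1 \<Longrightarrow> br (br l i) j = p"
    and sym_triv: "d i = 2 \<Longrightarrow> d t = 1 \<Longrightarrow> br t i = c \<Longrightarrow> c \<noteq> 0 \<Longrightarrow> br t (br i i) = 0 \<Longrightarrow> br c i \<noteq> 0 \<Longrightarrow> d (br c i) \<noteq> 1"
    and cubic_triv: "d a = 2 \<Longrightarrow> d b = 2 \<Longrightarrow> br a a = t \<Longrightarrow> br a b = s \<Longrightarrow> d t = 1 \<Longrightarrow> d s = 1 \<Longrightarrow>
       br t b = c \<Longrightarrow> br s a = c \<Longrightarrow> c \<noteq> 0 \<Longrightarrow> br (br t a) b = 0 \<Longrightarrow> br c a = 0"
    and dim_sum: "(\<Sum>i\<in>I. d i) \<le> 11"

section \<open>Tables with four summands\<close>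

context bracket_table begin

text \<open>The depths leave open only the three products of the generators \<open>a\<close>,
  \<open>b\<close>, each with three possible values, and \<open>br b c\<close>. Explicit weights
  exclude most combinations; parity and the bound 11 exclude the others.\<close>

lemma four_with_central_top:
  assumes I: "I = {a,b,c,z}" and dist: "distinct [a,b,c,z]"
    and dep: "dep a = 1" "dep b = 1" "dep c = 2" "dep z = 3" and ac: "br a c = z"
  shows False
proof -
  have nz: "a \<noteq> 0" "b \<noteq> 0" "c \<noteq> 0" "z \<noteq> 0" using zero_I I by auto
  have z0: "br z x = 0" "br x z = 0" for x
  proof -
    show "br z x = 0" by (rule top_central) (use I dep in auto)
    then show "br x z = 0" using br_comm by metis
  qed
  have cc: "br c c = 0" using dep_add[of c c] br_in[of c c] I dep by (cases "br c c = 0") auto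
  have bc: "br b c = 0 \<or> br b c = z" using dep_add[of b c] br_in[of b c] I dep by (cases "br b c = 0") auto
  have gg: "br x y = 0 \<or> br x y = c \<or> br x y = z" if "x \<in> {a,b}" "y \<in> {a,b}" for x y
    using dep_add[of x y] br_in[of x y] I dep that by (cases "br x y = 0") auto
  have gaa: "br a a = 0 \<or> br a a = c \<or> br a a = z" by (rule gg) simp_all
  have gab: "br a b = 0 \<or> br a b = c \<or> br a b = z" by (rule gg) simp_all
  have gbb: "br b b = 0 \<or> br b b = c \<or> br b b = z" by (rule gg) simp_all
  have ba: "br b a = br a b" "br c a = z" "br c b = br b c" using br_comm ac by auto
  have W0: "\<alpha> = 0 \<and> \<beta> = 0 \<and> \<gamma> = 0 \<and> \<zeta> = 0" if
      "br a a = c \<longrightarrow> \<gamma> = 2 * \<alpha>" "br a a = z \<longrightarrow> \<zeta> = 2 * \<alpha>"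
      "br a b = c \<longrightarrow> \<gamma> = \<alpha> + \<beta>" "br a b = z \<longrightarrow> \<zeta> = \<alpha> + \<beta>"
      "br b b = c \<longrightarrow> \<gamma> = 2 * \<beta>" "br b b = z \<longrightarrow> \<zeta> = 2 * \<beta>"
      "br b c = z \<longrightarrow> \<zeta> = \<beta> + \<gamma>" "\<zeta> = \<alpha> + \<gamma>" for \<alpha> \<beta> \<gamma> \<zeta> :: int
  proof -
    define w where "w x = (if x = a then \<alpha> else if x = b then \<beta> else if x = c then \<gamma> else \<zeta>)" for x
    have wv: "w a = \<alpha>" "w b = \<beta>" "w c = \<gamma>" "w z = \<zeta>" using dist unfolding w_def by auto
    have P: "br a a \<noteq> 0 \<longrightarrow> w (br a a) = w a + w a" 
      using gaa that(1,2) wv by (elim disjE) simp_all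
    have P2: "br a b \<noteq> 0 \<longrightarrow> w (br a b) = w a + w b"
      using gab that(3,4) wv by (elim disjE) simp_all
    have P3: "br b b \<noteq> 0 \<longrightarrow> w (br b b) = w b + w b"
      using gbb that(5,6) wv by (elim disjE) simp_all
    have P4: "br b c \<noteq> 0 \<longrightarrow> w (br b c) = w b + w c"
      using bc that(7) wv by (elim disjE) simp_all
    have P5: "w z = w a + w c" using that(8) wv by simp
    have "w x = 0" if "x \<in> I" for x
    proof (rule wt'[OF _ that])
      fix i j assume "i \<in> I" "j \<in> I" "br i j \<noteq> 0"
      then show "w (br i j) = w i + w j" unfolding I
        by (elim insertE emptyE) (use P P2 P3 P4 P5 z0 cc ba ac in simp_all)
    qed
    then have "w a = 0" "w b = 0" "w c = 0" "w z = 0" using I by simp_all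
    then show ?thesis using wv by simp
  qed
  \<comment> \<open>Instantiations of \<open>W\<close> list the weights of \<open>c\<close>,
    \<open>a\<close>, \<open>z\<close>, \<open>b\<close> in this order, which is the order of first
    occurrence. Every compatible choice with nonzero weight of \<open>a\<close> is a
    contradiction.\<close>
  have W: "(br a a = c \<longrightarrow> \<gamma> = 2 * \<alpha>) \<and> (br a a = z \<longrightarrow> \<zeta> = 2 * \<alpha>) \<and>
      (br a b = c \<longrightarrow> \<gamma> = \<alpha> + \<beta>) \<and> (br a b = z \<longrightarrow> \<zeta> = \<alpha> + \<beta>) \<and>
      (br b b = c \<longrightarrow> \<gamma> = 2 * \<beta>) \<and> (br b b = z \<longrightarrow> \<zeta> = 2 * \<beta>) \<and>
      (br b c = z \<longrightarrow> \<zeta> = \<beta> + \<gamma>) \<and> \<zeta> = \<alpha> + \<gamma> \<longrightarrow> \<alpha> = 0" for \<alpha> \<beta> \<gamma> \<zeta> :: int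
    using W0[of \<gamma> \<alpha> \<zeta> \<beta>] by blast
  have dd: "d a \<ge> 2" "d b \<ge> 2" using gen_nontriv dep by auto
  have dz: "d z \<ge> 2"
    using central_nontriv[of z] z0 d_pos[of z] I by fastforce
  have dc: "d c \<ge> 1" using d_pos I by auto
  have sum: "d a + d b + d c + d z \<le> 11" using dim_sum I dist by auto
  \<comment> \<open>If all dimensions are odd, the nontrivial \<open>a\<close>, \<open>b\<close>,
    \<open>z\<close> take at least 9 of the 11 dimensions and \<open>c\<close> is trivial. Squares
    of odd-dimensional summands are not trivial, so \<open>c\<close> is \<open>br a b\<close>, and
    \<open>jac_triv\<close> asks for a square of \<open>a\<close> that does not exist.\<close>
  have odd_case: False if o: "odd (d a)" "odd (d b)" "odd (d c)" "odd (d z)"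
  proof -
    have "d a \<noteq> 2" "d b \<noteq> 2" "d z \<noteq> 2" "d c \<noteq> 2" using o by auto
    then have c1: "d c = 1" using sum dd dz dc by linarith
    then have "br a a \<noteq> c" "br b b \<noteq> c" using sq_odd[of a] sq_odd[of b] o nz by auto
    moreover obtain x y where "br x y = c" "dep x = 1" "dep y = 1" using dep_split[of c] dep by auto
    moreover then have "x \<in> I" "y \<in> I" using br_mem[of x y] nz by auto
    ultimately have abc: "br a b = c" using I dep br_comm[of a b] by auto
    have "br (br a a) b = z"
    proof (rule jac_triv)
      show "br (br a b) a = z" using abc ba by simp
    qed (use nz abc c1 dd ba in simp_all)
    then show False using gaa \<open>br a a \<noteq> c\<close> z0 nz by auto
  qed
  have par: "br x y = u \<Longrightarrow> u \<noteq> 0 \<Longrightarrow> odd (d x + d y + d u)" for x y u using parity[of x y] by auto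
  have pac: "odd (d a + d c + d z)" using par ac nz by blast
  show False
  proof (cases "br b c = z")
    case True
    have pbc: "odd (d b + d c + d z)" using par True nz by blast
    have cz: "c \<noteq> z" using dist by simp
    \<comment> \<open>Otherwise weight 1 on both generators, 2 on \<open>c\<close> and 3 on
      \<open>z\<close> is compatible.\<close>
    have "br a a = z \<or> br a b = z \<or> br b b = z"
    proof (rule ccontr)
      assume n: "\<not> ?thesis"
      show False using W[of 2 1 3 1] n by simp
    qed
    then have oz: "odd (d z)" using par[of a a z] par[of b b z] par[of a b z] pac pbc nz by auto
    obtain x y where xy: "br x y = c" "dep x = 1" "dep y = 1" using dep_split[of c] dep by auto
    then have "x \<in> I" "y \<in> I" using br_mem[of x y] nz by auto
    then have "br a a = c \<or> br a b = c \<or> br b b = c" using xy I dep br_comm[of a b] by auto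
    then have oc: "odd (d c)" using par[of a a c] par[of b b c] par[of a b c] pac pbc nz by auto
    show False using odd_case oz oc pac pbc by auto
  next
    case False
    then have bc0: "br b c = 0" using bc by auto
    have bbc: "br b b \<noteq> c"
    proof
      assume h: "br b b = c"
      have "br (br b b) a = z" using h ba by auto
      from jac[OF this nz(4)] show False using gab ba z0 bc0 nz by auto
    qed
    have cz: "c \<noteq> z" using dist by simp
    \<comment> \<open>In this and the next two case lists the weights solve the linear equations
      given by the nonzero brackets; the conclusion is that all three products of generators are
      nonzero.\<close>
    have ne1: "br a a \<noteq> 0"
    proof
      assume h: "br a a = 0"
      consider "br a b = 0" "br b b = 0" | "br a b = 0" "br b b = c" | "br a b = 0" "br b b = z" | "br a b = c" "br b b = 0" | "br a b = c" "br b b = c" | "br a b = c" "br b b = z" | "br a b = z" "br b b = 0" | "br a b = z" "br b b = c" | "br a b = z" "br b b = z"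
        using gab gbb by argo
      then show False
      proof cases
        case 1 then show False using W[of 2 1 3 1] h cz nz bc0 by simp
      next
        case 2 then show False using bbc by simp
      next
        case 3 then show False using W[of 1 1 2 1] h cz nz bc0 by simp
      next
        case 4 then show False using W[of 2 1 3 1] h cz nz bc0 by simp
      next
        case 5 then show False using bbc by simp
      next
        case 6 then show False using W[of 3 1 4 2] h cz nz bc0 by simp
      next
        case 7 then show False using W[of 1 1 2 1] h cz nz bc0 by simp
      next
        case 8 then show False using bbc by simp
      next
        case 9 then show False using W[of 1 1 2 1] h cz nz bc0 by simp
      qed
    qed
    have ne2: "br a b \<noteq> 0"
    proof
      assume h: "br a b = 0"
      consider "br a a = 0" "br b b = 0" | "br a a = 0" "br b b = c" | "br a a = 0" "br b b = z" | "br a a = c" "br b b = 0" | "br a a = c" "br b b = c" | "br a a = c" "br b b = z" | "br a a = z" "br b b = 0" | "br a a = z" "br b b = c" | "br a a = z" "br b b = z"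
        using gaa gbb by argo
      then show False
      proof cases
        case 1 then show False using W[of 2 1 3 1] h cz nz bc0 by simp
      next
        case 2 then show False using bbc by simp
      next
        case 3 then show False using W[of 1 1 2 1] h cz nz bc0 by simp
      next
        case 4 then show False using W[of 2 1 3 1] h cz nz bc0 by simp
      next
        case 5 then show False using bbc by simp
      next
        case 6 then show False using W[of 4 2 6 3] h cz nz bc0 by simp
      next
        case 7 then show False using W[of 1 1 2 1] h cz nz bc0 by simp
      next
        case 8 then show False using bbc by simp
      next
        case 9 then show False using W[of 1 1 2 1] h cz nz bc0 by simp
      qed
    qed
    have ne3: "br b b \<noteq> 0"
    proof
      assume h: "br b b = 0"
      consider "br a a = 0" "br a b = 0" | "br a a = 0" "br a b = c" | "br a a = 0" "br a b = z" | "br a a = c" "br a b = 0" | "br a a = c" "br a b = c" | "br a a = c" "br a b = z" | "br a a = z" "br a b = 0" | "br a a = z" "br a b = c" | "br a a = z" "br a b = z"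
        using gaa gab by argo
      then show False
      proof cases
        case 1 then show False using W[of 2 1 3 1] h cz nz bc0 by simp
      next
        case 2 then show False using W[of 2 1 3 1] h cz nz bc0 by simp
      next
        case 3 then show False using W[of 1 1 2 1] h cz nz bc0 by simp
      next
        case 4 then show False using W[of 2 1 3 1] h cz nz bc0 by simp
      next
        case 5 then show False using W[of 2 1 3 1] h cz nz bc0 by simp
      next
        case 6 then show False using W[of 2 1 3 2] h cz nz bc0 by simp
      next
        case 7 then show False using W[of 1 1 2 1] h cz nz bc0 by simp
      next
        case 8 then show False using W[of 1 1 2 0] h cz nz bc0 by simp
      next
        case 9 then show False using W[of 1 1 2 1] h cz nz bc0 by simp
      qed
    qed
    have bb: "br b b = z" using gbb bbc ne3 by simp
    have oz: "odd (d z)" using par[OF bb nz(4)] by auto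
    have "br a a = c \<or> br a b = c" 
    proof (rule ccontr)
      assume "\<not> ?thesis"
      then have "br a a = z" "br a b = z" using gaa gab ne1 ne2 by auto
      then show False using W[of 1 1 2 1] bb bc0 cz nz by simp
    qed
    then show False
    proof (elim disjE)
      assume h: "br a a = c"
      then have "odd (d c)" using par[of a a c] nz by auto
      then show False using odd_case oz pac par[of a b c] par[of a b z] gab ne2 nz by auto
    next
      assume h: "br a b = c"
      show False
      proof (cases "br a a = c")
        case True
        then have "odd (d c)" using par[of a a c] nz by auto
        then show False using odd_case oz pac par[of a b c] h nz by auto
      next
        case False
        then have aa: "br a a = z" using gaa ne1 by auto
        have ob: "odd (d b)" using pac oz par[OF h nz(3)] by auto
        show False
        proof (cases "odd (d a)")
          case True then show False using odd_case oz pac ob by auto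
        next
          case False
          \<comment> \<open>The square of \<open>a\<close> is the nontrivial \<open>z\<close>, so
            \<open>a\<close> is not a plane. With parity, the dimensions of \<open>a\<close>,
            \<open>b\<close>, \<open>c\<close>, \<open>z\<close> are at least 4, 3, 2, 3, which is
            one too many.\<close>
          have "d a \<noteq> 2" using sq_two[of a] aa nz dz by auto
          moreover have "d a \<noteq> 3" "d b \<noteq> 2" "d z \<noteq> 2" "d c \<noteq> 1" using False ob oz pac by auto
          ultimately show False using sum dd dz dc by linarith
        qed
      qed
    qed
  qed
qed

text \<open>The indices of \<open>four_indices\<close> are all there are. If \<open>c\<close> had
  depth at least 3, its predecessor, of depth at least 2, would be a fifth one.\<close>

lemma card_ne_4: "card I \<noteq> 4"
proof
  assume c4: "card I = 4"
  obtain a b c p where abcp: "a \<noteq> b" "dep a = 1" "dep b = 1" "br a c = p" "dep p \<ge> 3" "dep c = dep p - 1"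
    "{a,b,c,p} \<subseteq> I" "card {a,b,c,p} = 4" using four_indices by blast
  have I: "I = {a,b,c,p}" using card_subset_eq[OF fin_I abcp(7)] abcp(8) c4 by simp
  have "\<not> dep c \<ge> 3"
  proof
    assume h: "dep c \<ge> 3"
    then obtain u where u: "dep u = dep c - 1" using dep_split[of c] by auto
    then have "u \<in> I" using dep_pos[of u] h by auto
    then show False using I u h abcp by auto
  qed
  then have dc: "dep c = 2" "dep p = 3" using abcp by auto
  have "distinct [a,b,c,p]" using abcp(1-3) dc by auto
  then show False using four_with_central_top[OF I _ abcp(2,3) dc abcp(4)] by blast
qed

end

lemma card2_sub: assumes "card T \<ge> 2" "T \<subseteq> {y, z}" shows "y \<in> T" "z \<in> T"
proof -
  have "\<not> T \<subseteq> {u}" for u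
  proof
    assume "T \<subseteq> {u}" then have "card T \<le> card {u}" by (intro card_mono) auto
    then show False using assms(1) by simp
  qed
  then show "y \<in> T" "z \<in> T" using assms(2) by blast+
qed

section \<open>Tables with at least five summands and their unique central index\<close>

locale large_bracket_table = bracket_table I br d for I :: "'b::zero set" and br d +
  fixes z :: 'b
  assumes card5: "card I \<ge> 5" and zI: "z \<in> I" and z_l: "br z j = 0"
begin

lemma z_r [simp]: "br j z = 0" "br z j = 0"
  using z_l br_comm[of j z] by simp_all

lemma zz: "x = 0 \<or> x = z \<Longrightarrow> br x y = 0"
  by auto

lemma z_uniq: "x \<in> I \<Longrightarrow> (\<And>j. br x j = 0) \<Longrightarrow> x = z"
  using central_uniq[OF card5 _ zI] z_l by blast

lemma not_central: assumes "x \<in> I" "x \<noteq> z" shows "\<exists>g. dep g = 1 \<and> br x g \<noteq> 0"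
proof (rule ccontr)
  assume "\<not> ?thesis"
  then have "br x j = 0" for j using central_gens[of x j] by blast
  then show False using z_uniq[OF assms(1)] assms(2) by blast
qed

text \<open>Every index of maximal depth is central, and \<open>z\<close> is the only central
  index.\<close>

lemma z_dep: assumes "x \<in> I" "x \<noteq> z" shows "dep x < dep z"
proof -
  have "Max (dep ` I) \<in> dep ` I" using fin_I I_ne by simp
  then obtain y where y: "y \<in> I" "dep y = Max (dep ` I)" by auto
  then have "dep j \<le> dep y" if "j \<in> I" for j using that fin_I by simp
  then have "br y j = 0" for j using top_central y(1) by blast
  then have "y = z" using z_uniq y(1) by blast
  then have le: "dep j \<le> dep z" if "j \<in> I" for j using y that fin_I by simp
  show ?thesis
  proof (rule ccontr)
    assume "\<not> ?thesis"
    then have "dep x = dep z" using le[OF assms(1)] by simp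
    then have "br x j = 0" for j using top_central[OF assms(1)] le by simp
    then show False using z_uniq assms by blast
  qed
qed

lemma z_nontriv: "d z \<ge> 2"
  using central_nontriv[OF zI z_l] d_pos[OF zI] by linarith

lemma z_dep3: "dep z \<ge> 3"
proof -
  from strict obtain i j where ij: "br i j \<noteq> 0" "dep (br i j) > dep i + dep j" by auto
  have "dep i \<ge> 1" "dep j \<ge> 1" using br_mem[OF ij(1)] dep_pos by blast+
  then have "dep (br i j) \<ge> 3" using ij(2) by linarith
  moreover have "dep (br i j) \<le> dep z" using z_dep[OF br_mem(3)[OF ij(1)]] by (cases "br i j = z") auto
  ultimately show ?thesis by linarith
qed

lemma gen_I: "dep g = 1 \<Longrightarrow> g \<in> I"
  using dep_pos by simp

lemma gen_not_z: "dep g = 1 \<Longrightarrow> g \<noteq> z"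
  using z_dep3 by auto

lemma I_nz: "x \<in> I \<Longrightarrow> x \<noteq> 0"
  using zero_I by blast

lemma br_not_gen: "br i j \<noteq> 0 \<Longrightarrow> dep (br i j) \<noteq> 1"
  using dep_br[of i j] br_mem(1)[of i j] dep_pos[of i] by auto

lemma nongen_dep: "x \<in> I \<Longrightarrow> dep x \<noteq> 1 \<Longrightarrow> dep x \<ge> 2"
  using dep_pos[of x] by auto

lemma no_wt: "(\<And>i j. br i j \<noteq> 0 \<Longrightarrow> w (br i j) = w i + w j) \<Longrightarrow> x \<in> I \<Longrightarrow> w x \<noteq> (0::int) \<Longrightarrow> False"
  using wt[of w x] by blast

text \<open>\<open>HH\<close> stands for the \<open>sl\<^sub>2\<close>-modules of half-integral spin, \<open>TT\<close> for the trivial ones and \<open>EE\<close> for the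
  other ones of integral spin.\<close>

definition "TT = {x \<in> I. d x = 1}"
definition "HH = {x \<in> I. even (d x)}"
definition "EE = {x \<in> I. odd (d x) \<and> d x \<noteq> 1}"

lemma fin: "finite TT" "finite HH" "finite EE"
  unfolding TT_def HH_def EE_def using fin_I by simp_all

lemma parts: "I = TT \<union> HH \<union> EE" "TT \<inter> HH = {}" "TT \<inter> EE = {}" "HH \<inter> EE = {}"
  unfolding TT_def HH_def EE_def by auto

lemma card_parts: "card I = card TT + card HH + card EE"
  using card_Un_disjoint[OF fin(1,2) parts(2)] card_Un_disjoint[of "TT \<union> HH" EE] fin parts by auto

lemma sum_parts: "sum d TT + sum d HH + sum d EE \<le> 11"
proof -
  have "sum d I = sum d (TT \<union> HH) + sum d EE"
    using parts fin sum.union_disjoint[of "TT \<union> HH" EE d] by auto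
  also have "sum d (TT \<union> HH) = sum d TT + sum d HH"
    using parts fin sum.union_disjoint[of TT HH d] by auto
  finally show ?thesis using dim_sum by simp
qed

lemma d_HH: "x \<in> HH \<Longrightarrow> d x \<ge> 2"
  unfolding HH_def using d_pos[of x] by (cases "d x = 1") auto

lemma d_EE: "x \<in> EE \<Longrightarrow> d x \<ge> 3"
  unfolding EE_def using d_pos[of x] by (cases "d x = 2") auto

lemma sum_bounds: "sum d TT = card TT" "sum d HH \<ge> 2 * card HH" "sum d EE \<ge> 3 * card EE"
proof -
  show "sum d TT = card TT" unfolding TT_def by simp
  show "sum d HH \<ge> 2 * card HH" using sum_bounded_below[of HH 2 d] d_HH by (simp add: mult.commute)
  show "sum d EE \<ge> 3 * card EE" using sum_bounded_below[of EE 3 d] d_EE by (simp add: mult.commute)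
qed

lemma TT_act: "t \<in> TT \<Longrightarrow> br t x \<noteq> 0 \<Longrightarrow> d (br t x) = d x"
  using triv_act[of t x] unfolding TT_def by simp

lemma TT_nongen: "t \<in> TT \<Longrightarrow> dep t \<ge> 2"
  using gen_nontriv[of t] nongen_dep[of t] unfolding TT_def by auto

lemma TT_noncentral: "t \<in> TT \<Longrightarrow> t \<noteq> z"
  using z_nontriv unfolding TT_def by auto

lemma HH_HH: "x \<in> HH \<Longrightarrow> y \<in> HH \<Longrightarrow> br x y \<noteq> 0 \<Longrightarrow> br x y \<in> TT \<union> EE"
  using parity[of x y] br_in[of x y] unfolding HH_def TT_def EE_def by auto

lemma HH_odd: "x \<in> HH \<Longrightarrow> y \<in> TT \<union> EE \<Longrightarrow> br x y \<noteq> 0 \<Longrightarrow> br x y \<in> HH"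
  using parity[of x y] br_in[of x y] unfolding HH_def TT_def EE_def by auto

lemma odd_odd: "x \<in> TT \<union> EE \<Longrightarrow> y \<in> TT \<union> EE \<Longrightarrow> br x y \<noteq> 0 \<Longrightarrow> br x y \<in> TT \<union> EE"
  using parity[of x y] br_in[of x y] unfolding HH_def TT_def EE_def by auto

text \<open>Parity of dimensions grades the table modulo 2. If no two even-dimensional summands had
  a nonzero bracket, weight 1 on them and 0 elsewhere would be compatible over the integers.\<close>

lemma HH_bracket: assumes "HH \<noteq> {}" shows "\<exists>x\<in>HH. \<exists>y\<in>HH. br x y \<noteq> 0"
proof (rule ccontr)
  assume c: "\<not> ?thesis"
  obtain x where x: "x \<in> HH" using assms by blast
  define w where "w x = (if x \<in> HH then 1 else 0 :: int)" for x
  show False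
  proof (rule no_wt[of w x])
    fix i j assume n: "br i j \<noteq> 0"
    then have m: "i \<in> TT \<union> HH \<union> EE" "j \<in> TT \<union> HH \<union> EE" using br_mem(1,2)[OF n] parts(1) by simp_all
    show "w (br i j) = w i + w j"
    proof (cases "i \<in> HH")
      case True
      then have "j \<notin> HH" "j \<in> TT \<union> EE" using c n m by auto
      then have "br i j \<in> HH" using HH_odd[OF True] n by blast
      then show ?thesis using True \<open>j \<notin> HH\<close> by (simp add: w_def)
    next
      case False
      then have i: "i \<in> TT \<union> EE" using m by blast
      show ?thesis
      proof (cases "j \<in> HH")
        case True
        then have "br j i \<in> HH" using HH_odd[OF True i] n br_comm[of i j] by simp
        then show ?thesis using True False br_comm[of i j] by (simp add: w_def)
      next
        case F: False
        then have "j \<in> TT \<union> EE" using m by blast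
        then have "br i j \<in> TT \<union> EE" using odd_odd i n by blast
        then have "br i j \<notin> HH" using parts by blast
        then show ?thesis using False F by (simp add: w_def)
      qed
    qed
  qed (use x in \<open>simp_all add: w_def HH_def\<close>)
qed

text \<open>A trivial \<open>br b b\<close> makes \<open>d b\<close> even, and a trivial
  \<open>br a b\<close> makes \<open>d a\<close> equal to it, while a square such as
  \<open>z\<close> has odd dimension. But the trivial \<open>br a b\<close> preserves dimensions
  when it maps \<open>a\<close> or \<open>b\<close> onto \<open>z\<close>.\<close>

lemma nontriv_three_aux1:
  assumes "d a \<ge> 2" "br a a = z" "br a b \<in> TT" "br b b \<in> TT" "a \<in> I" "b \<in> I"
    and act: "br (br a b) a = z \<or> br (br a b) b = z"
  shows False
proof -
  have nz: "br a a \<noteq> 0" "br a b \<noteq> 0" "br b b \<noteq> 0" "z \<noteq> 0"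
    using assms I_nz zI unfolding TT_def by auto
  have "d a = d b" using triv_dual[OF nz(2)] assms(3) unfolding TT_def by simp
  moreover have "even (d b)" using sq_odd[OF nz(3)] assms(4) unfolding TT_def by auto
  moreover have "odd (d z)" using parity[OF nz(1)] assms(2) by auto
  moreover have "d z = d a \<or> d z = d b" using act TT_act[OF assms(3), of a] TT_act[OF assms(3), of b] nz(4) by auto
  ultimately show False by auto
qed

lemma nontriv_three_aux2:
  assumes "br a b = z" "br a a \<in> TT" "br b b \<in> TT" "a \<in> I" "b \<in> I"
    and act: "br (br a a) a = z \<or> br (br a a) b = z"
  shows False
proof -
  have nz: "br a a \<noteq> 0" "br a b \<noteq> 0" "br b b \<noteq> 0" "z \<noteq> 0"
    using assms I_nz zI unfolding TT_def by auto
  have "even (d a)" using sq_odd[OF nz(1)] assms(2) unfolding TT_def by auto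
  moreover have "even (d b)" using sq_odd[OF nz(3)] assms(3) unfolding TT_def by auto
  moreover have "odd (d z)" using parity[OF nz(2)] assms(1) calculation by auto
  moreover have "d z = d a \<or> d z = d b" using act TT_act[OF assms(2), of a] TT_act[OF assms(2), of b] nz(4) by auto
  ultimately show False by auto
qed

text \<open>Apart from \<open>a\<close>, \<open>b\<close>, \<open>z\<close> all summands are
  trivial. They commute and map the generators into \<open>z\<close>, so weight 1 on generators, 2
  on trivial summands and 3 on \<open>z\<close> is compatible unless a product of generators is
  \<open>z\<close>. With five indices there are two trivial summands, which must be the other two
  products, and parity excludes this.\<close>

lemma nontriv_ne_3: assumes m: "card HH + card EE = 3" shows False
proof -
  obtain a b where ab: "a \<noteq> b" "dep a = 1" "dep b = 1" using two_gens by blast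
  have az: "a \<noteq> z" "b \<noteq> z" "a \<in> I" "b \<in> I" using gen_not_z gen_I ab by blast+
  have dab: "d a \<ge> 2" "d b \<ge> 2" using gen_nontriv ab by blast+
  have "{a,b,z} \<subseteq> HH \<union> EE" using az dab z_nontriv zI unfolding HH_def EE_def by auto
  moreover have "card (HH \<union> EE) = 3" using m card_Un_disjoint[OF fin(2,3) parts(4)] by simp
  ultimately have N: "HH \<union> EE = {a,b,z}" using card_subset_eq[of "HH \<union> EE" "{a,b,z}"] fin ab az by auto
  have I: "x \<in> TT \<or> x = a \<or> x = b \<or> x = z" if "x \<in> I" for x
    using that N parts(1) by blast
  have gens: "g = a \<or> g = b" if "dep g = 1" for g
    using I[OF gen_I[OF that]] gen_not_z[OF that] TT_nongen[of g] that by auto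
  have T2: "card TT \<ge> 2" using card_parts card5 m by linarith
  have tx: "br t x = 0 \<or> br t x = z" if "t \<in> TT" "x \<in> {a,b}" for t x
  proof (cases "br t x = 0")
    case False
    then have "d (br t x) \<ge> 2" using TT_act[OF that(1) False] dab that(2) by auto
    then have "br t x \<in> {a,b,z}" using I[OF br_in[OF False]] unfolding TT_def by auto
    then show ?thesis using br_not_gen[OF False] ab by auto
  qed simp
  \<comment> \<open>A nonzero \<open>br t t'\<close> is trivial and moves some generator
    \<open>g\<close>. By the Jacobi identity this passes through the action of \<open>t\<close> or
    \<open>t'\<close> on \<open>g\<close>, which ends in the central \<open>z\<close>.\<close>
  have tt: "br t t' = 0" if "t \<in> TT" "t' \<in> TT" for t t'
  proof (rule ccontr)
    assume n: "br t t' \<noteq> 0"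
    then have s: "br t t' \<in> TT" using TT_act[OF that(1) n] that br_in[OF n] unfolding TT_def by simp
    then obtain g where g: "dep g = 1" "br (br t t') g \<noteq> 0" using not_central[of "br t t'"] TT_noncentral br_in[OF n] by blast
    then have gab: "g \<in> {a,b}" using gens by blast
    have "br (br t' g) t = 0" "br (br g t) t' = 0"
      using zz[OF tx[OF that(2) gab]] zz[OF tx[OF that(1) gab]] by (simp_all add: br_comm[of g t])
    then show False using jac[OF refl g(2)] g(2) by simp
  qed
  have TTsub: "TT \<subseteq> {br a a, br a b, br b b}"
  proof
    fix t assume t: "t \<in> TT"
    obtain g x where gx: "br g x = t" "dep g = 1" using dep_split[OF TT_nongen[OF t]] by blast
    have n: "br g x \<noteq> 0" using gx t I_nz unfolding TT_def by auto
    have g: "g \<in> {a,b}" using gens gx by blast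
    have "x \<notin> TT" using tx[OF _ g, of x] br_comm[of x g] gx TT_noncentral[OF t] n by auto
    then have "x \<in> {a,b}" using I[OF br_mem(2)[OF n]] n by auto
    then show "t \<in> {br a a, br a b, br b b}" using g gx br_comm[of a b] by auto
  qed
  have act: "br t a = z \<or> br t b = z" if t: "t \<in> TT" for t
  proof -
    have "t \<in> I" using t unfolding TT_def by simp
    then obtain g where g: "dep g = 1" "br t g \<noteq> 0" using not_central TT_noncentral[OF t] by blast
    have "br t g = z" using gens[OF g(1)] tx[OF t, of g] g(2) by blast
    then show ?thesis using gens[OF g(1)] by blast
  qed
  have "br a a = z \<or> br a b = z \<or> br b b = z"
  proof (rule ccontr)
    assume c: "\<not> ?thesis"
    have cT: "br x y \<in> TT" if "x \<in> {a,b}" "y \<in> {a,b}" "br x y \<noteq> 0" for x y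
    proof -
      have "br b a = br a b" by (rule br_comm)
      then have "br x y \<noteq> z" using that(1,2) c by (elim insertE emptyE) simp_all
      moreover have "br x y \<noteq> a" "br x y \<noteq> b" using br_not_gen[OF that(3)] ab by metis+
      ultimately show ?thesis using I[OF br_in[OF that(3)]] by blast
    qed
    define w where "w x = (if x = z then 3 else if x \<in> TT then 2 else 1 :: int)" for x
    have aT: "a \<notin> TT" "b \<notin> TT" using dab unfolding TT_def by auto
    show False
    proof (rule no_wt[of w z])
      fix i j assume n: "br i j \<noteq> 0"
      have "i \<noteq> z" "j \<noteq> z" using n by auto
      then have ij: "i \<in> TT \<union> {a,b}" "j \<in> TT \<union> {a,b}" using I[OF br_mem(1)[OF n]] I[OF br_mem(2)[OF n]] by auto
      have P: "w (br x y) = w x + w y" if "x \<in> TT" "y \<in> {a,b}" "br x y \<noteq> 0" for x y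
        using tx[OF that(1,2)] that aT az TT_noncentral[OF that(1)] by (auto simp: w_def)
      show "w (br i j) = w i + w j"
      proof (cases "i \<in> TT")
        case True
        then have "j \<notin> TT" using tt n by blast
        then show ?thesis using P[OF True _ n] ij by blast
      next
        case False
        show ?thesis
        proof (cases "j \<in> TT")
          case True then show ?thesis using P[OF True, of i] n False ij br_comm[of i j] by auto
        next
          case F: False
          then have "br i j \<in> TT" using cT[OF _ _ n] ij False by blast
          then show ?thesis using False F TT_noncentral[of "br i j"] \<open>i \<noteq> z\<close> \<open>j \<noteq> z\<close> by (simp add: w_def)
        qed
      qed
    qed (use zI in \<open>simp_all add: w_def\<close>)
  qed
  moreover have zT: "z \<notin> TT" using TT_noncentral by blast
  ultimately consider "br a a = z" | "br b b = z" | "br a b = z" by blast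
  then show False
  proof cases
    case 1
    then have "TT \<subseteq> {br a b, br b b}" using TTsub zT by auto
    from card2_sub[OF T2 this] show False using nontriv_three_aux1[of a b] 1 dab az act by blast
  next
    case 2
    then have "TT \<subseteq> {br b a, br a a}" using TTsub zT br_comm[of a b] by auto
    from card2_sub[OF T2 this] show False using nontriv_three_aux1[of b a] 2 dab az act by blast
  next
    case 3
    then have "TT \<subseteq> {br a a, br b b}" using TTsub zT by auto
    from card2_sub[OF T2 this] show False using nontriv_three_aux2[of a b] 3 az act by blast
  qed
qed

end

section \<open>Tables whose nontrivial summands all have even dimension\<close>

context large_bracket_table begin

lemma gen_not_TT: "dep g = 1 \<Longrightarrow> g \<notin> TT"
  using TT_nongen by fastforce

lemma TT_sq: "t \<in> TT \<Longrightarrow> br t t = 0"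
  using sq_triv unfolding TT_def by simp

lemma z_not_TT: "z \<notin> TT"
  using TT_noncentral by blast

lemma card_nontriv: "card HH + card EE \<ge> 4"
proof -
  obtain a b where ab: "a \<noteq> b" "dep a = 1" "dep b = 1" using two_gens by blast
  have az: "a \<noteq> z" "b \<noteq> z" "a \<in> I" "b \<in> I" using gen_not_z gen_I ab by blast+
  then have "{a,b,z} \<subseteq> HH \<union> EE" using gen_not_TT[OF ab(2)] gen_not_TT[OF ab(3)] z_not_TT zI parts(1) by blast
  then have "card {a,b,z} \<le> card (HH \<union> EE)" using fin by (intro card_mono) simp_all
  moreover have "card {a,b,z} = 3" using ab az by simp
  ultimately have "3 \<le> card HH + card EE" using card_Un_disjoint[OF fin(2,3) parts(4)] by simp
  then show ?thesis using nontriv_ne_3 by fastforce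
qed

text \<open>Here every bracket of two even-dimensional summands is zero or trivial, so
  \<open>jac_triv\<close> applies to each arrangement of the factors. On indices, nonzero triple
  brackets become symmetric.\<close>

lemma HH_sym:
  assumes "EE = {}" "i \<in> HH" "j \<in> HH" "l \<in> HH" "br (br i j) l = p" "p \<noteq> 0"
  shows "br (br j l) i = p" "br (br l i) j = p"
proof -
  have T: "br x y = 0 \<or> d (br x y) = 1" if "x \<in> HH" "y \<in> HH" for x y
    using HH_HH[OF that] assms(1) unfolding TT_def by blast
  have "br i j \<noteq> 0" using assms(5,6) by auto
  then have ij: "d (br i j) = 1" using T[OF assms(2,3)] by blast
  show "br (br l i) j = p"
    using jac_triv[OF assms(5,6) ij d_HH[OF assms(4)] T[OF assms(3,4)]] .
  have "br (br j i) l = p" using assms(5) br_comm[of i j] by simp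
  moreover have "d (br j i) = 1" using ij br_comm[of i j] by simp
  ultimately have "br (br l j) i = p" using jac_triv[OF _ assms(6) _ d_HH[OF assms(4)] T[OF assms(2,4)]] by blast
  then show "br (br j l) i = p" using br_comm[of l j] by simp
qed

text \<open>By symmetry of triple brackets, all nonzero values \<open>br t x\<close> agree with one
  index \<open>p\<close>, and \<open>t\<close> moves both factors of every nonzero bracket of
  even-dimensional summands. So weight 1 on what \<open>t\<close> moves, 2 on \<open>t\<close>, 3 on
  \<open>p\<close> and 0 elsewhere is compatible.\<close>

lemma even_only_one_triv: assumes E0: "EE = {}" and T1: "TT = {t}" shows False
proof -
  have t: "t \<in> TT" "t \<in> I" using T1 unfolding TT_def by auto
  have IH: "x = t \<or> x \<in> HH" if "x \<in> I" for x using that parts(1) E0 T1 by blast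
  have tt: "br t t = 0" using TT_sq t by blast
  have gH: "g \<in> HH" if "dep g = 1" for g using IH[OF gen_I[OF that]] gen_not_TT[OF that] T1 by blast
  have HHt: "br x y = t" if "x \<in> HH" "y \<in> HH" "br x y \<noteq> 0" for x y using HH_HH[OF that] E0 T1 by blast
  have tH: "br t x \<in> HH" if "x \<in> HH" "br t x \<noteq> 0" for x
    using HH_odd[OF that(1), of t] t that br_comm[of t x] by simp
  obtain g where g: "dep g = 1" "br t g \<noteq> 0" using not_central[OF t(2) TT_noncentral[OF t(1)]] by blast
  obtain i0 j0 where ij0: "br i0 j0 = t" "dep i0 = 1" "dep j0 = dep t - 1" using dep_split[OF TT_nongen[OF t(1)]] by blast
  have tnz: "t \<noteq> 0" using t I_nz by blast
  have "br i0 j0 \<noteq> 0" using ij0 tnz by simp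
  from dep_br[OF this] have "j0 \<noteq> t" using ij0 by auto
  then have j0: "j0 \<in> HH" using IH[OF br_mem(2)[OF \<open>br i0 j0 \<noteq> 0\<close>]] by blast
  define p where "p = br t i0"
  have A: "br t x = p" if "x \<in> HH" "br t x \<noteq> 0" for x
  proof -
    have "br (br j0 x) i0 = br t x" using HH_sym(1)[OF E0 gH[OF ij0(2)] j0 that(1), of "br t x"] ij0 that by simp
    then have "br j0 x \<noteq> 0" using that by auto
    then have "br j0 x = t" using HHt j0 that by blast
    then show ?thesis using \<open>br (br j0 x) i0 = br t x\<close> p_def by simp
  qed
  have pg: "br t g = p" "p \<noteq> 0" using A[OF gH[OF g(1)] g(2)] g(2) by simp_all
  have pH: "p \<in> HH" using tH[OF gH[OF g(1)] g(2)] pg by simp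
  have B: "br t x = p" if "x \<in> HH" "y \<in> HH" "br x y \<noteq> 0" for x y
  proof -
    have "br (br x y) g = p" using HHt[OF that] pg by simp
    then have h: "br (br y g) x = p" using HH_sym(1)[OF E0 that(1,2) gH[OF g(1)]] pg(2) by blast
    then have "br y g \<noteq> 0" using pg by auto
    then have "br y g = t" using HHt that gH g by blast
    then show ?thesis using h by simp
  qed
  have tp: "br t p = 0"
  proof (rule ccontr)
    assume n: "br t p \<noteq> 0"
    then show False using A[OF pH n] dep_br[OF n] by simp
  qed
  have pt: "p \<noteq> t" using pH t parts(2) by blast
  define w where "w x = (if br t x \<noteq> 0 then 1 else if x = t then 2 else if x = p then 3 else 0 :: int)" for x
  have wt: "w t = 2" "w p = 3" unfolding w_def using tt tp pt by simp_all
  show False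
  proof (rule no_wt[of w t])
    fix i j assume n: "br i j \<noteq> 0"
    have W: "w (br t x) = w t + w x" if "x \<in> HH" "br t x \<noteq> 0" for x
      using A[OF that] tp pt tt pg(2) by (simp add: w_def)
    show "w (br i j) = w i + w j"
    proof (cases "i = t")
      case True
      then have "j \<noteq> t" using tt n by blast
      then show ?thesis using W IH[OF br_mem(2)[OF n]] n True by blast
    next
      case False
      then have i: "i \<in> HH" using IH[OF br_mem(1)[OF n]] by blast
      show ?thesis
      proof (cases "j = t")
        case True then show ?thesis using W[OF i] n br_comm[of i t] by simp
      next
        case False
        then have j: "j \<in> HH" using IH[OF br_mem(2)[OF n]] by blast
        have "br t i = p" "br t j = p" using B[OF i j n] B[OF j i] n br_comm[of i j] by simp_all
        then have "w i = 1" "w j = 1" unfolding w_def using pg by simp_all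
        then show ?thesis using HHt[OF i j n] wt by simp
      qed
    qed
  qed (use t wt in simp_all)
qed

end

text \<open>The extremal case of the dimension count: two generating planes, the central index, and
  at most one further even-dimensional index \<open>c\<close>. Everything turns on how
  \<open>c\<close> arises from \<open>a\<close> and \<open>b\<close>.\<close>

locale even_only_table = large_bracket_table I br d z for I :: "'b::zero set" and br d z +
  fixes a b c :: 'b
  assumes E0: "EE = {}" and HHm: "x \<in> HH \<Longrightarrow> x = a \<or> x = b \<or> x = c \<or> x = z"
    and abc: "a \<in> HH" "b \<in> HH" "c \<in> HH" "c \<noteq> z" "dep a = 1" "dep b = 1"
    and two: "d a = 2" "d b = 2"
begin

lemma IH: "x \<in> I \<Longrightarrow> x \<in> TT \<or> x \<in> HH"
  using parts(1) E0 by blast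

lemma nz: "x \<in> HH \<Longrightarrow> x \<noteq> 0" "t \<in> TT \<Longrightarrow> t \<noteq> 0"
  using I_nz unfolding HH_def TT_def by blast+

lemma sym: assumes "i \<in> HH" "j \<in> HH" "l \<in> HH" "br (br i j) l = p" "p \<noteq> 0"
  shows "br (br j l) i = p" "br (br l i) j = p"
  using HH_sym[OF E0 assms] by blast+

lemma HHT: "x \<in> HH \<Longrightarrow> y \<in> HH \<Longrightarrow> br x y \<noteq> 0 \<Longrightarrow> br x y \<in> TT"
  using HH_HH[of x y] E0 by blast

lemma gensm: "dep g = 1 \<Longrightarrow> g = a \<or> g = b \<or> g = c"
  using IH[OF gen_I, of g] gen_not_TT[of g] gen_not_z[of g] HHm[of g] by blast

lemma gensH: "dep g = 1 \<Longrightarrow> g \<in> HH"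
  using gensm abc by blast

lemma tH: assumes "t \<in> TT" "x \<in> HH" "br t x \<noteq> 0"
  shows "br t x = c \<or> br t x = z"
proof -
  have "br t x \<in> HH" using HH_odd[OF assms(2), of t] assms br_comm[of t x] by simp
  moreover have "br t x \<noteq> a" "br t x \<noteq> b" using br_not_gen[OF assms(3)] abc by auto
  ultimately show ?thesis using HHm by blast
qed

text \<open>Brackets are never generators, so trivial summands could then only lead to
  \<open>z\<close>. As before, weight 3 on \<open>z\<close>, 2 on trivial summands and 1 elsewhere
  is compatible.\<close>

lemma cgen: assumes "dep c = 1" shows False
proof -
  have tz: "br t x = 0 \<or> br t x = z" if "t \<in> TT" "x \<in> HH" for t x
  proof (cases "br t x = 0")
    case False
    then show ?thesis using tH[OF that False] br_not_gen[OF False] assms by auto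
  qed simp
  have tt: "br t t' = 0" if "t \<in> TT" "t' \<in> TT" for t t'
  proof (rule ccontr)
    assume n: "br t t' \<noteq> 0"
    have s: "br t t' \<in> TT" using odd_odd[of t t'] that n E0 by blast
    then obtain g where g: "dep g = 1" "br (br t t') g \<noteq> 0" using not_central[OF br_in[OF n]] TT_noncentral[OF s] by blast
    have "br (br t' g) t = 0" "br (br g t) t' = 0"
      using zz[OF tz[OF that(2) gensH[OF g(1)]]] zz[OF tz[OF that(1) gensH[OF g(1)]]] by (simp_all add: br_comm[of g t])
    then show False using jac[OF refl g(2)] g(2) by simp
  qed
  define w where "w x = (if x = z then 3 else if x \<in> TT then 2 else 1 :: int)" for x
  show False
  proof (rule no_wt[of w z])
    fix i j assume n: "br i j \<noteq> 0"
    have nzz: "i \<noteq> z" "j \<noteq> z" using n by auto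
    have P: "w (br t x) = w t + w x" if "t \<in> TT" "x \<in> HH" "br t x \<noteq> 0" for t x
    proof -
      have "x \<noteq> z" using that(3) by auto
      moreover have "x \<notin> TT" using that(2) parts by blast
      ultimately show ?thesis using tz[OF that(1,2)] that TT_noncentral[OF that(1)] by (simp add: w_def)
    qed
    show "w (br i j) = w i + w j"
    proof (cases "i \<in> TT")
      case True
      then have "j \<in> HH" using tt n IH[OF br_mem(2)[OF n]] by blast
      then show ?thesis using P[OF True _ n] by blast
    next
      case False
      then have i: "i \<in> HH" using IH[OF br_mem(1)[OF n]] by blast
      show ?thesis
      proof (cases "j \<in> TT")
        case True then show ?thesis using P[OF True i] n br_comm[of i j] by simp
      next
        case F: False
        then have j: "j \<in> HH" using IH[OF br_mem(2)[OF n]] by blast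
        have "br i j \<in> TT" using HHT[OF i j n] .
        then show ?thesis using F False nzz TT_noncentral[of "br i j"] by (simp add: w_def)
      qed
    qed
  qed (use zI in \<open>simp_all add: w_def\<close>)
qed

lemma gens: "dep g = 1 \<Longrightarrow> g = a \<or> g = b"
  using gensm cgen by blast

lemma TTact: "t \<in> TT \<Longrightarrow> br t a \<noteq> 0 \<or> br t b \<noteq> 0"
  using not_central[of t] TT_noncentral[of t] gens unfolding TT_def by blast

lemma tgen: assumes "t \<in> TT" "t' \<in> TT" shows "br t t' \<in> TT \<or> br t t' = 0"
  using odd_odd[of t t'] assms E0 by blast

text \<open>Neither \<open>c\<close> nor the trivial value \<open>br c i\<close> is central, so two
  generators act on \<open>c\<close> in succession with nonzero result. By depth the result is not
  \<open>c\<close> again.\<close>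

lemma c_pair: "\<exists>i l. (i = a \<or> i = b) \<and> (l = a \<or> l = b) \<and> br (br c i) l = z"
proof -
  have "c \<in> I" using abc unfolding HH_def by blast
  then obtain g where g: "dep g = 1" "br c g \<noteq> 0" using not_central abc by blast
  have gH: "g \<in> HH" using gensH g by blast
  have t: "br c g \<in> TT" using HHT[OF abc(3) gH g(2)] .
  obtain l where l: "l = a \<or> l = b" "br (br c g) l \<noteq> 0" using TTact[OF t] by blast
  then have lH: "l \<in> HH" using abc by blast
  have "br (br c g) l \<noteq> c" using dep_br[OF l(2)] dep_br[OF g(2)] by auto
  then have "br (br c g) l = z" using tH[OF t lH l(2)] by blast
  then show ?thesis using gens[OF g(1)] l by blast
qed

text \<open>By symmetry of triple brackets, \<open>c\<close> has a nonzero bracket with both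
  generators from \<open>c_pair\<close>, and \<open>a\<close> is excluded.\<close>

lemma c_pair_b: assumes "br c a = 0"
  shows "br c b \<in> TT" "br (br c b) b = z"
proof -
  obtain i l where il: "i = a \<or> i = b" "l = a \<or> l = b" "br (br c i) l = z" using c_pair by blast
  have zn: "z \<noteq> 0" using zI I_nz by blast
  have i: "i = b" using il assms zn by auto
  have lH: "l \<in> HH" using il abc by blast
  have "br (br l c) i = z" using sym(2)[OF abc(3) _ lH il(3) zn] abc i by blast
  then have "br c l \<noteq> 0" using br_comm[of l c] zn by auto
  then have "l = b" using il assms by auto
  then show b: "br (br c b) b = z" using il i by simp
  then have "br c b \<noteq> 0" using zn by auto
  then show "br c b \<in> TT" using HHT abc by blast
qed

text \<open>First \<open>sym_triv\<close> gives \<open>br c a = 0\<close>. With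
  \<open>t = br a a\<close> and \<open>s = br a b\<close>, the Jacobi identity identifies the
  trivial \<open>u = br c b\<close> with \<open>br s t\<close>. Both \<open>s\<close> and
  \<open>t\<close> kill \<open>c\<close> and lead only to \<open>c\<close> or \<open>z\<close>, so
  \<open>u\<close> kills all even-dimensional summands; yet a trivial summand moves some
  generator.\<close>

lemma aa_a_ne_c: assumes "br (br a a) a = c" shows False
proof -
  have cn: "c \<noteq> 0" "z \<noteq> 0" using abc nz zI I_nz by blast+
  define t where "t = br a a"
  have "t \<noteq> 0" using assms cn unfolding t_def by auto
  then have t: "t \<in> TT" using HHT[of a a] abc unfolding t_def by blast
  have ta: "br t a = c" using assms t_def by simp
  have ca: "br c a = 0"
  proof (rule ccontr)
    assume n: "br c a \<noteq> 0"
    have "d t = 1" using t unfolding TT_def by simp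
    moreover have "br t (br a a) = 0" using TT_sq[OF t] t_def by simp
    ultimately have "d (br c a) \<noteq> 1" using sym_triv[OF two(1) _ ta cn(1) _ n] by blast
    then show False using HHT[OF abc(3,1) n] unfolding TT_def by simp
  qed
  define u where "u = br c b"
  have u: "u \<in> TT" "br u b = z" using c_pair_b[OF ca] u_def by simp_all
  have un: "u \<noteq> 0" using u nz by blast
  have Hac: "br (br t x) a = 0" if x: "x \<in> HH" for x
  proof (cases "br t x = 0")
    case False
    then show ?thesis using tH[OF t x False] by (elim disjE) (simp_all add: ca)
  qed simp
  have "br (br t a) b = u" using ta u_def by simp
  from jac[OF this un] have "br (br a b) t = u \<or> br (br t b) a = u" using br_comm[of b t] by simp
  then have su: "br (br a b) t = u" using Hac[OF abc(2)] un by auto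
  define s where "s = br a b"
  have "s \<noteq> 0" using su un s_def by auto
  then have s: "s \<in> TT" using HHT abc s_def by blast
  have st: "br s t = u" using su s_def by simp
  have sc: "br s c = 0"
  proof (rule ccontr)
    assume n: "br s c \<noteq> 0"
    have "br (br c a) b = br s c" using sym(2)[OF abc(1,2,3) refl, folded s_def, OF n] .
    then show False using ca n by simp
  qed
  have tc: "br t c = 0"
  proof (rule ccontr)
    assume n: "br t c \<noteq> 0"
    have "br (br c a) a = br t c" using sym(2)[OF abc(1,1,3) refl, folded t_def, OF n] .
    then show False using ca n by simp
  qed
  have z1: "br (br y x) v = 0" if "y \<in> TT" "v = s \<or> v = t" "x \<in> HH" for y v x
  proof (cases "br y x = 0")
    case False
    then have "br y x = c \<or> br y x = z" using tH that by blast
    moreover have "br c v = 0" using that(2) sc tc br_comm[of c v] by auto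
    ultimately show ?thesis by (elim disjE) simp_all
  qed simp
  have u0: "br u x = 0" if "x \<in> HH" for x
  proof (rule ccontr)
    assume n: "br u x \<noteq> 0"
    then have "br (br s t) x = br u x" using st by simp
    from jac[OF this n] show False
      using z1[OF t _ that, of s] z1[OF s _ that, of t] n br_comm[of x s] by auto
  qed
  then show False using TTact[OF u(1)] abc by blast
qed

end

lemma (in even_only_table) swap: "even_only_table I br d z b a c"
  by unfold_locales (use E0 HHm abc two in auto)

context even_only_table begin

text \<open>By symmetry also \<open>br s a = c\<close> for \<open>s = br a b\<close>, so that
  \<open>cubic_triv\<close> yields \<open>br c a = 0\<close>. The Jacobi identity for
  \<open>br (br s a) b\<close> then leads to \<open>br s s\<close>, which vanishes because
  \<open>s\<close> is trivial.\<close>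

lemma aa_b_ne_c: assumes "br (br a a) b = c" shows False
proof -
  interpret sw: even_only_table I br d z b a c by (rule swap)
  have cn: "c \<noteq> 0" "z \<noteq> 0" using abc nz zI I_nz by blast+
  define t where "t = br a a"
  define s where "s = br a b"
  have "t \<noteq> 0" using assms cn unfolding t_def by auto
  then have t: "t \<in> TT" using HHT[of a a] abc unfolding t_def by blast
  have tb: "br t b = c" using assms t_def by simp
  have sa: "br s a = c" using sym(1)[OF abc(1,1,2) assms cn(1)] s_def by simp
  then have "s \<noteq> 0" using cn by auto
  then have s: "s \<in> TT" using HHT abc s_def by blast
  have "br t a \<noteq> c" using aa_a_ne_c t_def by blast
  then have ta: "br t a = 0 \<or> br t a = z" using tH[OF t abc(1)] by blast
  have d1: "d t = 1" "d s = 1" using s t unfolding TT_def by simp_all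
  have ca: "br c a = 0"
    using cubic_triv[OF two t_def[symmetric] s_def[symmetric] d1 tb sa cn(1) zz[OF ta]] .
  define u where "u = br c b"
  have u: "u \<in> TT" using c_pair_b[OF ca] u_def by simp
  have un: "u \<noteq> 0" using u nz by blast
  have "br (br s a) b = u" using sa u_def by simp
  from jac[OF this un] have "br s s = u \<or> br (br s b) a = u" using br_comm[of b s] s_def by simp
  moreover have "br s s = 0" using TT_sq s by blast
  moreover have "br (br s b) a = 0"
  proof (cases "br s b = 0")
    case False
    then show ?thesis using tH[OF s abc(2) False] by (elim disjE) (simp_all add: ca)
  qed simp
  ultimately show False using un by auto
qed

text \<open>Splitting off generators twice from the nongenerator \<open>c\<close> writes it as a
  triple bracket of copies of \<open>a\<close> and \<open>b\<close>. Up to symmetry there are four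
  such brackets, all excluded.\<close>

lemma even_only_false: False
proof -
  interpret sw: even_only_table I br d z b a c by (rule swap)
  have cI: "c \<in> I" using abc unfolding HH_def by blast
  have cn: "c \<noteq> 0" "z \<noteq> 0" using abc nz zI I_nz by blast+
  have "dep c \<ge> 2" using nongen_dep[OF cI] cgen by blast
  then obtain g t where gt: "br g t = c" "dep g = 1" "dep t = dep c - 1" using dep_split by blast
  have gH: "g \<in> HH" using gensH gt by blast
  have n: "br g t \<noteq> 0" using gt cn by simp
  have "t \<notin> HH" using HHT[OF gH _ n] gt abc parts by auto
  then have t: "t \<in> TT" using IH[OF br_mem(2)[OF n]] by blast
  obtain g' x where gx: "br g' x = t" "dep g' = 1" "dep x = dep t - 1" using dep_split[OF TT_nongen[OF t]] by blast
  have gH': "g' \<in> HH" using gensH gx by blast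
  have n': "br g' x \<noteq> 0" using gx t nz by simp
  have "x \<notin> TT" 
  proof
    assume "x \<in> TT"
    then have "br g' x \<in> HH" using HH_odd[OF gH' _ n'] by blast
    then show False using gx t parts by blast
  qed
  then have xH: "x \<in> HH" using IH[OF br_mem(2)[OF n']] by blast
  have "dep x < dep t" using dep_br[OF n'] unfolding gx(1) by blast
  moreover have "dep t < dep c" using dep_br[OF n] unfolding gt(1) by blast
  ultimately have "x \<noteq> c" by auto
  moreover have "x \<noteq> z" using n' by auto
  ultimately have x: "x = a \<or> x = b" using HHm[OF xH] by blast
  have e: "br (br g' x) g = c" using gx gt br_comm[of g t] by simp
  have e2: "br (br x g) g' = c" "br (br g g') x = c" using sym[OF gH' xH gH e cn(1)] by blast+
  have com: "br b a = br a b" by (rule br_comm)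
  have gg: "g = a \<or> g = b" "g' = a \<or> g' = b" using gens gt gx by blast+
  have "br (br a a) a = c \<or> br (br b b) b = c \<or> br (br a a) b = c \<or> br (br b b) a = c"
    using gg x e e2 com by (elim disjE) simp_all
  then show False using aa_a_ne_c aa_b_ne_c sw.aa_a_ne_c sw.aa_b_ne_c by blast
qed

end

text \<open>At least two trivial and four even-dimensional summands take 10 of the 11 dimensions.
  Hence there are exactly four of the latter, and all are planes.\<close>

lemma (in large_bracket_table) some_odd_dim: assumes E0: "EE = {}" shows False
proof -
  obtain a b where ab: "a \<noteq> b" "dep a = 1" "dep b = 1" using two_gens by blast
  have az: "a \<noteq> z" "b \<noteq> z" "a \<in> I" "b \<in> I" using gen_not_z gen_I ab by blast+
  have aH: "a \<in> HH" "b \<in> HH" "z \<in> HH"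
    using az zI parts(1) E0 gen_not_TT[OF ab(2)] gen_not_TT[OF ab(3)] z_not_TT by blast+
  have "TT \<noteq> {}" using HH_bracket aH HH_HH E0 by blast
  then have "card TT \<ge> 1" using fin(1) by (simp add: Suc_le_eq card_gt_0_iff)
  moreover have "card TT \<noteq> 1" using even_only_one_triv[OF E0] card_1_singletonE by metis
  ultimately have T2: "card TT \<ge> 2" by linarith
  have s: "sum d TT + sum d HH \<le> 11" using sum_parts E0 by simp
  have c4: "card HH \<ge> 4" using card_nontriv E0 by simp
  then have cH: "card HH = 4" using s sum_bounds T2 by linarith
  have all2: "d x = 2" if x: "x \<in> HH" for x
  proof (rule ccontr)
    assume "d x \<noteq> 2"
    moreover have "d x \<noteq> 3" using x unfolding HH_def by auto
    ultimately have "d x \<ge> 4" using d_HH[OF x] by linarith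
    moreover have "sum d HH = d x + sum d (HH - {x})" using sum.remove[OF fin(2) x] .
    moreover have "sum d (HH - {x}) \<ge> 2 * card (HH - {x})"
      using sum_bounded_below[of "HH - {x}" 2 d] d_HH by (simp add: mult.commute)
    moreover have "card (HH - {x}) = 3" using cH x fin(2) by simp
    ultimately show False using s sum_bounds T2 by linarith
  qed
  have "card (HH - {a,b,z}) = 1" using card_Diff_subset[of "{a,b,z}" HH] aH ab az cH by simp
  then obtain c where c: "HH - {a,b,z} = {c}" by (rule card_1_singletonE)
  have cc: "c \<in> HH" "c \<noteq> z" using c by blast+
  have "even_only_table I br d z a b c"
    by unfold_locales (use E0 c cc aH ab all2 in blast)+
  then show False by (rule even_only_table.even_only_false)
qed

section \<open>Shapes with summands of odd dimension at least 3\<close>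

context large_bracket_table begin

text \<open>The table is symmetric, so a weight has to be checked for one order of each pair only;
  \<open>rk\<close> selects the order.\<close>

lemma no_wt_sym:
  assumes "\<And>i j. br i j \<noteq> 0 \<Longrightarrow> rk i \<le> (rk j :: nat) \<Longrightarrow> w (br i j) = w i + w j" "x \<in> I" "w x \<noteq> (0::int)"
  shows False
proof (rule no_wt[of w x, OF _ assms(2,3)])
  fix i j assume "br i j \<noteq> 0"
  then show "w (br i j) = w i + w j"
    using assms(1)[of i j] assms(1)[of j i] br_comm[of i j] by (cases "rk i \<le> rk j") simp_all
qed

text \<open>The next even dimension after 2 is 4, and one such summand would raise the total from at
  least 10 to at least 12.\<close>

lemma tight_HH: assumes "2 * card HH + 3 * card EE + card TT \<ge> 10" "x \<in> HH" shows "d x = 2"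
proof (rule ccontr)
  assume "d x \<noteq> 2"
  moreover have "d x \<noteq> 3" using assms(2) unfolding HH_def by auto
  ultimately have "d x \<ge> 4" using d_HH[OF assms(2)] by linarith
  moreover have "sum d HH = d x + sum d (HH - {x})" using sum.remove[OF fin(2) assms(2)] .
  moreover have "sum d (HH - {x}) \<ge> 2 * card (HH - {x})"
    using sum_bounded_below[of "HH - {x}" 2 d] d_HH by (simp add: mult.commute)
  moreover have "Suc (card (HH - {x})) = card HH" using card_Suc_Diff1[OF fin(2) assms(2)] .
  ultimately show False using sum_parts sum_bounds assms(1) by linarith
qed

lemma HH_sq: "x \<in> HH \<Longrightarrow> d x = 2 \<Longrightarrow> br x x = 0 \<or> br x x \<in> TT"
  using sq_two[of x] br_in[of x x] unfolding TT_def by auto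

lemma EE_sq: "x \<in> EE \<Longrightarrow> br x x = 0 \<or> br x x \<in> EE"
  using sq_odd[of x] odd_odd[of x x] unfolding EE_def TT_def by auto

lemma TT_EE: "t \<in> TT \<Longrightarrow> x \<in> EE \<Longrightarrow> br t x = 0 \<or> br t x \<in> EE"
  using TT_act[of t x] br_in[of t x] unfolding EE_def by auto

lemma TT_TT: "t \<in> TT \<Longrightarrow> t' \<in> TT \<Longrightarrow> br t t' = 0 \<or> br t t' \<in> TT"
  using TT_act[of t t'] br_in[of t t'] unfolding TT_def by auto

lemma TT_HH: "t \<in> TT \<Longrightarrow> x \<in> HH \<Longrightarrow> br t x = 0 \<or> br t x \<in> HH"
  using HH_odd[of x t] br_comm[of t x] by auto

lemma EE_HH: "t \<in> EE \<Longrightarrow> x \<in> HH \<Longrightarrow> br t x = 0 \<or> br t x \<in> HH"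
  using HH_odd[of x t] br_comm[of t x] by auto

lemma in_nz: "x \<in> HH \<Longrightarrow> x \<noteq> 0" "x \<in> TT \<Longrightarrow> x \<noteq> 0" "x \<in> EE \<Longrightarrow> x \<noteq> 0"
  using I_nz unfolding HH_def TT_def EE_def by blast+

lemma in_I: "x \<in> HH \<Longrightarrow> x \<in> I" "x \<in> TT \<Longrightarrow> x \<in> I" "x \<in> EE \<Longrightarrow> x \<in> I"
  unfolding HH_def TT_def EE_def by blast+

lemma in_parts: "x \<in> I \<Longrightarrow> x \<in> TT \<or> x \<in> HH \<or> x \<in> EE"
  using parts(1) by blast

lemma disj_parts: "x \<in> HH \<Longrightarrow> x \<notin> TT" "x \<in> HH \<Longrightarrow> x \<notin> EE" "x \<in> TT \<Longrightarrow> x \<notin> EE"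
  using parts by blast+

text \<open>Brackets of planes are zero or \<open>e\<close>, and a plane that is not a generator is
  a bracket with \<open>e\<close>. This forces depth 2 for \<open>e\<close>. Then weight 1 on the
  planes and 2 on \<open>e\<close> is compatible, with weight 3 on \<open>z\<close> if
  \<open>z\<close> is a plane.\<close>

lemma four_even_one_odd: assumes cH: "card HH = 4" and EE: "EE = {e}" and TT: "TT = {}" shows False
proof -
  have d2: "d x = 2" if "x \<in> HH" for x using tight_HH[OF _ that] cH EE TT by simp
  have e: "e \<in> EE" "e \<in> I" "e \<noteq> 0" using EE in_I in_nz by blast+
  have IH: "x = e \<or> x \<in> HH" if "x \<in> I" for x using in_parts[OF that] EE TT by blast
  have HHe: "br x y = e" if "x \<in> HH" "y \<in> HH" "br x y \<noteq> 0" for x y using HH_HH[OF that] EE TT by blast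
  have ee: "br e e = 0" using EE_sq[OF e(1)] dep_br[of e e] e(3) unfolding EE by auto
  have "HH \<noteq> {}" using cH by auto
  then obtain x y where xy: "x \<in> HH" "y \<in> HH" "br x y \<noteq> 0" using HH_bracket by blast
  have e1: "dep e \<noteq> 1" using br_not_gen[OF xy(3)] HHe[OF xy] by simp
  have gH: "g \<in> HH" if "dep g = 1" for g using IH[OF gen_I[OF that]] e1 that by blast
  have ng: "\<exists>g. dep g = 1 \<and> br g e = x" if "x \<in> HH" "dep x \<noteq> 1" for x
  proof -
    have "dep x \<ge> 2" using nongen_dep[OF in_I(1)[OF that(1)] that(2)] .
    then obtain g y where gy: "br g y = x" "dep g = 1" using dep_split by blast
    have n: "br g y \<noteq> 0" using gy in_nz(1)[OF that(1)] by simp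
    have "y \<notin> HH" using HHe[OF gH[OF gy(2)] _ n] gy that(1) disj_parts(2) e by blast
    then show ?thesis using IH[OF br_mem(2)[OF n]] gy by blast
  qed
  obtain g x where gx: "br g x = e" "dep g = 1" "dep x = dep e - 1" using dep_split[OF nongen_dep[OF e(2) e1]] by blast
  have n: "br g x \<noteq> 0" using gx e by simp
  have "x \<noteq> e" using gx nongen_dep[OF e(2) e1] by auto
  then have xH: "x \<in> HH" using IH[OF br_mem(2)[OF n]] by blast
  \<comment> \<open>A nongenerator \<open>x\<close> would be a bracket with \<open>e\<close>, hence
    deeper than \<open>e\<close>, although it is a factor of \<open>e\<close>.\<close>
  have "dep x = 1"
  proof (rule ccontr)
    assume "dep x \<noteq> 1"
    then obtain g' where g': "br g' e = x" using ng[OF xH] by blast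
    then have "br g' e \<noteq> 0" using in_nz xH by blast
    then have "dep e < dep x" using dep_br[of g' e] g' by simp
    then show False using gx(3) by linarith
  qed
  then have de: "dep e = 2" using gx nongen_dep[OF e(2) e1] by linarith
  have pg: "dep i = 1 \<and> dep j = 1" if "i \<in> HH" "j \<in> HH" "br i j \<noteq> 0" for i j
    using dep_add[OF that(3)] HHe[OF that] de dep_pos in_I(1)[OF that(1)] in_I(1)[OF that(2)] by fastforce
  have "e \<noteq> z"
  proof
    assume ez: "e = z"
    show False
    proof (rule no_wt[of "\<lambda>x. if x = e then 2 else 1" e])
      fix i j assume n: "br i j \<noteq> 0"
      then have "i \<noteq> e" "j \<noteq> e" using ez by auto
      then have "br i j = e" using HHe[OF _ _ n] IH[OF br_mem(1)[OF n]] IH[OF br_mem(2)[OF n]] by blast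
      then show "(if br i j = e then 2 else 1) = (if i = e then 2 else 1) + (if j = e then 2 else 1 :: int)"
        using \<open>i \<noteq> e\<close> \<open>j \<noteq> e\<close> by simp
    qed (use e in simp_all)
  qed
  then have zH: "z \<in> HH" using IH[OF zI] by blast
  have nz1: "dep x = 1" if "x \<in> HH" "x \<noteq> z" for x
  proof -
    have "\<exists>g. dep g = 1 \<and> br x g \<noteq> 0" using not_central[OF in_I(1)[OF that(1)] that(2)] .
    then show ?thesis using pg[OF that(1) gH] by blast
  qed
  show False
  proof (rule no_wt_sym[of "\<lambda>x. if x = e then 0 else 1" "\<lambda>x. if x = e then 2 else if x = z then 3 else 1" e])
    fix i j assume n: "br i j \<noteq> 0" and rk: "(if i = e then 0 else 1) \<le> (if j = e then 0 else 1 :: nat)"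
    have nzz: "i \<noteq> z" "j \<noteq> z" using n by auto
    show "(if br i j = e then 2 else if br i j = z then 3 else 1) =
      (if i = e then 2 else if i = z then 3 else 1) + (if j = e then 2 else if j = z then 3 else (1 :: int))"
    proof (cases "i = e")
      case True
      then have "j \<noteq> e" using n ee by blast
      then have j: "j \<in> HH" using IH[OF br_mem(2)[OF n]] by blast
      then have bH: "br e j \<in> HH" using EE_HH[OF e(1) j] n True by simp
      then have "br e j = z" using nz1[OF bH] br_not_gen[OF n] True by blast
      then show ?thesis using True \<open>e \<noteq> z\<close> \<open>j \<noteq> e\<close> nzz by simp
    next
      case False
      then have "j \<noteq> e" using rk by auto
      then have "br i j = e" using HHe[OF _ _ n] IH[OF br_mem(1)[OF n]] IH[OF br_mem(2)[OF n]] False by blast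
      then show ?thesis using False \<open>j \<noteq> e\<close> nzz by simp
    qed
  qed (use e in simp_all)
qed

text \<open>Brackets are deeper than their factors, so the ordering by depth makes the table nearly
  triangular: \<open>e\<close>, \<open>f\<close>, \<open>t\<close> kill \<open>q\<close>, and
  \<open>z\<close> can only be \<open>q\<close> or \<open>f\<close>. In each case the Jacobi
  identity removes brackets until a contradiction appears or explicit weights fit.\<close>

lemma two_even_two_odd:
  assumes HHm: "HH = {p,q}" and EEm: "EE = {e,f}" and TTm: "TT = {t}"
    and d2: "d p = 2" "d q = 2" and ord: "dep p \<le> dep q" "dep e \<le> dep f"
    and dist: "p \<noteq> q" "e \<noteq> f"
  shows False
proof -
  have m: "p \<in> HH" "q \<in> HH" "e \<in> EE" "f \<in> EE" "t \<in> TT" using HHm EEm TTm by blast+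
  have mI: "p \<in> I" "q \<in> I" "e \<in> I" "f \<in> I" "t \<in> I" using m in_I by blast+
  have nz: "p \<noteq> 0" "q \<noteq> 0" "e \<noteq> 0" "f \<noteq> 0" "t \<noteq> 0" using mI I_nz by blast+
  have dj: "p \<noteq> e" "p \<noteq> f" "p \<noteq> t" "q \<noteq> e" "q \<noteq> f" "q \<noteq> t" "e \<noteq> t" "f \<noteq> t" using m parts by blast+
  have Im: "x = p \<or> x = q \<or> x = e \<or> x = f \<or> x = t" if "x \<in> I" for x using in_parts[OF that] HHm EEm TTm by blast
  have lt: "br i j = k \<Longrightarrow> k \<noteq> 0 \<Longrightarrow> dep i < dep k \<and> dep j < dep k" for i j k using dep_br[of i j] by auto
  have pp: "br p p = 0 \<or> br p p = t" using HH_sq[OF m(1) d2(1)] TTm by blast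
  have qq: "br q q = 0 \<or> br q q = t" using HH_sq[OF m(2) d2(2)] TTm by blast
  have pq: "br p q = 0 \<or> br p q = e \<or> br p q = f \<or> br p q = t" using HH_HH[OF m(1,2)] EEm TTm by blast
  have xp: "br x p = 0 \<or> br x p = q" if "x = e \<or> x = f \<or> x = t" for x
    using HH_odd[OF m(1), of x] that m HHm lt[of x p p] nz br_comm[of p x] by auto
  have xq: "br x q = 0" if "x = e \<or> x = f \<or> x = t" for x
  proof (rule ccontr)
    assume n: "br x q \<noteq> 0"
    then have "br x q \<in> HH" using HH_odd[OF m(2), of x] that m br_comm[of q x] by auto
    then have "br x q = p \<or> br x q = q" using HHm by blast
    then show False using dep_br[OF n] ord by auto
  qed
  have ee: "br e e = 0 \<or> br e e = f" using EE_sq[OF m(3)] EEm lt[of e e e] nz by auto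
  have ff: "br f f = 0" using EE_sq[OF m(4)] EEm lt[of f f f] lt[of f f e] ord nz by auto
  have ef: "br e f = 0 \<or> br e f = t"
    using odd_odd[of e f] m EEm TTm lt[of e f f] lt[of e f e] ord nz by auto
  have te: "br t e = 0 \<or> br t e = f" using TT_EE[OF m(5,3)] EEm lt[of t e e] nz by auto
  have tf: "br t f = 0" using TT_EE[OF m(5,4)] EEm lt[of t f f] lt[of t f e] ord nz by auto
  have tt: "br t t = 0" using TT_sq m by blast
  have com: "br q p = br p q" "br p e = br e p" "br p f = br f p" "br p t = br t p" "br f e = br e f"
    "br e t = br t e" by (rule br_comm)+
  have cq: "br q x = 0" if "x = e \<or> x = f \<or> x = t" for x using xq[OF that] br_comm[of q x] by simp
  have cf: "br f t = 0" using tf br_comm[of f t] by simp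
  have W0: "w p = (0::int)" if h: "br p p = t \<longrightarrow> w t = w p + w p" "br q q = t \<longrightarrow> w t = w q + w q" "br p q = e \<longrightarrow> w e = w p + w q" "br p q = f \<longrightarrow> w f = w p + w q" "br p q = t \<longrightarrow> w t = w p + w q" "br e p = q \<longrightarrow> w q = w e + w p" "br f p = q \<longrightarrow> w q = w f + w p" "br t p = q \<longrightarrow> w q = w t + w p" "br e e = f \<longrightarrow> w f = w e + w e" "br e f = t \<longrightarrow> w t = w e + w f" "br t e = f \<longrightarrow> w f = w t + w e" for w
  proof -
    have P0: "br p p \<noteq> 0 \<longrightarrow> w (br p p) = w p + w p" using pp h(1) by metis
    have P1: "br q q \<noteq> 0 \<longrightarrow> w (br q q) = w q + w q" using qq h(2) by metis
    have P2: "br p q \<noteq> 0 \<longrightarrow> w (br p q) = w p + w q" using pq h(3) h(4) h(5) by metis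
    have P3: "br e p \<noteq> 0 \<longrightarrow> w (br e p) = w e + w p" using xp[of e] h(6) by metis
    have P4: "br f p \<noteq> 0 \<longrightarrow> w (br f p) = w f + w p" using xp[of f] h(7) by metis
    have P5: "br t p \<noteq> 0 \<longrightarrow> w (br t p) = w t + w p" using xp[of t] h(8) by metis
    have P6: "br e e \<noteq> 0 \<longrightarrow> w (br e e) = w e + w e" using ee h(9) by metis
    have P7: "br e f \<noteq> 0 \<longrightarrow> w (br e f) = w e + w f" using ef h(10) by metis
    have P8: "br t e \<noteq> 0 \<longrightarrow> w (br t e) = w t + w e" using te h(11) by metis
    show "w p = 0"
    proof (rule wt'[OF _ mI(1)])
      fix i j assume ij: "i \<in> I" "j \<in> I" and n: "br i j \<noteq> 0"
      show "w (br i j) = w i + w j"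
        using Im[OF ij(1)] Im[OF ij(2)] n P0 P1 P2 P3 P4 P5 P6 P7 P8
        by (elim disjE; simp only: xq cq ff tf cf tt com simp_thms add.commute)
    qed
  qed
  have W: "(br p p = t \<longrightarrow> w t = w p + w p) \<and> (br q q = t \<longrightarrow> w t = w q + w q) \<and> (br p q = e \<longrightarrow> w e = w p + w q) \<and> (br p q = f \<longrightarrow> w f = w p + w q) \<and> (br p q = t \<longrightarrow> w t = w p + w q) \<and> (br e p = q \<longrightarrow> w q = w e + w p) \<and> (br f p = q \<longrightarrow> w q = w f + w p) \<and> (br t p = q \<longrightarrow> w q = w t + w p) \<and> (br e e = f \<longrightarrow> w f = w e + w e) \<and> (br e f = t \<longrightarrow> w t = w e + w f) \<and> (br t e = f \<longrightarrow> w f = w t + w e) \<longrightarrow> w p = (0::int)" for w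
    using W0[of w] by blast
  have zz': "z = q \<or> z = f"
  proof -
    have "z \<noteq> t" using TT_noncentral[OF m(5)] by blast
    moreover have "z \<noteq> p" using z_dep[OF mI(2)] ord dist by auto
    moreover have "z \<noteq> e" using z_dep[OF mI(4)] ord dist by auto
    ultimately show ?thesis using Im[OF zI] by blast
  qed
  have HHb: "br p p = t \<or> br q q = t \<or> br p q \<noteq> 0"
    using HH_bracket HHm pp qq com by auto
  have tgen: "br p p = t \<or> br q q = t \<or> br p q = t \<or> br e f = t"
  proof -
    obtain i j where n: "br i j = t" using dep_split[OF TT_nongen[OF m(5)]] by blast
    then have n0: "br i j \<noteq> 0" using nz by simp
    show ?thesis
      using Im[OF br_mem(1)[OF n0]] Im[OF br_mem(2)[OF n0]] n n0
      by (elim disjE) (use xp[of e] xp[of f] xp[of t] dj ee te xq cq ff tf cf tt com in auto)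
  qed
  have nc: "\<exists>y. (y = p \<or> y = q \<or> y = e \<or> y = f \<or> y = t) \<and> br x y \<noteq> 0" if "x \<in> I" "x \<noteq> z" for x
    using not_central[OF that] Im gen_I by blast
  define wf where "wf a b c d1 d2 x = (if x = p then a else if x = q then b else if x = e then c else if x = f then d1 else (d2::int))" for a b c d1 d2 x
  have wf: "wf a b c d1 d2 p = a" "wf a b c d1 d2 q = b" "wf a b c d1 d2 e = c" "wf a b c d1 d2 f = d1" "wf a b c d1 d2 t = d2"
    for a b c d1 d2 using dj dist unfolding wf_def by simp_all
  show False
  proof (cases "z = q")
    case True
    have q0: "br p q = 0" "br q q = 0" using True z_r by auto
    have ppt: "br p p = t" using HHb q0 nz by auto
    have ex0: "br (br e p) y = 0" "br (br f p) y = 0" "br (br t p) y = 0" for y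
      using zz[of "br e p" y] zz[of "br f p" y] zz[of "br t p" y] xp[of e] xp[of f] xp[of t] True by auto
    have te0: "br t e = 0"
    proof (rule ccontr)
      assume n: "br t e \<noteq> 0"
      have "br (br p p) e = br t e" using ppt by simp
      from jac[OF this n] show False using com ex0 n by auto
    qed
    have tp: "br t p = q"
    proof -
      have "t \<noteq> z" using True dj by blast
      then show ?thesis using nc[OF mI(5)] xq[of t] te0 tf tt xp[of t] by auto
    qed
    have ef0: "br e f = 0"
    proof (rule ccontr)
      assume "br e f \<noteq> 0"
      then have "br (br e f) p = q" using ef tp by auto
      from jac[OF this nz(2)] show False using com ex0 nz by auto
    qed
    have fp: "br f p = q"
    proof -
      have "f \<noteq> z" using True dj by blast
      then show ?thesis using nc[OF mI(4)] xq[of f] ef0 cf ff xp[of f] com by auto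
    qed
    have ee0: "br e e = 0"
    proof (rule ccontr)
      assume "br e e \<noteq> 0"
      then have "br (br e e) p = q" using ee fp by auto
      from jac[OF this nz(2)] show False using com ex0 nz by auto
    qed
    show False
      \<comment> \<open>Weights of \<open>p\<close>, \<open>q\<close>, \<open>e\<close>,
        \<open>f\<close>, \<open>t\<close> in this order. What remains is \<open>br p p = t\<close>
        and the action of \<open>e\<close>, \<open>f\<close>, \<open>t\<close> carrying
        \<open>p\<close> to \<open>q\<close>.\<close>
      using W[of "wf 1 3 2 2 2"] unfolding wf using q0 ppt te0 tp ef0 fp ee0 nz dj by simp
  next
    case False
    then have zf: "z = f" using zz' by blast
    have f0: "br f x = 0" "br x f = 0" for x using zf z_r by auto
    have ef0: "br e f = 0" using f0 by simp
    have qz: "q \<noteq> z" "t \<noteq> z" "e \<noteq> z" using zf dj dist by blast+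
    have tpe: "br t p = q \<or> br t e = f" using nc[OF mI(5) qz(2)] xp[of t] te xq[of t] tf tt by auto
    have ncq: "br q p \<noteq> 0 \<or> br q q \<noteq> 0" using nc[OF mI(2) qz(1)] cq by auto
    have nce: "br e p \<noteq> 0 \<or> br e e \<noteq> 0 \<or> br t e \<noteq> 0" using nc[OF mI(3) qz(3)] f0 xq[of e] com by auto
    have qt: "br q q = t \<Longrightarrow> br t p = 0"
      using lt[of q q t] lt[of t p q] nz xp[of t] by fastforce
    have noqq: "br q q = 0"
    proof (rule ccontr)
      assume "br q q \<noteq> 0"
      then have q: "br q q = t" using qq by blast
      then have t: "br t e = f" using tpe qt nz by auto
      then have "br (br q q) e = f" using q by simp
      from jac[OF this nz(4)] show False using cq[of e] xq[of e] nz by auto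
    qed
    then have pqn: "br p q \<noteq> 0" using ncq com by auto
    then consider "br p q = t" | "br p q = e" | "br p q = f" using pq by blast
    then show False
    proof cases
      case 1
      then have "br t p \<noteq> q" using lt[of p q t] lt[of t p q] nz by auto
      then have "br t e = f" using tpe by blast
      then have "br (br p q) e = f" using 1 by simp
      from jac[OF this nz(4)] show False using cq[of e] xp[of e] noqq nz by auto
    next
      case 2
      have ep: "br e p = 0" using 2 xp[of e] lt[of p q e] lt[of e p q] nz by auto
      have ee0: "br e e = 0"
      proof (rule ccontr)
        assume "br e e \<noteq> 0"
        then have "br (br p q) e = f" using ee 2 by simp
        from jac[OF this nz(4)] show False using cq[of e] ep nz by auto
      qed
      then have te: "br t e = f" using nce ep te by auto
      have "br p p = t" using tgen noqq ef0 2 dj nz by auto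
      then have "br (br p p) e = f" using te by simp
      from jac[OF this nz(4)] show False using ep com nz by auto
    next
      case 3
      have "br p p = t" using tgen noqq ef0 3 dj nz by auto
      \<comment> \<open>The bracket \<open>br p q = f\<close> now asks for weight 1 + 3 on
        \<open>f\<close>; this also suits a square of \<open>e\<close> or a bracket
        \<open>br t e\<close> with value \<open>f\<close>.\<close>
      then show False using W[of "wf 1 3 2 4 2"] unfolding wf using noqq 3 ef0 f0 nz dj dist by simp
    qed
  qed
qed

end

section \<open>Three planes, one odd-dimensional summand, and one or two trivial summands\<close>

locale three_planes_table = large_bracket_table I br d z for I :: "'b::zero set" and br d z +
  fixes p q r e :: 'b
  assumes HHm: "HH = {p,q,r}" and EEm: "EE = {e}" and TTn: "TT \<noteq> {}" "card TT \<le> 2"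
    and two: "d p = 2" "d q = 2" "d r = 2" and dist: "p \<noteq> q" "p \<noteq> r" "q \<noteq> r"
begin

lemma m: "p \<in> HH" "q \<in> HH" "r \<in> HH" "e \<in> EE"
  using HHm EEm by blast+

lemma mI: "p \<in> I" "q \<in> I" "r \<in> I" "e \<in> I"
  using m in_I by blast+

lemma nz: "p \<noteq> 0" "q \<noteq> 0" "r \<noteq> 0" "e \<noteq> 0"
  using mI I_nz by blast+

lemma HHc: "x \<in> HH \<Longrightarrow> x = p \<or> x = q \<or> x = r"
  using HHm by blast

lemma Im: "x \<in> I \<Longrightarrow> x \<in> TT \<or> x = e \<or> x \<in> HH"
  using in_parts EEm by blast

lemma sq: "x \<in> HH \<Longrightarrow> br x x = 0 \<or> br x x \<in> TT"
  using HH_sq HHc two by blast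

lemma HHTe: "x \<in> HH \<Longrightarrow> y \<in> HH \<Longrightarrow> br x y = 0 \<or> br x y \<in> TT \<or> br x y = e"
  using HH_HH EEm by blast

lemma ee: "br e e = 0"
proof (rule ccontr)
  assume n: "br e e \<noteq> 0"
  then have "br e e = e" using EE_sq[OF m(4)] EEm by blast
  then show False using dep_br[OF n] by simp
qed

lemma te: assumes "t \<in> TT" shows "br t e = 0" "br e t = 0"
proof -
  show "br t e = 0"
  proof (rule ccontr)
    assume n: "br t e \<noteq> 0"
    then have "br t e = e" using TT_EE[OF assms m(4)] EEm by blast
    then show False using dep_br[OF n] by simp
  qed
  then show "br e t = 0" using br_comm[of e t] by simp
qed

text \<open>A nonzero bracket of two trivial summands would be a third one, because it is deeper
  than both.\<close>

lemma tt: assumes "t \<in> TT" "t' \<in> TT" shows "br t t' = 0"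
proof (rule ccontr)
  assume n: "br t t' \<noteq> 0"
  have s: "br t t' \<in> TT" using TT_TT[OF assms] n by blast
  have "br t t' \<noteq> t" "br t t' \<noteq> t'" using dep_br[OF n] by auto
  moreover have "t \<noteq> t'" using n TT_sq assms by auto
  ultimately have "card {br t t', t, t'} = 3" by simp
  moreover have "card {br t t', t, t'} \<le> card TT" using s assms fin by (intro card_mono) simp_all
  ultimately show False using TTn by simp
qed

lemma xH: "x \<in> TT \<or> x = e \<Longrightarrow> y \<in> HH \<Longrightarrow> br x y = 0 \<or> br x y \<in> HH"
  using TT_HH EE_HH m(4) by blast

lemma xx0: "x \<in> TT \<or> x = e \<Longrightarrow> y \<in> TT \<or> y = e \<Longrightarrow> br x y = 0"
  using tt te ee by blast

text \<open>The trivial summands and \<open>e\<close> have zero brackets among themselves, so only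
  brackets involving a plane have to be checked.\<close>

lemma wtI:
  assumes "\<And>x y. x \<in> HH \<Longrightarrow> y \<in> HH \<Longrightarrow> br x y \<noteq> 0 \<Longrightarrow> w (br x y) = w x + w y"
    "\<And>x y. x \<in> TT \<or> x = e \<Longrightarrow> y \<in> HH \<Longrightarrow> br x y \<noteq> 0 \<Longrightarrow> w (br x y) = w x + w y"
    "x \<in> I" "w x \<noteq> (0::int)"
  shows False
proof (rule no_wt_sym[of "\<lambda>x. if x \<in> HH then 1 else 0" w x])
  fix i j assume n: "br i j \<noteq> 0" and rk: "(if i \<in> HH then 1 else 0) \<le> (if j \<in> HH then 1 else 0 :: nat)"
  show "w (br i j) = w i + w j"
  proof (cases "i \<in> HH")
    case True
    then have "j \<in> HH" using rk by (auto split: if_splits)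
    then show ?thesis using assms(1) True n by blast
  next
    case False
    then have i: "i \<in> TT \<or> i = e" using Im[OF br_mem(1)[OF n]] by blast
    then have "j \<in> HH" using xx0[OF i, of j] n Im[OF br_mem(2)[OF n]] by blast
    then show ?thesis using assms(2) i n by blast
  qed
qed (use assms in simp_all)

end

locale odd_centre_table = three_planes_table I br d z p q r e for I :: "'b::zero set" and br d z p q r e +
  assumes ez: "z = e" and gens: "dep p = 1" "dep q = 1"
begin

lemma e0: "br e x = 0" "br x e = 0"
  using ez z_r by auto

lemma tr: assumes "t \<in> TT" "x \<in> HH" shows "br t x = 0 \<or> br t x = r"
proof (cases "br t x = 0")
  case False
  then have "br t x \<noteq> p" "br t x \<noteq> q" using br_not_gen[OF False] gens by auto
  then show ?thesis using xH[of t x] assms False HHc by blast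
qed simp

text \<open>Some trivial summand moves a generator, and the value, not being \<open>p\<close> or
  \<open>q\<close>, is \<open>r\<close>.\<close>

lemma r_nongen: "dep r \<noteq> 1"
proof
  assume r1: "dep r = 1"
  obtain t where t: "t \<in> TT" using TTn by blast
  obtain g where g: "dep g = 1" "br t g \<noteq> 0" using not_central[OF in_I(2)[OF t]] TT_noncentral[OF t] by blast
  have "g \<in> HH" using Im[OF gen_I[OF g(1)]] gen_not_TT[OF g(1)] gen_not_z[OF g(1)] ez by blast
  then have "br t g = r" using tr[OF t] g by blast
  then show False using br_not_gen[OF g(2)] r1 by simp
qed

lemma gen_pq: "dep g = 1 \<Longrightarrow> g = p \<or> g = q"
  using Im[OF gen_I, of g] gen_not_TT[of g] gen_not_z[of g] ez HHc[of g] r_nongen by blast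

lemma act: "t \<in> TT \<Longrightarrow> br t p = r \<or> br t q = r"
  using not_central[OF in_I(2)] TT_noncentral gen_pq tr m by metis

text \<open>A trivial summand maps a generator to \<open>r\<close> and is therefore shallower than
  \<open>r\<close>, while \<open>br r x\<close> is deeper.\<close>

lemma rT: assumes "x \<in> HH" shows "br r x \<notin> TT"
proof
  assume s: "br r x \<in> TT"
  then have n: "br r x \<noteq> 0" using in_nz by blast
  obtain l where l: "br (br r x) l = r" using act[OF s] by blast
  then have "br (br r x) l \<noteq> 0" using nz by simp
  from dep_br[OF this] show False using l dep_br[OF n] by simp
qed

lemma re: "x \<in> HH \<Longrightarrow> br r x = 0 \<or> br r x = e"
  using HHTe[OF m(3)] rT by blast

lemma rr: "br r r = 0"
  using sq[OF m(3)] rT[OF m(3)] by blast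

lemma rtr: assumes "t \<in> TT" shows "br t r = 0"
proof (rule ccontr)
  assume n: "br t r \<noteq> 0"
  then have "br t r = r" using tr[OF assms m(3)] by blast
  then show False using dep_br[OF n] by simp
qed

lemma rpq: "br r p = e \<or> br r q = e"
proof -
  have "r \<noteq> z" using ez m parts by blast
  then obtain g where "dep g = 1" "br r g \<noteq> 0" using not_central[OF mI(3)] by blast
  then show ?thesis using gen_pq re m by blast
qed

lemma TTsub: "TT \<subseteq> {br p p, br p q, br q q}"
proof
  fix t assume t: "t \<in> TT"
  obtain g x where gx: "br g x = t" "dep g = 1" using dep_split[OF TT_nongen[OF t]] by blast
  have n: "br g x \<noteq> 0" using gx in_nz(2)[OF t] by simp
  have g: "g = p \<or> g = q" using gen_pq gx by blast
  then have gH: "g \<in> HH" using m by blast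
  have xHH: "x \<in> HH"
  proof (rule ccontr)
    assume "x \<notin> HH"
    then have "x \<in> TT \<or> x = e" using Im[OF br_mem(2)[OF n]] by blast
    then have "br g x \<in> HH" using xH[of x g] gH n br_comm[of g x] by auto
    then show False using gx t disj_parts by blast
  qed
  have "x \<noteq> r" using rT[OF gH] gx t br_comm[of g r] by auto
  then have "x = p \<or> x = q" using HHc[OF xHH] by blast
  then show "t \<in> {br p p, br p q, br q q}" using g gx br_comm[of p q] by auto
qed

text \<open>The Jacobi identity gives the claim or the other arrangement. In the latter,
  \<open>br l i\<close> is not the central \<open>e\<close>, hence is trivial, and
  \<open>jac_triv\<close> turns this arrangement into the first.\<close>

lemma sym:
  assumes "i \<in> HH" "j \<in> HH" "l \<in> HH" "br i j \<in> TT" "br (br i j) l = k" "k \<noteq> 0"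
  shows "br (br j l) i = k"
proof -
  have d1: "d (br i j) = 1" "d (br j i) = 1" using assms(4) br_comm[of j i] unfolding TT_def by simp_all
  have k': "br (br j i) l = k" using assms(5) br_comm[of i j] by simp
  have fin: "br (br j l) i = k" if "br (br l i) j = k"
  proof -
    have n: "br l i \<noteq> 0" using that assms(6) by auto
    have "br l i \<noteq> e" using that assms(6) e0 by auto
    then have "d (br i l) = 1" using HHTe[OF assms(3,1)] n br_comm[of i l] unfolding TT_def by auto
    then have "br (br l j) i = k" using jac_triv[OF k' assms(6) d1(2) d_HH[OF assms(3)]] by blast
    then show ?thesis using br_comm[of l j] by simp
  qed
  show ?thesis using jac[OF assms(5,6)] fin by blast
qed

text \<open>The relations pin down the table: \<open>br p p\<close> carries \<open>p\<close> to
  \<open>r\<close>, \<open>br r p = e\<close>, and \<open>q\<close> only enters through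
  \<open>br p q = e\<close>. Weights 1, 2, 3, 3, 4 on \<open>p\<close>, the trivial summand,
  \<open>q\<close>, \<open>r\<close>, \<open>e\<close> fit.\<close>

lemma pq_e_aux: assumes pqe: "br p q = e" and P: "br p p \<in> TT" shows False
proof -
  have tp: "br (br p p) q = 0"
  proof (rule ccontr)
    assume n: "br (br p p) q \<noteq> 0"
    have "br (br p q) p = br (br p p) q" using sym[OF m(1,1,2) P refl n] .
    then show False using pqe e0 n by simp
  qed
  have p1: "br (br p p) p = r" using act[OF P] tp nz by auto
  have rq: "br r q = 0"
  proof (rule ccontr)
    assume n: "br r q \<noteq> 0"
    then have "br (br (br p p) p) q = br r q" using p1 by simp
    from jac[OF this n] show False using pqe e0 tp br_comm[of q "br p p"] n by auto
  qed
  then have rp: "br r p = e" using rpq nz by auto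
  have qq: "br q q = 0"
  proof (rule ccontr)
    assume "br q q \<noteq> 0"
    then have Q: "br q q \<in> TT" using sq[OF m(2)] by blast
    have qp: "br (br q q) p = 0"
    proof (rule ccontr)
      assume n: "br (br q q) p \<noteq> 0"
      have "br (br q p) q = br (br q q) p" using sym[OF m(2,2,1) Q refl n] .
      then show False using pqe e0 n br_comm[of q p] by simp
    qed
    then have "br (br q q) q = r" using act[OF Q] nz by auto
    then have "br (br (br q q) q) p = e" using rp by simp
    from jac[OF this nz(4)] show False using pqe e0 qp br_comm[of q p] br_comm[of p "br q q"] nz by auto
  qed
  have T: "t = br p p" if "t \<in> TT" for t
    using TTsub that qq pqe in_nz(2)[OF that] disj_parts(3)[OF that] m(4) by auto
  define w where "w x = (if x = p then 1 else if x \<in> TT then 2 else if x = e then 4 else 3 :: int)" for x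
  have wv: "w p = 1" "w q = 3" "w r = 3" "w e = 4" "t \<in> TT \<Longrightarrow> w t = 2" for t
    using dist m parts unfolding w_def by auto
  show False
  proof (rule wtI[of w p])
    fix x y assume x: "x \<in> HH" and y: "y \<in> HH" and n: "br x y \<noteq> 0"
    show "w (br x y) = w x + w y"
      using HHc[OF x] HHc[OF y] n
      by (elim disjE) (use wv(1-4) wv(5)[OF P] qq rq rp rr pqe br_comm[of q p] br_comm[of p r] br_comm[of q r] in simp_all)
  next
    fix x y assume x: "x \<in> TT \<or> x = e" and y: "y \<in> HH" and n: "br x y \<noteq> 0"
    then have xT: "x \<in> TT" using e0 by auto
    then have "x = br p p" using T by blast
    then have "y \<noteq> q" "y \<noteq> r" using n tp rtr[OF xT] by auto
    then have "y = p" using HHc[OF y] by blast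
    then show "w (br x y) = w x + w y" using p1 \<open>x = br p p\<close> wv(1,3) wv(5)[OF P] by simp
  qed (use mI wv in simp_all)
qed

text \<open>Now products of \<open>p\<close> and \<open>q\<close> are zero or trivial, and the
  weights count generators: 1 for \<open>p\<close> and \<open>q\<close>, 2 for trivial summands, 3
  for \<open>r\<close>, 4 for \<open>e\<close>.\<close>

lemma pq_ne: assumes "br p q \<noteq> e" shows False
proof -
  define w where "w x = (if x = p \<or> x = q then 1 else if x \<in> TT then 2 else if x = e then 4 else 3 :: int)" for x
  have wv: "w p = 1" "w q = 1" "w r = 3" "w e = 4" "t \<in> TT \<Longrightarrow> w t = 2" for t
    using dist m parts unfolding w_def by auto
  have pq: "br x y = 0 \<or> br x y \<in> TT" if "x = p \<or> x = q" "y = p \<or> y = q" for x y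
    using that HHTe[OF m(1,2)] assms sq[OF m(1)] sq[OF m(2)] br_comm[of q p] by auto
  show False
  proof (rule wtI[of w p])
    fix x y assume x: "x \<in> HH" and y: "y \<in> HH" and n: "br x y \<noteq> 0"
    show "w (br x y) = w x + w y"
    proof (cases "x = r")
      case True
      then have "y \<noteq> r" using rr n by blast
      then have "w y = 1" using HHc[OF y] wv by auto
      then show ?thesis using re[OF y] n True wv by auto
    next
      case F: False
      then have x1: "x = p \<or> x = q" using HHc[OF x] by blast
      then have wx: "w x = 1" using wv by auto
      show ?thesis
      proof (cases "y = r")
        case True
        then have "br r x = e" using re[OF x] n br_comm[of x r] by auto
        then show ?thesis using True wx wv br_comm[of x r] by simp
      next
        case False
        then have y1: "y = p \<or> y = q" using HHc[OF y] by blast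
        then have "w y = 1" using wv by auto
        moreover have "w (br x y) = 2" using pq[OF x1 y1] n wv(5) by blast
        ultimately show ?thesis using wx by simp
      qed
    qed
  next
    fix x y assume x: "x \<in> TT \<or> x = e" and y: "y \<in> HH" and n: "br x y \<noteq> 0"
    then have xT: "x \<in> TT" using e0 by auto
    then have "y \<noteq> r" using n rtr by blast
    then have "w y = 1" using HHc[OF y] wv by auto
    then show "w (br x y) = w x + w y" using tr[OF xT y] n wv(3) wv(5)[OF xT] by auto
  qed (use mI wv in simp_all)
qed

end

lemma (in odd_centre_table) swap: "odd_centre_table I br d z q p r e"
  by unfold_locales (use HHm EEm TTn two dist ez gens in auto)

lemma (in odd_centre_table) odd_centre_false: False
proof (cases "br p q = e")
  case True
  interpret sw: odd_centre_table I br d z q p r e by (rule swap)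
  obtain t where t: "t \<in> TT" using TTn by blast
  have "e \<notin> TT" using m parts by blast
  then have "br p p \<in> TT \<or> br q q \<in> TT" using TTsub t True by blast
  then show False using pq_e_aux sw.pq_e_aux True br_comm[of q p] by auto
next
  case False
  then show False by (rule pq_ne)
qed

locale even_centre_table = three_planes_table I br d z p q r e for I :: "'b::zero set" and br d z p q r e +
  assumes rz: "z = r" and ord: "dep p \<le> dep q" "dep q \<le> dep r"
begin

lemma r0: "br r x = 0" "br x r = 0"
  using rz z_r by auto

lemma p_gen: "dep p = 1"
proof -
  obtain a b where ab: "a \<noteq> b" "dep a = 1" "dep b = 1" using two_gens by blast
  then have "a \<noteq> e \<or> b \<noteq> e" by blast
  then obtain g where g: "dep g = 1" "g \<noteq> e" using ab by blast
  then have "g = p \<or> g = q" using Im[OF gen_I[OF g(1)]] gen_not_TT[OF g(1)] gen_not_z[OF g(1)] rz HHc by blast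
  then show ?thesis using g ord dep_pos[of p] mI by auto
qed

text \<open>If \<open>p\<close> and \<open>q\<close> are generators, trivial summands and
  \<open>e\<close> can only carry them to \<open>r\<close>. So weight 1 on \<open>p\<close>,
  \<open>q\<close>, 3 on \<open>r\<close>, and 2 on everything else is compatible.\<close>

lemma gens_two: assumes "dep q = 1" shows False
proof -
  define w where "w x = (if x = p \<or> x = q then 1 else if x = r then 3 else 2 :: int)" for x
  have wv: "w p = 1" "w q = 1" "w r = 3" "w e = 2" "t \<in> TT \<Longrightarrow> w t = 2" for t
    using dist m parts unfolding w_def by auto
  have pq: "x = p \<or> x = q" if "x \<in> HH" "x \<noteq> r" for x using HHc that by blast
  show False
  proof (rule wtI[of w p])
    fix x y assume x: "x \<in> HH" and y: "y \<in> HH" and n: "br x y \<noteq> 0"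
    have "x \<noteq> r" "y \<noteq> r" using n r0 by auto
    then have "w x = 1" "w y = 1" using pq x y wv by auto
    then show "w (br x y) = w x + w y" using HHTe[OF x y] n wv by auto
  next
    fix x y assume x: "x \<in> TT \<or> x = e" and y: "y \<in> HH" and n: "br x y \<noteq> 0"
    have "y \<noteq> r" using n r0 by auto
    then have "w y = 1" using pq y wv by auto
    moreover have "w x = 2" using x wv by auto
    moreover have "br x y = r" using xH[OF x y] n HHc br_not_gen[OF n] p_gen assms by metis
    ultimately show "w (br x y) = w x + w y" using wv by simp
  qed (use mI wv in simp_all)
qed

text \<open>The generators are \<open>p\<close> and \<open>e\<close>, so brackets of planes are zero
  or trivial. A trivial summand carrying \<open>p\<close> to \<open>q\<close> must be
  \<open>br p p\<close>, and \<open>sym_triv\<close> with the Jacobi identity refutes it. Otherwise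
  \<open>q = br e p\<close>, and weights 1, 1, 2, 2, 3 on \<open>p\<close>, \<open>e\<close>,
  \<open>q\<close>, trivial summands, \<open>r\<close> are compatible.\<close>

lemma even_centre_false: False
proof -
  have q2: "dep q \<ge> 2" using gens_two nongen_dep[OF mI(2)] by blast
  have gpe: "g = p \<or> g = e" if "dep g = 1" for g
    using Im[OF gen_I[OF that]] gen_not_TT[OF that] gen_not_z[OF that] rz HHc[of g] q2 that by auto
  have e1: "dep e = 1"
  proof -
    obtain a b where ab: "a \<noteq> b" "dep a = 1" "dep b = 1" using two_gens by blast
    then show ?thesis using gpe[OF ab(2)] gpe[OF ab(3)] by auto
  qed
  have HT: "br x y = 0 \<or> br x y \<in> TT" if "x \<in> HH" "y \<in> HH" for x y
  proof (cases "br x y = 0")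
    case False
    have "br x y \<noteq> e" using br_not_gen[OF False] e1 by auto
    then show ?thesis using HHTe[OF that] by blast
  qed simp
  have tqr: "br x y = 0 \<or> br x y = q \<or> br x y = r" if "x \<in> TT \<or> x = e" "y \<in> HH" for x y
  proof (cases "br x y = 0")
    case False
    have "br x y \<noteq> p" using br_not_gen[OF False] p_gen by auto
    then show ?thesis using xH[OF that] HHc by blast
  qed simp
  have xq: "br x q = 0 \<or> br x q = r" if "x \<in> TT \<or> x = e" for x
  proof (cases "br x q = 0")
    case False
    have "br x q \<noteq> q" using dep_br[OF False] by auto
    then show ?thesis using tqr[OF that m(2)] by blast
  qed simp
  have com: "br q p = br p q" "br q e = br e q" "br p e = br e p" by (rule br_comm)+
  have tp: "br t p \<noteq> 0" if t: "t \<in> TT" for t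
  proof -
    obtain g where g: "dep g = 1" "br t g \<noteq> 0" using not_central[OF in_I(2)[OF t]] TT_noncentral[OF t] by blast
    then show ?thesis using gpe[OF g(1)] te(1)[OF t] by auto
  qed
  have qnc: "br p q \<noteq> 0 \<or> br e q \<noteq> 0"
  proof -
    have "q \<noteq> z" using rz dist by blast
    then obtain g where g: "dep g = 1" "br q g \<noteq> 0" using not_central[OF mI(2)] by blast
    then show ?thesis using gpe[OF g(1)] com by auto
  qed
  show False
  proof (cases "\<exists>t\<in>TT. br t p = q")
    case True
    then obtain t where t: "t \<in> TT" "br t p = q" by blast
    have tnz: "t \<noteq> 0" using in_nz t by blast
    obtain g x where gx: "br g x = t" "dep g = 1" using dep_split[OF TT_nongen[OF t(1)]] by blast
    have n: "br g x \<noteq> 0" using gx tnz by simp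
    have "g \<noteq> e"
    proof
      assume "g = e"
      then have "br e x = t" "br e x \<noteq> 0" using gx n by auto
      moreover have "x \<in> HH" using xx0[of e x] Im[OF br_mem(2)[OF n]] \<open>br e x \<noteq> 0\<close> by blast
      ultimately have "t \<in> HH" using xH[of e x] by auto
      then show False using t parts by blast
    qed
    then have gp: "g = p" using gpe gx by blast
    have xHH: "x \<in> HH"
    proof (rule ccontr)
      assume "x \<notin> HH"
      then have "br x p \<in> HH" using Im[OF br_mem(2)[OF n]] xH[of x p] m(1) n gp br_comm[of p x] by auto
      then show False using gx gp br_comm[of p x] t parts by auto
    qed
    have "br t p \<noteq> 0" using t nz by simp
    from dep_br[OF this] have "dep t < dep q" using t by simp
    moreover have "dep x < dep t" using dep_br[OF n] gx by simp
    ultimately have "x \<noteq> q" by auto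
    then have "x = p" using HHc[OF xHH] r0 n by auto
    then have tpp: "t = br p p" using gx gp by simp
    have pq0: "br p q = 0"
    proof (rule ccontr)
      assume "br p q \<noteq> 0"
      then have n: "br q p \<noteq> 0" using com by simp
      have "d t = 1" using t unfolding TT_def by simp
      moreover have "br t (br p p) = 0" using TT_sq t tpp by auto
      ultimately have "d (br q p) \<noteq> 1" using sym_triv[OF two(1) _ t(2) nz(2) _ n] by blast
      then show False using HT[OF m(2,1)] n unfolding TT_def by blast
    qed
    then have eq: "br e q = r" using qnc xq[of e] by auto
    \<comment> \<open>Applied to \<open>t\<close>, \<open>p\<close>, \<open>e\<close>, the Jacobi
      identity forces \<open>br p e = q\<close>; applied to \<open>p\<close>, \<open>p\<close>,
      \<open>q\<close>, it then needs the bracket of \<open>p\<close> and \<open>q\<close>, which is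
      zero.\<close>
    then have "br (br t p) e = r" using t com by simp
    from jac[OF this nz(3)] have "br (br p e) t = r" using te(2)[OF t(1)] nz by auto
    then have "br p e = q" using tqr[of e p] m com r0 nz by auto
    then have "br (br p p) q = r" using \<open>br (br p e) t = r\<close> tpp br_comm[of q t] by simp
    from jac[OF this nz(3)] show False using pq0 com nz by auto
  next
    case False
    then have tpr: "br t p = r" if "t \<in> TT" for t using tqr[of t p] m that tp[OF that] by blast
    have epq: "br e p = q"
    proof -
      obtain g x where gx: "br g x = q" "dep g = 1" using dep_split[OF q2] by blast
      have n: "br g x \<noteq> 0" using gx nz by simp
      have xm: "x \<in> TT \<or> x = e \<or> x = p \<or> x = q" using Im[OF br_mem(2)[OF n]] HHc[of x] n r0 by auto
      have "x \<noteq> q" using dep_br[OF n] gx by auto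
      show ?thesis
      proof (cases "g = p")
        case True
        then have "br x p = q" using gx br_comm[of p x] by simp
        moreover have "x \<noteq> p" using calculation sq[OF m(1)] nz m parts by auto
        moreover have "x \<notin> TT" using False calculation by blast
        ultimately show ?thesis using xm \<open>x \<noteq> q\<close> by blast
      next
        case F: False
        then have "g = e" using gpe gx by blast
        then show ?thesis using gx xm \<open>x \<noteq> q\<close> xx0[of e x] n by auto
      qed
    qed
    have tq: "br t q = 0" if t: "t \<in> TT" for t
    proof (rule ccontr)
      assume n: "br t q \<noteq> 0"
      have "br (br e p) t = br t q" using epq br_comm[of q t] by simp
      from jac[OF this n] show False using te[OF t] tpr[OF t] r0 br_comm[of p t] n by auto
    qed
    have qq: "br q q = 0"
    proof (rule ccontr)
      assume n: "br q q \<noteq> 0"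
      have "br (br e p) q = br q q" using epq by simp
      moreover have "br (br p q) e = 0" using HT[OF m(1,2)] te by auto
      moreover have "br (br q e) p = 0" using xq[of e] com r0 by auto
      ultimately show False using jac[of e p q "br q q"] n by auto
    qed
    have pq0: "br p q = 0"
    proof (rule ccontr)
      assume n: "br p q \<noteq> 0"
      then have s: "br p q \<in> TT" using HT[OF m(1,2)] by blast
      have "br (br p q) p = r" using tpr[OF s] .
      moreover have "d (br p q) = 1" "d (br q p) = 1" using s com unfolding TT_def by auto
      ultimately have "br (br p p) q = r" using jac_triv[of p q p r] nz two by simp
      then show False using HT[OF m(1,1)] tq nz by auto
    qed
    define w where "w x = (if x = p \<or> x = e then 1 else if x = r then 3 else 2 :: int)" for x
    have wv: "w p = 1" "w q = 2" "w r = 3" "w e = 1" "t \<in> TT \<Longrightarrow> w t = 2" for t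
      using dist m parts unfolding w_def by auto
    show False
    proof (rule wtI[of w p])
      fix x y assume x: "x \<in> HH" and y: "y \<in> HH" and n: "br x y \<noteq> 0"
      have "x = p" "y = p" using HHc[OF x] HHc[OF y] n r0 pq0 qq com by auto
      then show "w (br x y) = w x + w y" using HT[OF x y] n wv by auto
    next
      fix x y assume x: "x \<in> TT \<or> x = e" and y: "y \<in> HH" and n: "br x y \<noteq> 0"
      have y': "y = p \<or> y = q" using HHc[OF y] n r0 by auto
      show "w (br x y) = w x + w y"
      proof (cases "x = e")
        case True
        then show ?thesis using y' epq xq[of e] n wv by auto
      next
        case F: False
        then have xT: "x \<in> TT" using x by blast
        then have "y = p" using y' tq n by blast
        then show ?thesis using tpr[OF xT] wv(1,3) wv(5)[OF xT] by simp
      qed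
    qed (use mI wv in simp_all)
  qed
qed

end

section \<open>The count of dimensions for at least five summands\<close>

context large_bracket_table begin

text \<open>The central index is deepest, so it is \<open>e\<close> or the last plane. If it is
  \<open>e\<close>, then two planes are generators, and these come first in the order.\<close>

lemma three_planes_sorted:
  assumes "HH = {p,q,r}" "EE = {e}" "TT \<noteq> {}" "card TT \<le> 2" "d p = 2" "d q = 2" "d r = 2"
    "p \<noteq> q" "p \<noteq> r" "q \<noteq> r" and ord: "dep p \<le> dep q" "dep q \<le> dep r"
  shows False
proof -
  interpret b: three_planes_table I br d z p q r e
    by unfold_locales (use assms in auto)
  consider "z = e" | "z \<in> HH" using b.Im[OF zI] z_not_TT by blast
  then show False
  proof cases
    case 1
    obtain x y where xy: "x \<noteq> y" "dep x = 1" "dep y = 1" using two_gens by blast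
    have h: "g = p \<or> g = q \<or> g = r" if "dep g = 1" for g
      using b.Im[OF gen_I[OF that]] gen_not_TT[OF that] gen_not_z[OF that] 1 b.HHc by blast
    have "dep p \<ge> 1" using dep_pos b.mI by blast
    then have "dep p = 1 \<and> dep q = 1" using h[OF xy(2)] h[OF xy(3)] xy ord by auto
    then have "odd_centre_table I br d z p q r e" using 1 by unfold_locales auto
    then show False by (rule odd_centre_table.odd_centre_false)
  next
    case 2
    then have "z = r" using b.HHc[OF 2] z_dep[OF b.mI(3)] ord assms(8-10) by fastforce
    then have "even_centre_table I br d z p q r e" using ord by unfold_locales auto
    then show False by (rule even_centre_table.even_centre_false)
  qed
qed

text \<open>At least four nontrivial summands, one of them odd-dimensional, at least five summands
  in all and total dimension at most 11 leave these numbers of odd, even and trivial summands: 1, 3,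
  and 1 or 2; 1, 4, 0; 2, 2, 1. Each takes at least 10 dimensions, so the even-dimensional summands
  are planes.\<close>

lemma large_false: False
proof -
  have E: "EE \<noteq> {}" using some_odd_dim by blast
  have s: "2 * card HH + 3 * card EE + card TT \<le> 11" using sum_parts sum_bounds by linarith
  have c: "card TT + card HH + card EE \<ge> 5" using card_parts card5 by linarith
  have n: "card HH + card EE \<ge> 4" by (rule card_nontriv)
  have "card EE \<ge> 1" using E fin(3) by (simp add: Suc_le_eq card_gt_0_iff)
  then consider "card EE = 1" "card HH = 3" "card TT \<ge> 1" "card TT \<le> 2" | "card EE = 1" "card HH = 4" "card TT = 0"
    | "card EE = 2" "card HH = 2" "card TT = 1"
    using s c n by fastforce
  then show False
  proof cases
    case 1
    obtain e where e: "EE = {e}" using 1 card_1_singletonE by blast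
    obtain x y u where xyz: "HH = {x,y,u}" "x \<noteq> y" "x \<noteq> u" "y \<noteq> u" using 1 card_3_iff by metis
    have d: "d v = 2" if "v \<in> HH" for v using tight_HH[OF _ that] 1 by simp
    have T: "TT \<noteq> {}" using 1 by auto
    have *: "dep p \<le> dep q \<Longrightarrow> dep q \<le> dep r \<Longrightarrow> HH = {p,q,r} \<Longrightarrow> p \<noteq> q \<Longrightarrow> p \<noteq> r \<Longrightarrow> q \<noteq> r \<Longrightarrow> False" for p q r
      using three_planes_sorted[of p q r e] e T 1 d by auto
    have perm: "HH = {x,u,y}" "HH = {y,x,u}" "HH = {y,u,x}" "HH = {u,x,y}" "HH = {u,y,x}"
      using xyz(1) by blast+
    consider "dep x \<le> dep y" "dep y \<le> dep u" | "dep x \<le> dep u" "dep u \<le> dep y" | "dep y \<le> dep x" "dep x \<le> dep u"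
      | "dep y \<le> dep u" "dep u \<le> dep x" | "dep u \<le> dep x" "dep x \<le> dep y" | "dep u \<le> dep y" "dep y \<le> dep x"
      by linarith
    then show False using * perm xyz by cases metis+
  next
    case 2
    obtain e where "EE = {e}" using 2 card_1_singletonE by blast
    moreover have "TT = {}" using 2 fin by simp
    ultimately show False using four_even_one_odd 2 by blast
  next
    case 3
    obtain t where t: "TT = {t}" using 3 card_1_singletonE by blast
    obtain x y where xy: "HH = {x,y}" "x \<noteq> y" using 3 card_2_iff by metis
    obtain u v where uv: "EE = {u,v}" "u \<noteq> v" using 3 card_2_iff by metis
    have d: "d x = 2" "d y = 2" using tight_HH 3 xy by auto
    have perm: "HH = {y,x}" "EE = {v,u}" using xy uv by blast+
    have "dep x \<le> dep y \<or> dep y \<le> dep x" "dep u \<le> dep v \<or> dep v \<le> dep u" by linarith+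
    then show False
      using two_even_two_odd[OF xy(1) uv(1) t d _ _ xy(2) uv(2)] two_even_two_odd[OF xy(1) perm(2) t d _ _ xy(2) uv(2)[symmetric]]
        two_even_two_odd[OF perm(1) uv(1) t d(2,1) _ _ xy(2)[symmetric] uv(2)] two_even_two_odd[OF perm t d(2,1) _ _ xy(2)[symmetric] uv(2)[symmetric]]
      by blast
  qed
qed

end

theorem (in bracket_table) bracket_table_false: False
proof -
  have c: "card I \<ge> 5" using card_ge_4 card_ne_4 by linarith
  have "Max (dep ` I) \<in> dep ` I" using fin_I I_ne by simp
  then obtain z where z: "z \<in> I" "dep z = Max (dep ` I)" by auto
  then have "dep j \<le> dep z" if "j \<in> I" for j using that fin_I by simp
  then have "br z j = 0" for j using top_central z(1) by blast
  then have "large_bracket_table I br d z" using c z by unfold_locales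
  then show False by (rule large_bracket_table.large_false)
qed

section \<open>Lie's theorem and nilpotency\<close>

locale fd_lie = lie_algebra scale bracket + finite_dimensional_vector_space scale Basis
  for scale :: "complex \<Rightarrow> 'a::ab_group_add \<Rightarrow> 'a" (infixr "*s" 75) and bracket and Basis
begin

lemma br_lin_r: "Vector_Spaces.linear scale scale (bracket x)"
  using linear_bracket_right[of x] by simp

lemma br_add_r: "bracket x (y + z) = bracket x y + bracket x z"
  and br_scale_r: "bracket x (c *s y) = c *s bracket x y"
  and br_zero_r [simp]: "bracket x 0 = 0"
  and br_neg_r: "bracket x (- y) = - bracket x y"
  and br_diff_r: "bracket x (y - z) = bracket x y - bracket x z"
  and br_sum_r: "bracket x (sum f A) = (\<Sum>i\<in>A. bracket x (f i))"
proof -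
  interpret Vector_Spaces.linear scale scale "bracket x" by (rule br_lin_r)
  show "bracket x (y + z) = bracket x y + bracket x z" by (rule add)
  show "bracket x (c *s y) = c *s bracket x y" by (rule scale)
  show "bracket x 0 = 0" by (rule zero)
  show "bracket x (- y) = - bracket x y" by (rule neg)
  show "bracket x (y - z) = bracket x y - bracket x z" by (rule diff)
  show "bracket x (sum f A) = (\<Sum>i\<in>A. bracket x (f i))" by (rule sum)
qed

lemma br_add_l: "bracket (y + z) x = bracket y x + bracket z x"
  and br_scale_l: "bracket (c *s y) x = c *s bracket y x"
  and br_zero_l [simp]: "bracket 0 x = 0"
  and br_neg_l: "bracket (- y) x = - bracket y x"
proof -
  interpret Vector_Spaces.linear scale scale "\<lambda>y. bracket y x" by (rule linear_bracket_left)
  show "bracket (y + z) x = bracket y x + bracket z x" by (rule add)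
  show "bracket (c *s y) x = c *s bracket y x" by (rule scale)
  show "bracket 0 x = 0" by (rule zero)
  show "bracket (- y) x = - bracket y x" by (rule neg)
qed

lemma br_anti: "bracket y x = - bracket x y"
proof -
  have "bracket (x + y) (x + y) = bracket x x + bracket y x + (bracket x y + bracket y y)"
    by (simp only: br_add_l br_add_r)
  then have "bracket y x + bracket x y = 0" by (simp add: bracket_self add.commute)
  then show ?thesis by (simp add: eq_neg_iff_add_eq_0)
qed

lemma br_deriv: "bracket x (bracket y z) = bracket (bracket x y) z + bracket y (bracket x z)"
proof -
  have "bracket x (bracket y z) = - bracket y (bracket z x) - bracket z (bracket x y)"
    using jacobi[of x y z] by (simp add: algebra_simps eq_neg_iff_add_eq_0)
  also have "bracket z x = - bracket x z" by (rule br_anti)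
  also have "bracket z (bracket x y) = - bracket (bracket x y) z" by (rule br_anti)
  finally show ?thesis by (simp add: br_neg_r)
qed

lemma bracket_span_least: assumes "subspace S" "\<And>a b. a \<in> A \<Longrightarrow> b \<in> B \<Longrightarrow> bracket a b \<in> S"
  shows "bracket_span A B \<subseteq> S"
  unfolding bracket_span_def by (rule span_minimal) (use assms in auto)

lemma bracket_span_mem: "a \<in> A \<Longrightarrow> b \<in> B \<Longrightarrow> bracket a b \<in> bracket_span A B"
  unfolding bracket_span_def by (rule span_base) blast

lemma bracket_span_subspace: "subspace (bracket_span A B)"
  unfolding bracket_span_def by (rule subspace_span)

lemma subspace_zero_mem: "subspace S \<Longrightarrow> 0 \<in> S" by (rule subspace_0)

lemma subspace_preimage: assumes "subspace S" "Vector_Spaces.linear scale scale f" shows "subspace {x. f x \<in> S}"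
proof -
  interpret f: Vector_Spaces.linear scale scale f by fact
  show ?thesis unfolding subspace_def
    using assms(1) by (auto simp: f.add f.scale f.zero subspace_add subspace_scale subspace_0)
qed

text \<open>This is q(T) v, evaluated by Horner's scheme.\<close>

definition ap :: "('a \<Rightarrow> 'a) \<Rightarrow> complex poly \<Rightarrow> 'a \<Rightarrow> 'a" where
  "ap T q v = fold_coeffs (\<lambda>a x. a *s v + T x) q 0"

context
  fixes T :: "'a \<Rightarrow> 'a"
  assumes T: "Vector_Spaces.linear scale scale T"
begin

interpretation T: Vector_Spaces.linear scale scale T by (rule T)

lemma ap_0: "ap T 0 v = 0"
  unfolding ap_def by simp

lemma ap_pCons: "ap T (pCons a q) v = a *s v + T (ap T q v)"
  unfolding ap_def by (cases "q = 0 \<and> a = 0") (auto simp: T.zero)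

lemma ap_add: "ap T (p + q) v = ap T p v + ap T q v"
proof (induction p arbitrary: q)
  case 0 then show ?case by (simp add: ap_0)
next
  case (pCons a p)
  obtain b q' where q: "q = pCons b q'" by (cases q)
  have "ap T (pCons a p + q) v = (a + b) *s v + T (ap T p v + ap T q' v)"
    by (simp add: q ap_pCons pCons.IH)
  then show ?case by (simp add: q ap_pCons T.add scale_left_distrib)
qed

lemma ap_smult: "ap T (smult c p) v = c *s ap T p v"
  by (induction p) (simp_all add: ap_0 ap_pCons T.scale scale_right_distrib)

lemma ap_monom: "ap T (monom c i) v = c *s (T ^^ i) v"
  by (induction i) (simp_all add: monom_0 monom_Suc ap_pCons ap_0 T.zero T.scale)

lemma ap_sum: "ap T (sum f A) v = (\<Sum>i\<in>A. ap T (f i) v)"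
  by (induction A rule: infinite_finite_induct) (simp_all add: ap_0 ap_add)

lemma ap_linear_factor: "ap T ([:- c, 1:] * q) v = T (ap T q v) - c *s ap T q v"
proof -
  have "[:- c, 1:] * q = smult (- c) q + pCons 0 q" by simp
  then have "ap T ([:- c, 1:] * q) v = - c *s ap T q v + T (ap T q v)"
    by (simp only: ap_add ap_smult ap_pCons) simp
  then show ?thesis by simp
qed

lemma ap_mem: assumes "subspace W" "\<And>u. u \<in> W \<Longrightarrow> T u \<in> W" "v \<in> W" shows "ap T q v \<in> W"
  by (induction q) (use assms in \<open>simp_all add: ap_0 ap_pCons subspace_0 subspace_add subspace_scale\<close>)

text \<open>Take \<open>dimension + 1\<close> iterates of \<open>v\<close>. Linear dependence is
  stated for sets, so repeated iterates, which also give a polynomial relation, are treated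
  apart.\<close>

lemma annihilator: "\<exists>p. p \<noteq> 0 \<and> ap T p v = 0"
proof (cases "inj_on (\<lambda>i. (T ^^ i) v) {..dimension}")
  case False
  then obtain i j where ij: "i \<noteq> j" "(T ^^ i) v = (T ^^ j) v" unfolding inj_on_def by blast
  let ?p = "monom 1 i + smult (-1) (monom 1 j) :: complex poly"
  have "coeff ?p i = 1" using ij by simp
  then have "?p \<noteq> 0" by (metis coeff_0 zero_neq_one)
  moreover have "ap T ?p v = 0" by (subst ap_add, subst ap_smult) (simp add: ap_monom ij(2))
  ultimately show ?thesis by blast
next
  case True
  let ?S = "(\<lambda>i. (T ^^ i) v) ` {..dimension}"
  have "card ?S = Suc dimension" using card_image[OF True] by simp
  then have "dependent ?S"
    using independent_card_le_dim[of ?S UNIV] dim_UNIV dimension_def by fastforce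
  then obtain u where u: "\<exists>x\<in>?S. u x \<noteq> 0" "(\<Sum>x\<in>?S. u x *s x) = 0"
    using dependent_finite[of ?S] by auto
  let ?p = "\<Sum>i\<le>dimension. monom (u ((T ^^ i) v)) i"
  obtain i where i: "i \<le> dimension" "u ((T ^^ i) v) \<noteq> 0" using u(1) by auto
  have "coeff ?p i = (\<Sum>j\<le>dimension. if j = i then u ((T ^^ j) v) else 0)"
    by (simp add: coeff_sum)
  also have "\<dots> = u ((T ^^ i) v)" using i by (subst sum.delta) auto
  finally have "?p \<noteq> 0" using i by (metis coeff_0)
  moreover have "ap T ?p v = (\<Sum>i\<le>dimension. u ((T ^^ i) v) *s (T ^^ i) v)"
    by (simp add: ap_sum ap_monom)
  moreover have "\<dots> = 0" using u(2) sum.reindex[OF True, of "\<lambda>x. u x *s x"] by (simp add: o_def)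
  ultimately show ?thesis by auto
qed

text \<open>An eigenvector on W/J without forming the quotient. Among nonzero polynomials that carry
  some \<open>v\<close> in \<open>W\<close> outside \<open>J\<close> into \<open>J\<close>, take one
  of least degree. It is not constant, and after splitting off a root \<open>c\<close> the remaining
  factor carries \<open>v\<close> to the eigenvector, which is outside \<open>J\<close> by
  minimality.\<close>

lemma eigenvector_mod:
  assumes W: "subspace W" and J: "subspace J" "\<not> W \<subseteq> J"
    and TW: "\<And>u. u \<in> W \<Longrightarrow> T u \<in> W"
  shows "\<exists>u\<in>W. \<exists>c. u \<notin> J \<and> T u - c *s u \<in> J"
proof -
  define P where "P n \<longleftrightarrow> (\<exists>p v. p \<noteq> 0 \<and> degree p = n \<and> v \<in> W \<and> v \<notin> J \<and> ap T p v \<in> J)" for n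
  obtain v where v: "v \<in> W" "v \<notin> J" using J(2) by blast
  obtain p where "p \<noteq> 0" "ap T p v = 0" using annihilator by blast
  then have "P (degree p)" unfolding P_def using v subspace_zero_mem[OF J(1)] by (intro exI[of _ p] exI[of _ v]) simp
  then have PL: "P (LEAST n. P n)" by (rule LeastI)
  define n where "n = (LEAST n. P n)"
  obtain p v where p: "p \<noteq> 0" "degree p = n" "v \<in> W" "v \<notin> J" "ap T p v \<in> J"
    using PL unfolding P_def n_def by blast
  have "n \<noteq> 0"
  proof
    assume "n = 0"
    then obtain a where a: "p = [:a:]" using p(2) degree_eq_zeroE by metis
    then have "a \<noteq> 0" using p(1) by auto
    have "ap T p v = a *s v" by (simp add: a ap_pCons ap_0 T.zero)
    then have "inverse a *s a *s v \<in> J" using p(5) subspace_scale[OF J(1)] by metis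
    then show False using \<open>a \<noteq> 0\<close> p(4) by simp
  qed
  then have "\<not> constant (poly p)" using p(2) constant_degree by metis
  then obtain c where "poly p c = 0" using fundamental_theorem_of_algebra by blast
  then obtain q where q: "p = [:- c, 1:] * q" using poly_eq_0_iff_dvd[of p c] by (metis dvdE)
  have q0: "q \<noteq> 0" using q p(1) by auto
  then have "degree p = Suc (degree q)" unfolding q by (subst degree_mult_eq) auto
  then have lt: "degree q < n" using p(2) by simp
  define u where "u = ap T q v"
  have "u \<in> W" unfolding u_def by (rule ap_mem[OF W TW p(3)])
  moreover have "u \<notin> J"
  proof
    assume "u \<in> J"
    then have "P (degree q)" unfolding P_def u_def using q0 p by blast
    then show False using lt not_less_Least unfolding n_def by blast
  qed
  moreover have "T u - c *s u \<in> J" using p(5) unfolding q ap_linear_factor u_def .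
  ultimately show ?thesis by blast
qed

end

text \<open>The trace argument of Lie's theorem, replaced by a comparison of leading coefficients: if
  \<open>n\<close> is minimal with \<open>y\<^sup>n v\<close> in the span of the lower \<open>y\<^sup>i v\<close> modulo \<open>J\<close>, then applying
  \<open>x - lam x\<close> to this relation leaves \<open>n lam [x, y] y\<^sup>n\<^sup>-\<^sup>1 v\<close> in the span of lower terms.\<close>

lemma weight_bracket_zero:
  assumes J: "subspace J" and Ky: "\<And>x. x \<in> K \<Longrightarrow> bracket x y \<in> K"
    and yJ: "\<And>u. u \<in> J \<Longrightarrow> bracket y u \<in> J" and KJ: "\<And>x u. x \<in> K \<Longrightarrow> u \<in> J \<Longrightarrow> bracket x u \<in> J"
    and v: "v \<notin> J" and w: "\<And>x. x \<in> K \<Longrightarrow> bracket x v - lam x *s v \<in> J" and x: "x \<in> K"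
  shows "lam (bracket x y) = 0"
proof -
  define f where "f n = (bracket y ^^ n) v" for n
  define S where "S n = span (J \<union> f ` {..<n})" for n
  have f0: "f 0 = v" and fS: "f (Suc n) = bracket y (f n)" for n unfolding f_def by simp_all
  have S: "subspace (S n)" for n unfolding S_def by (rule subspace_span)
  have fin_S: "f i \<in> S n" if "i < n" for i n unfolding S_def by (rule span_base) (use that in auto)
  have J_S: "J \<subseteq> S n" for n unfolding S_def using span_superset by blast
  have S_mono: "S m \<subseteq> S n" if "m \<le> n" for m n unfolding S_def by (rule span_mono) (use that in auto)
  have up: "u \<in> S n \<Longrightarrow> v \<in> S (Suc n) \<Longrightarrow> u + v \<in> S (Suc n)" for u v n
  proof -
    assume "u \<in> S n" "v \<in> S (Suc n)"
    then show ?thesis using subsetD[OF S_mono[of n "Suc n"], of u] by (intro subspace_add[OF S]) simp_all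
  qed
  have S0: "S 0 = J" unfolding S_def using J by (simp add: span_eq_iff)
  have yS: "bracket y u \<in> S (Suc n)" if "u \<in> S n" for u n
  proof -
    have "S n \<subseteq> {u. bracket y u \<in> S (Suc n)}" unfolding S_def[of n]
    proof (rule span_minimal)
      show "J \<union> f ` {..<n} \<subseteq> {u. bracket y u \<in> S (Suc n)}"
      proof
        fix u assume "u \<in> J \<union> f ` {..<n}"
        then consider "u \<in> J" | i where "i < n" "u = f i" by auto
        then show "u \<in> {u. bracket y u \<in> S (Suc n)}"
        proof cases
          case 1 then show ?thesis using yJ J_S[of "Suc n"] by blast
        next
          case 2 then show ?thesis using fin_S[of "Suc i" "Suc n"] fS[of i] by simp
        qed
      qed
    qed (rule subspace_preimage[OF S br_lin_r])
    then show ?thesis using that by blast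
  qed
  \<comment> \<open>The second part for \<open>n\<close> is needed both for \<open>x\<close> and for
    \<open>bracket x y\<close>, which is again in \<open>K\<close>; hence \<open>x\<close> is
    quantified inside the induction. The factor \<open>Suc n\<close> counts the positions at which
    \<open>x\<close> can be commuted past a \<open>y\<close>.\<close>
  have A: "\<forall>x\<in>K. bracket x (f n) - lam x *s f n \<in> S n \<and>
      bracket x (f (Suc n)) - lam x *s f (Suc n) - of_nat (Suc n) *s lam (bracket x y) *s f n \<in> S n" for n
  proof (induction n)
    case 0
    show ?case
    proof (intro ballI conjI)
      fix x assume x: "x \<in> K"
      show "bracket x (f 0) - lam x *s f 0 \<in> S 0" using w[OF x] S0 f0 by simp
      have "bracket x (f (Suc 0)) - lam x *s f (Suc 0) - of_nat (Suc 0) *s lam (bracket x y) *s f 0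
        = (bracket (bracket x y) v - lam (bracket x y) *s v) + bracket y (bracket x v - lam x *s v)"
        using f0 fS[of 0] by (simp add: br_deriv[of x y v] br_diff_r br_scale_r)
      also have "\<dots> \<in> J" using w[OF x] w[OF Ky[OF x]] yJ J subspace_add by blast
      finally show "bracket x (f (Suc 0)) - lam x *s f (Suc 0) - of_nat (Suc 0) *s lam (bracket x y) *s f 0 \<in> S 0"
        using S0 by simp
    qed
  next
    case (Suc n)
    show ?case
    proof (intro ballI conjI)
      fix x assume x: "x \<in> K"
      let ?l = "lam (bracket x y)"
      have IH: "bracket x (f (Suc n)) - lam x *s f (Suc n) - of_nat (Suc n) *s ?l *s f n \<in> S n"
        using Suc x by blast
      have "of_nat (Suc n) *s ?l *s f n \<in> S (Suc n)" using fin_S[of n "Suc n"] subspace_scale[OF S] by simp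
      then have "(bracket x (f (Suc n)) - lam x *s f (Suc n) - of_nat (Suc n) *s ?l *s f n) +
        of_nat (Suc n) *s ?l *s f n \<in> S (Suc n)"
        by (rule up[OF IH])
      then show "bracket x (f (Suc n)) - lam x *s f (Suc n) \<in> S (Suc n)" by simp
      have z: "bracket (bracket x y) (f (Suc n)) - ?l *s f (Suc n) \<in> S (Suc n)"
      proof -
        have "bracket (bracket x y) (f (Suc n)) - ?l *s f (Suc n)
            - of_nat (Suc n) *s lam (bracket (bracket x y) y) *s f n \<in> S n"
          using Suc Ky[OF x] by blast
        moreover have "of_nat (Suc n) *s lam (bracket (bracket x y) y) *s f n \<in> S (Suc n)"
          using fin_S[of n "Suc n"] subspace_scale[OF S] by simp
        ultimately have "(bracket (bracket x y) (f (Suc n)) - ?l *s f (Suc n)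
            - of_nat (Suc n) *s lam (bracket (bracket x y) y) *s f n)
            + of_nat (Suc n) *s lam (bracket (bracket x y) y) *s f n \<in> S (Suc n)"
          by (rule up)
        then show ?thesis by simp
      qed
      have "bracket x (f (Suc (Suc n))) - lam x *s f (Suc (Suc n)) - of_nat (Suc (Suc n)) *s ?l *s f (Suc n)
        = (bracket (bracket x y) (f (Suc n)) - ?l *s f (Suc n)) +
          bracket y (bracket x (f (Suc n)) - lam x *s f (Suc n) - of_nat (Suc n) *s ?l *s f n)"
      proof -
        have e: "of_nat (Suc (Suc n)) *s ?l *s f (Suc n) = ?l *s f (Suc n) + of_nat (Suc n) *s ?l *s f (Suc n)"
          by (simp only: of_nat_Suc[of "Suc n"] scale_left_distrib scale_one)
        have g: "(X + Y) - A - (P + Q) = (X - P) + (Y - A - Q)" for X Y A P Q :: 'a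
          by (simp add: algebra_simps)
        show ?thesis unfolding e br_diff_r br_scale_r fS[symmetric] unfolding fS[of "Suc n"] br_deriv[of x y] by (rule g)
      qed
      also have "\<dots> \<in> S (Suc n)" using z yS[OF IH] subspace_add[OF S] by blast
      finally show "bracket x (f (Suc (Suc n))) - lam x *s f (Suc (Suc n)) - of_nat (Suc (Suc n)) *s ?l *s f (Suc n) \<in> S (Suc n)" .
    qed
  qed
  have "\<exists>n. f n \<in> S n"
  proof (rule ccontr)
    assume c: "\<not> ?thesis"
    have "n \<le> dim (J \<union> f ` {..<n})" for n
    proof (induction n)
      case 0 show ?case by simp
    next
      case (Suc n)
      have "J \<union> f ` {..<Suc n} = insert (f n) (J \<union> f ` {..<n})" by (auto simp: less_Suc_eq)
      moreover have "f n \<notin> span (J \<union> f ` {..<n})" using c S_def by blast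
      ultimately show ?case using Suc by (simp add: dim_insert)
    qed
    from this[of "Suc dimension"] show False using dim_subset_UNIV[of "J \<union> f ` {..<Suc dimension}"] by simp
  qed
  define n where "n = (LEAST n. f n \<in> S n)"
  have n: "f n \<in> S n" unfolding n_def by (rule LeastI_ex) fact
  have least: "f m \<notin> S m" if "m < n" for m using that not_less_Least unfolding n_def by blast
  have "n \<noteq> 0" using n v S0 f0 by metis
  then obtain m where m: "n = Suc m" by (cases n) auto
  define T where "T u = bracket x u - lam x *s u" for u
  have T: "Vector_Spaces.linear scale scale T"
    unfolding T_def by unfold_locales (simp_all add: br_add_r br_scale_r algebra_simps scale_right_diff_distrib scale_left_commute)
  have "S n \<subseteq> {u. T u \<in> S m}" unfolding S_def[of n]
  proof (rule span_minimal)
    have "T u \<in> S m" if "u \<in> J" for u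
      using KJ[OF x that] that J J_S[of m] unfolding T_def by (meson subsetD subspace_diff subspace_scale)
    moreover have "T (f i) \<in> S m" if "i < n" for i
      using A[of i] x S_mono[of i m] that m unfolding T_def by auto
    ultimately show "J \<union> f ` {..<n} \<subseteq> {u. T u \<in> S m}" by auto
  qed (rule subspace_preimage[OF S T])
  \<comment> \<open>Since \<open>f n\<close> already lies in \<open>S n\<close>, its image drops to
    \<open>S m\<close>. The leading term of \<open>T (f n)\<close> is then in \<open>S m\<close> as
    well, while \<open>f m\<close> is not, so its coefficient vanishes.\<close>
  then have "T (f n) \<in> S m" using n by blast
  moreover have "T (f n) - of_nat n *s lam (bracket x y) *s f m \<in> S m" using A[of m] x m unfolding T_def by blast
  ultimately have "T (f n) - (T (f n) - of_nat n *s lam (bracket x y) *s f m) \<in> S m" using subspace_diff[OF S] by blast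
  then have 1: "(of_nat n * lam (bracket x y)) *s f m \<in> S m" by simp
  show ?thesis
  proof (rule ccontr)
    assume "lam (bracket x y) \<noteq> 0"
    then have nz: "of_nat n * lam (bracket x y) \<noteq> 0" using \<open>n \<noteq> 0\<close> by simp
    have "inverse (of_nat n * lam (bracket x y)) *s (of_nat n * lam (bracket x y)) *s f m \<in> S m"
      using 1 subspace_scale[OF S] by blast
    then have "f m \<in> S m" using nz by (simp only: scale_scale left_inverse[OF nz] scale_one)
    then show False using least m by simp
  qed
qed

abbreviation derived :: "'a set \<Rightarrow> nat \<Rightarrow> 'a set" where
  "derived A n \<equiv> ((\<lambda>D. bracket_span D D) ^^ n) A"

lemma derived_props:
  assumes "subspace A" "\<And>x y. x \<in> A \<Longrightarrow> y \<in> A \<Longrightarrow> bracket x y \<in> A"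
  shows "subspace (derived A n) \<and> derived A (Suc n) \<subseteq> derived A n"
proof (induction n)
  case 0 then show ?case using assms by (simp add: bracket_span_least)
next
  case (Suc n)
  have "subspace (derived A (Suc n))" by (simp add: bracket_span_subspace)
  moreover have "derived A (Suc (Suc n)) \<subseteq> derived A (Suc n)"
    using Suc
    by (simp, intro bracket_span_least[OF bracket_span_subspace] bracket_span_mem) blast+
  ultimately show ?case by blast
qed

text \<open>Let \<open>J\<close> be a proper submodule of \<open>U\<close> of largest dimension. By
  Lie's theorem \<open>h\<close> has a common eigenvector on U/J; its weight space is stable under
  the whole algebra and hence everything. So \<open>h\<close> acts on U/J by scalars, which vanish
  on brackets of \<open>h\<close> with the algebra, thus on \<open>h\<close>, and
  \<open>bracket_span h U\<close> lies in \<open>J\<close>.\<close>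

theorem bracket_span_ideal_neq:
  assumes h: "lie_ideal h UNIV" "solvable h" "h \<subseteq> bracket_span UNIV h"
    and U: "subspace U" "U \<noteq> {0}" "\<And>x u. u \<in> U \<Longrightarrow> bracket x u \<in> U"
  shows "bracket_span h U \<noteq> U"
proof -
  define G where "G J \<longleftrightarrow> subspace J \<and> J \<subseteq> U \<and> J \<noteq> U \<and> (\<forall>x. \<forall>u\<in>J. bracket x u \<in> J)" for J
  have "G {0}" unfolding G_def using U subspace_zero_mem[OF U(1)] by auto
  moreover have "\<forall>J. G J \<longrightarrow> dim J < Suc dimension" using dim_subset_UNIV by (simp add: less_Suc_eq_le)
  ultimately have "\<exists>J. G J \<and> (\<forall>J'. G J' \<longrightarrow> dim J' \<le> dim J)" by (rule Lattices_Big.ex_has_greatest_nat)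
  then obtain J where J: "G J" "\<And>J'. G J' \<Longrightarrow> dim J' \<le> dim J" by auto
  have Js: "subspace J" and JU: "J \<subseteq> U" "J \<noteq> U" and Jst: "\<And>x u. u \<in> J \<Longrightarrow> bracket x u \<in> J"
    using J(1) unfolding G_def by blast+
  have hs: "subspace h" and hst: "\<And>x y. y \<in> h \<Longrightarrow> bracket x y \<in> h" using h(1) unfolding lie_ideal_def by auto
  define E where "E v = {x. \<exists>c. bracket x v - c *s v \<in> J}" for v
  have Es: "subspace (E v)" for v unfolding subspace_def
  proof (intro conjI ballI allI)
    show "0 \<in> E v" unfolding E_def using subspace_zero_mem[OF Js] by (auto intro!: exI[of _ 0])
  next
    fix x y assume "x \<in> E v" "y \<in> E v"
    then obtain c d where "bracket x v - c *s v \<in> J" "bracket y v - d *s v \<in> J" unfolding E_def by blast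
    then have "(bracket x v - c *s v) + (bracket y v - d *s v) \<in> J" using subspace_add[OF Js] by blast
    then have "bracket (x + y) v - (c + d) *s v \<in> J" by (simp add: br_add_l scale_left_distrib algebra_simps)
    then show "x + y \<in> E v" unfolding E_def by blast
  next
    fix a x assume "x \<in> E v"
    then obtain c where "bracket x v - c *s v \<in> J" unfolding E_def by blast
    then have "a *s (bracket x v - c *s v) \<in> J" using subspace_scale[OF Js] by blast
    then have "bracket (a *s x) v - (a * c) *s v \<in> J" by (simp add: br_scale_l scale_right_diff_distrib)
    then show "a *s x \<in> E v" unfolding E_def by blast
  qed
  \<comment> \<open>Weight spaces modulo \<open>J\<close> are stable under every \<open>y\<close>
    normalizing \<open>K\<close>. This is used for subspaces of the derived series and, at the end,
    for \<open>K = h\<close>.\<close>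
  have stable: "\<And>u. u \<in> W \<Longrightarrow> bracket y u \<in> W" "subspace W" "J \<subseteq> W" "v \<in> W"
    if W: "W = {u\<in>U. \<forall>x\<in>K. bracket x u - lam x *s u \<in> J}"
      and Ky: "\<And>x. x \<in> K \<Longrightarrow> bracket x y \<in> K"
      and v: "v \<in> U" "v \<notin> J" "\<And>x. x \<in> K \<Longrightarrow> bracket x v - lam x *s v \<in> J" for W K lam y v
  proof -
    have z: "lam (bracket x y) = 0" if "x \<in> K" for x
      by (rule weight_bracket_zero[OF Js Ky _ _ v(2,3) that]) (use Jst in blast)+
    show "bracket y u \<in> W" if "u \<in> W" for u
    proof -
      have u: "u \<in> U" "\<And>x. x \<in> K \<Longrightarrow> bracket x u - lam x *s u \<in> J" using that W by auto
      have "bracket x (bracket y u) - lam x *s bracket y u \<in> J" if x: "x \<in> K" for x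
      proof -
        have "bracket x (bracket y u) - lam x *s bracket y u =
          (bracket (bracket x y) u - lam (bracket x y) *s u) + bracket y (bracket x u - lam x *s u)"
          by (simp add: br_deriv[of x y u] br_diff_r br_scale_r z[OF x])
        also have "\<dots> \<in> J" using u(2)[OF Ky[OF x]] Jst[OF u(2)[OF x]] subspace_add[OF Js] by blast
        finally show ?thesis .
      qed
      then show ?thesis using W U(3)[OF u(1)] by blast
    qed
    show "subspace W" unfolding subspace_def
    proof (intro conjI ballI allI)
      show "0 \<in> W" using W subspace_zero_mem[OF Js] subspace_zero_mem[OF U(1)] by simp
    next
      fix a b assume ab: "a \<in> W" "b \<in> W"
      have "bracket x (a + b) - lam x *s (a + b) \<in> J" if "x \<in> K" for x
      proof -
        have "(bracket x a - lam x *s a) + (bracket x b - lam x *s b) \<in> J"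
          using ab that W subspace_add[OF Js] by blast
        then show ?thesis by (simp add: br_add_r scale_right_distrib algebra_simps)
      qed
      then show "a + b \<in> W" using W ab subspace_add[OF U(1)] by blast
    next
      fix c a assume a: "a \<in> W"
      have "bracket x (c *s a) - lam x *s (c *s a) \<in> J" if "x \<in> K" for x
      proof -
        have "c *s (bracket x a - lam x *s a) \<in> J" using a that W subspace_scale[OF Js] by blast
        then show ?thesis by (simp add: br_scale_r scale_right_diff_distrib mult.commute)
      qed
      then show "c *s a \<in> W" using W a subspace_scale[OF U(1)] by blast
    qed
    show "J \<subseteq> W" using W JU Jst subspace_diff[OF Js] subspace_scale[OF Js] by blast
    show "v \<in> W" using W v by blast
  qed
  note D = derived_props[OF hs hst]
  have Dst: "bracket x y \<in> derived h (Suc m)" if "x \<in> derived h m" "y \<in> derived h m" for x y m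
    using bracket_span_mem[OF that] by simp
  \<comment> \<open>One step up the derived series. Among the eigenvectors for the smaller term
    choose \<open>v\<close> so that it is an eigenvector for as large a part \<open>K\<close> of the
    larger term as possible. If some \<open>y\<close> were missing, an eigenvector of
    \<open>y\<close> in the weight space of \<open>K\<close> would do better.\<close>
  have step: "\<exists>v\<in>U. v \<notin> J \<and> derived h m \<subseteq> E v" if ex: "\<exists>v\<in>U. v \<notin> J \<and> derived h (Suc m) \<subseteq> E v" for m
  proof -
    define Q where "Q v \<longleftrightarrow> v \<in> U \<and> v \<notin> J \<and> derived h (Suc m) \<subseteq> E v" for v
    obtain v0 where "Q v0" using ex unfolding Q_def by blast
    moreover have "\<forall>v. Q v \<longrightarrow> dim (E v \<inter> derived h m) < Suc dimension" using dim_subset_UNIV by (simp add: less_Suc_eq_le)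
    ultimately have "\<exists>v. Q v \<and> (\<forall>u. Q u \<longrightarrow> dim (E u \<inter> derived h m) \<le> dim (E v \<inter> derived h m))"
      by (rule Lattices_Big.ex_has_greatest_nat)
    then obtain v where v: "Q v" "\<And>u. Q u \<Longrightarrow> dim (E u \<inter> derived h m) \<le> dim (E v \<inter> derived h m)" by auto
    define K where "K = E v \<inter> derived h m"
    have "derived h m \<subseteq> E v"
    proof (rule ccontr)
      assume "\<not> ?thesis"
      then obtain y where y: "y \<in> derived h m" "y \<notin> E v" by blast
      have Ky: "bracket x y \<in> K" if "x \<in> K" for x
      proof -
        have "bracket x y \<in> derived h (Suc m)" using Dst that y(1) unfolding K_def by blast
        then show ?thesis using v(1) D[of m] unfolding Q_def K_def by blast
      qed
      have "\<forall>x. \<exists>c. x \<in> K \<longrightarrow> bracket x v - c *s v \<in> J" unfolding K_def E_def by blast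
      then obtain lam where lam: "\<And>x. x \<in> K \<Longrightarrow> bracket x v - lam x *s v \<in> J" by metis
      define W where "W = {u\<in>U. \<forall>x\<in>K. bracket x u - lam x *s u \<in> J}"
      have vU: "v \<in> U" "v \<notin> J" using v(1) unfolding Q_def by blast+
      note st = stable[OF W_def Ky vU lam]
      have "\<not> W \<subseteq> J" using st(4) vU by blast
      from eigenvector_mod[OF br_lin_r st(2) Js this st(1)]
      obtain u c where u: "u \<in> W" "u \<notin> J" "bracket y u - c *s u \<in> J" by blast
      have KE: "K \<subseteq> E u" using u(1) unfolding W_def E_def by blast
      have yE: "y \<in> E u" using u(3) unfolding E_def by blast
      have "derived h (Suc m) \<subseteq> K" using v(1) D[of m] unfolding Q_def K_def by blast
      then have "Q u" using u KE unfolding Q_def W_def by blast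
      have Ks: "subspace K" unfolding K_def using subspace_inter[OF Es] D by blast
      have K's: "subspace (E u \<inter> derived h m)" using subspace_inter[OF Es] D by blast
      have "K \<subset> E u \<inter> derived h m" using KE yE y unfolding K_def by blast
      then have "dim K < dim (E u \<inter> derived h m)" 
        using dim_psubset[of K "E u \<inter> derived h m"] Ks K's by (metis span_eq_iff)
      then show False using v(2)[OF \<open>Q u\<close>] unfolding K_def by simp
    qed
    then show ?thesis using v(1) unfolding Q_def by blast
  qed
  obtain n where n: "derived h n = {0}" using h(2) unfolding solvable_def by blast
  obtain v0 where "v0 \<in> U" "v0 \<notin> J" using JU by blast
  moreover have "derived h n \<subseteq> E v0" using n subspace_zero_mem[OF Es] by simp
  ultimately have base: "\<exists>v\<in>U. v \<notin> J \<and> derived h n \<subseteq> E v" by blast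
  \<comment> \<open>Climbing from the vanishing term to \<open>h\<close> itself, which is reached at
    \<open>m = n\<close>.\<close>
  have "\<exists>v\<in>U. v \<notin> J \<and> derived h (n - m) \<subseteq> E v" for m
  proof (induction m)
    case 0 then show ?case using base by simp
  next
    case (Suc m)
    show ?case
    proof (cases "n - m = 0")
      case True
      then have "n - Suc m = n - m" by simp
      then show ?thesis using Suc by simp
    next
      case False
      then have "n - m = Suc (n - Suc m)" by simp
      then show ?thesis using Suc step by metis
    qed
  qed
  from this[of n] obtain v where v: "v \<in> U" "v \<notin> J" "h \<subseteq> E v" by auto
  have "\<forall>x. \<exists>c. x \<in> h \<longrightarrow> bracket x v - c *s v \<in> J" using v(3) unfolding E_def by blast
  then obtain lam where lam: "\<And>x. x \<in> h \<Longrightarrow> bracket x v - lam x *s v \<in> J" by metis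
  have hr: "bracket x y \<in> h" if "x \<in> h" for x y
    using hst[OF that, of y] br_anti[of x y] subspace_neg[OF hs] by simp
  define W where "W = {u\<in>U. \<forall>x\<in>h. bracket x u - lam x *s u \<in> J}"
  note st = stable[OF W_def hr v(1,2) lam]
  have "W = U"
  proof (rule ccontr)
    assume "W \<noteq> U"
    then have "G W" unfolding G_def using st unfolding W_def by blast
    moreover have "dim J < dim W" using dim_psubset[of J W] st(2,3,4) Js v by (metis psubsetI span_eq_iff)
    ultimately show False using J(2) by fastforce
  qed
  have "bracket_span h U \<subseteq> J"
  proof (rule bracket_span_least[OF Js])
    fix x u assume x: "x \<in> h" and u: "u \<in> U"
    have "bracket_span UNIV h \<subseteq> {x. bracket x u \<in> J}"
    proof (rule bracket_span_least)
      show "subspace {x. bracket x u \<in> J}" by (rule subspace_preimage[OF Js linear_bracket_left])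
      fix a b assume b: "b \<in> h"
      have "lam (bracket b a) = 0"
        by (rule weight_bracket_zero[OF Js hr _ _ v(2) lam b]) (use Jst in blast)+
      moreover have "bracket (bracket b a) u - lam (bracket b a) *s u \<in> J"
        using \<open>W = U\<close> u hr[OF b] unfolding W_def by blast
      ultimately have "bracket (bracket b a) u \<in> J" by simp
      then have "- bracket (bracket b a) u \<in> J" using subspace_neg[OF Js] by blast
      then show "bracket a b \<in> {x. bracket x u \<in> J}" using br_anti[of a b] by (simp add: br_neg_l)
    qed
    then show "bracket x u \<in> J" using h(3) x by blast
  qed
  then show ?thesis using JU by blast
qed

end

section \<open>The table of a sympathetic Lie algebra\<close>

locale levi_setting = fd_lie scale bracket Basis
  for scale :: "complex \<Rightarrow> 'a::ab_group_add \<Rightarrow> 'a" (infixr "*s" 75) and bracket and Basis +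
  fixes L h :: "'a set" and k :: nat and V :: "nat \<Rightarrow> 'a set"
  assumes symp: sympathetic and nss: "\<not> semisimple UNIV" and levi: "levi_decomposition L h"
    and simpL: "simple L" and ds: "direct_sum {1..k} V h"
    and sm: "i \<in> {1..k} \<Longrightarrow> simple_module L (V i)"
    and tbl: "i \<in> {1..k} \<Longrightarrow> j \<in> {1..k} \<Longrightarrow> bracket_span (V i) (V j) \<noteq> {0} \<Longrightarrow>
           \<exists>!p. p \<in> {1..k} \<and> bracket_span (V i) (V j) = V p"
    and zc: "k \<ge> 5 \<Longrightarrow> simple_module L (center h)"
begin

definition I :: "nat set" where "I = {1..k}"

lemma fin_I [simp]: "finite I" and zero_I: "0 \<notin> I" unfolding I_def by simp_all

lemma Ls: "subspace L" and Lc: "x \<in> L \<Longrightarrow> y \<in> L \<Longrightarrow> bracket x y \<in> L"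
  using simpL unfolding simple_def lie_subalgebra_def by blast+

lemma h_ideal: "lie_ideal h UNIV" and h_solv: "solvable h" and Lh: "L \<inter> h = {0}"
  and Lh_dec: "\<exists>l\<in>L. \<exists>r\<in>h. x = l + r"
  using levi unfolding levi_decomposition_def is_radical_def by blast+

lemma hs: "subspace h" and hst: "y \<in> h \<Longrightarrow> bracket x y \<in> h"
  using h_ideal unfolding lie_ideal_def by blast+

lemma hst': "y \<in> h \<Longrightarrow> bracket y x \<in> h"
  using hst[of y x] br_anti[of y x] subspace_neg[OF hs] by simp

lemma Vs: "i \<in> I \<Longrightarrow> subspace (V i)" and Vst: "i \<in> I \<Longrightarrow> x \<in> L \<Longrightarrow> v \<in> V i \<Longrightarrow> bracket x v \<in> V i"
  and Vne: "i \<in> I \<Longrightarrow> V i \<noteq> {0}"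
  and Vsimple: "i \<in> I \<Longrightarrow> submodule L U \<Longrightarrow> U \<subseteq> V i \<Longrightarrow> U = {0} \<or> U = V i"
  using sm unfolding I_def simple_module_def submodule_def by blast+

abbreviation fam :: "(nat \<Rightarrow> 'a) \<Rightarrow> bool" where "fam v \<equiv> \<forall>i\<in>I. v i \<in> V i"
abbreviation Ssum :: "(nat \<Rightarrow> 'a) \<Rightarrow> 'a" where "Ssum v \<equiv> \<Sum>i\<in>I. v i"

lemma bij: "bij_betw (\<lambda>v. Ssum v) (Pi\<^sub>E I V) h"
  using ds unfolding direct_sum_def I_def by blast

lemma fam_h: assumes "fam v" shows "Ssum v \<in> h"
proof -
  have "restrict v I \<in> Pi\<^sub>E I V" using assms by simp
  then have "Ssum (restrict v I) \<in> h" using bij bij_betwE by blast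
  then show ?thesis by simp
qed

lemma h_fam: assumes "x \<in> h" shows "\<exists>v. fam v \<and> x = Ssum v"
proof -
  have "x \<in> (\<lambda>v. Ssum v) ` Pi\<^sub>E I V" using bij assms unfolding bij_betw_def by simp
  then obtain v where "v \<in> Pi\<^sub>E I V" "x = Ssum v" by blast
  then show ?thesis by (auto simp: PiE_iff)
qed

lemma fam_uniq: assumes "fam v" "fam v'" "Ssum v = Ssum v'" "i \<in> I" shows "v i = v' i"
proof -
  have "restrict v I \<in> Pi\<^sub>E I V" "restrict v' I \<in> Pi\<^sub>E I V" using assms by simp_all
  moreover have "Ssum (restrict v I) = Ssum (restrict v' I)" using assms(3) by simp
  ultimately have "restrict v I = restrict v' I" using bij unfolding bij_betw_def inj_on_def by blast
  then show ?thesis using assms(4) by (metis restrict_apply')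
qed

lemma fam_single: assumes "i \<in> I" "x \<in> V i"
  shows "fam (\<lambda>j. if j = i then x else 0)" "Ssum (\<lambda>j. if j = i then x else 0) = x"
  using assms subspace_zero_mem[OF Vs] by (auto simp: sum.delta)

lemma fam_add: "fam v \<Longrightarrow> fam w \<Longrightarrow> fam (\<lambda>i. v i + w i)"
  using subspace_add[OF Vs] by blast

lemma fam_scale: "fam v \<Longrightarrow> fam (\<lambda>i. c *s v i)"
  using subspace_scale[OF Vs] by blast

lemma Vh: "i \<in> I \<Longrightarrow> V i \<subseteq> h"
proof
  fix x assume "i \<in> I" "x \<in> V i"
  then show "x \<in> h" using fam_h[OF fam_single(1)] fam_single(2) by metis
qed

text \<open>The sum of the \<open>V i\<close> with \<open>i\<close> in \<open>J\<close>, given by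
  families so that uniqueness of components applies directly.\<close>

definition VS :: "nat set \<Rightarrow> 'a set" where
  "VS J = {Ssum v | v. fam v \<and> (\<forall>i\<in>I - J. v i = 0)}"

lemma VS_subspace: "subspace (VS J)"
  unfolding subspace_def
proof (intro conjI ballI allI)
  show "0 \<in> VS J" unfolding VS_def using subspace_zero_mem[OF Vs] by (auto intro!: exI[of _ "\<lambda>_. 0"])
next
  fix x y assume "x \<in> VS J" "y \<in> VS J"
  then obtain v w where v: "x = Ssum v" "fam v" "\<forall>i\<in>I - J. v i = 0" and w: "y = Ssum w" "fam w" "\<forall>i\<in>I - J. w i = 0"
    unfolding VS_def by blast
  have "x + y = Ssum (\<lambda>i. v i + w i)" using v w by (simp add: sum.distrib)
  moreover have "\<forall>i\<in>I - J. v i + w i = 0" using v w by simp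
  ultimately show "x + y \<in> VS J" unfolding VS_def using fam_add[OF v(2) w(2)] by blast
next
  fix c x assume "x \<in> VS J"
  then obtain v where v: "x = Ssum v" "fam v" "\<forall>i\<in>I - J. v i = 0" unfolding VS_def by blast
  have "c *s x = Ssum (\<lambda>i. c *s v i)" using v by (simp add: scale_sum_right)
  moreover have "\<forall>i\<in>I - J. c *s v i = 0" using v by simp
  ultimately show "c *s x \<in> VS J" unfolding VS_def using fam_scale[OF v(2)] by blast
qed

lemma V_sub_VS: assumes "i \<in> I" "i \<in> J" shows "V i \<subseteq> VS J"
proof
  fix x assume x: "x \<in> V i"
  have "\<forall>j\<in>I - J. (if j = i then x else 0) = 0" using assms by auto
  then show "x \<in> VS J" unfolding VS_def using fam_single[OF assms(1) x]
    by (intro CollectI exI[of _ "\<lambda>j. if j = i then x else 0"]) simp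
qed

lemma VS_least: assumes "subspace S" "\<And>i. i \<in> I \<Longrightarrow> i \<in> J \<Longrightarrow> V i \<subseteq> S" shows "VS J \<subseteq> S"
proof
  fix x assume "x \<in> VS J"
  then obtain v where v: "x = Ssum v" "fam v" "\<forall>i\<in>I - J. v i = 0" unfolding VS_def by blast
  have "v i \<in> S" if "i \<in> I" for i using v assms(2)[OF that] that subspace_zero_mem[OF assms(1)] by (cases "i \<in> J") auto
  then show "x \<in> S" unfolding v(1) by (rule subspace_sum[OF assms(1)])
qed

lemma VS_zero: assumes "i \<in> I" "i \<notin> J" "x \<in> V i" "x \<in> VS J" shows "x = 0"
proof -
  obtain v where v: "x = Ssum v" "fam v" "\<forall>i\<in>I - J. v i = 0" using assms(4) unfolding VS_def by blast
  have "(if i = i then x else 0) = v i"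
    by (rule fam_uniq[OF fam_single(1)[OF assms(1,3)] v(2) _ assms(1)]) (use v fam_single(2)[OF assms(1,3)] in simp)
  then show ?thesis using v(3) assms by simp
qed

text \<open>Here directness of the sum enters: a summand lies inside a sum of summands only if it is
  one of them as a subspace, however many of them are isomorphic to it.\<close>

lemma V_VS_iff: assumes "i \<in> I" "V i \<subseteq> VS J" shows "i \<in> J"
proof (rule ccontr)
  assume n: "i \<notin> J"
  have "x = 0" if "x \<in> V i" for x using VS_zero[OF assms(1) n that] assms(2) that by blast
  then show False using Vne[OF assms(1)] subspace_zero_mem[OF Vs[OF assms(1)]] by auto
qed

lemma VS_h: "h = VS I"
proof
  show "h \<subseteq> VS I" using h_fam unfolding VS_def by blast
  show "VS I \<subseteq> h" by (rule VS_least[OF hs]) (use Vh in blast)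
qed

lemma V_inj: assumes "i \<in> I" "j \<in> I" "V i = V j" shows "i = j"
proof -
  have "V i \<subseteq> VS {j}" using V_sub_VS[OF assms(2), of "{j}"] assms(3) by simp
  then show ?thesis using V_VS_iff[OF assms(1)] by blast
qed

lemma UNIV_span: assumes "subspace S" "L \<subseteq> S" "\<And>i. i \<in> I \<Longrightarrow> V i \<subseteq> S" shows "x \<in> S"
proof -
  obtain l r where lr: "l \<in> L" "r \<in> h" "x = l + r" using Lh_dec by blast
  have "h \<subseteq> S" unfolding VS_h by (rule VS_least[OF assms(1)]) (use assms(3) in blast)
  then show ?thesis using lr assms(1,2) subspace_add by blast
qed

text \<open>All brackets lie in L + [g, h], so this sum is the whole algebra. As \<open>L\<close>
  meets \<open>h\<close> trivially and [g, h] is inside \<open>h\<close>, the part in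
  \<open>h\<close> is [g, h].\<close>

lemma h_perfect: "h \<subseteq> bracket_span UNIV h"
proof -
  define W where "W = bracket_span UNIV h"
  have Ws: "subspace W" unfolding W_def by (rule bracket_span_subspace)
  have Wh: "W \<subseteq> h" unfolding W_def by (rule bracket_span_least[OF hs]) (rule hst)
  have W: "bracket x y \<in> W" "bracket y x \<in> W" if "y \<in> h" for x y
  proof -
    show "bracket x y \<in> W" unfolding W_def by (rule bracket_span_mem) (use that in auto)
    then show "bracket y x \<in> W" using br_anti[of y x] subspace_neg[OF Ws] by simp
  qed
  define S where "S = {l + w | l w. l \<in> L \<and> w \<in> W}"
  have Ss: "subspace S" unfolding S_def by (rule subspace_sums[OF Ls Ws])
  have "bracket_span UNIV UNIV \<subseteq> S"
  proof (rule bracket_span_least[OF Ss])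
    fix a b
    obtain l r l' r' where d: "l \<in> L" "r \<in> h" "a = l + r" "l' \<in> L" "r' \<in> h" "b = l' + r'" using Lh_dec by metis
    have "bracket a b = bracket l l' + (bracket l r' + bracket r b)" by (simp add: d br_add_l br_add_r)
    moreover have "bracket l r' + bracket r b \<in> W" using W d subspace_add[OF Ws] by blast
    ultimately show "bracket a b \<in> S" unfolding S_def using Lc[OF d(1,4)] by blast
  qed
  then have U: "S = UNIV" using symp unfolding sympathetic_def by auto
  show ?thesis
  proof
    fix x assume x: "x \<in> h"
    obtain l w where lw: "l \<in> L" "w \<in> W" "x = l + w" using U unfolding S_def by blast
    then have "l = x - w" by simp
    then have "l \<in> h" using x lw Wh subspace_diff[OF hs] by blast
    then have "l = 0" using lw Lh by blast
    then show "x \<in> bracket_span UNIV h" using lw W_def by simp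
  qed
qed

lemma I_ne: "I \<noteq> {}"
proof
  assume "I = {}"
  then have "h = {0}" using h_fam subspace_zero_mem[OF hs] by auto
  then have "semisimple UNIV" using levi unfolding semisimple_def levi_decomposition_def lie_subalgebra_def by auto
  then show False using nss by blast
qed

section \<open>The table of brackets and its Jacobi, nilpotency and weight rules\<close>

definition VV :: "nat \<Rightarrow> 'a set" where "VV p = (if p \<in> I then V p else {0})"

definition br :: "nat \<Rightarrow> nat \<Rightarrow> nat" where
  "br i j = (if i \<in> I \<and> j \<in> I \<and> bracket_span (V i) (V j) \<noteq> {0}
     then THE p. p \<in> I \<and> bracket_span (V i) (V j) = V p else 0)"

lemma VVs: "subspace (VV p)"
  unfolding VV_def using Vs by auto

lemma VV_0 [simp]: "VV 0 = {0}"
  unfolding VV_def using zero_I by simp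

lemma VV_I: "p \<in> I \<Longrightarrow> VV p = V p"
  unfolding VV_def by simp

lemma br_span: assumes "i \<in> I" "j \<in> I" shows "bracket_span (V i) (V j) = VV (br i j)"
    and br_cases: "br i j = 0 \<or> br i j \<in> I"
proof -
  have *: "br i j \<in> I \<and> bracket_span (V i) (V j) = V (br i j)"
    if "i \<in> I" "j \<in> I" and n: "bracket_span (V i) (V j) \<noteq> {0}" for i j
  proof -
    have "\<exists>!p. p \<in> I \<and> bracket_span (V i) (V j) = V p" using tbl that unfolding I_def by blast
    then show ?thesis unfolding br_def using that theI'[of "\<lambda>p. p \<in> I \<and> bracket_span (V i) (V j) = V p"] by simp
  qed
  show "br i j = 0 \<or> br i j \<in> I" using *[of i j] unfolding br_def by auto
  show "bracket_span (V i) (V j) = VV (br i j)"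
  proof (cases "bracket_span (V i) (V j) = {0}")
    case True then show ?thesis unfolding br_def by simp
  next
    case False then show ?thesis using *[OF assms False] VV_I by simp
  qed
qed

lemma br_in: "br i j \<noteq> 0 \<Longrightarrow> br i j \<in> I"
  using br_cases[of i j] unfolding br_def by (auto split: if_splits)

lemma br_dom: "br i j \<noteq> 0 \<Longrightarrow> i \<in> I \<and> j \<in> I"
  unfolding br_def by (auto split: if_splits)

lemma br_mem: assumes "x \<in> VV i" "y \<in> VV j" shows "bracket x y \<in> VV (br i j)"
proof (cases "i \<in> I \<and> j \<in> I")
  case True
  then show ?thesis using bracket_span_mem[of x "V i" y "V j"] br_span assms VV_I by simp
next
  case False
  then have "x = 0 \<or> y = 0" using assms unfolding VV_def by auto
  then show ?thesis using subspace_zero_mem[OF VVs] by auto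
qed

lemma bracket_span_comm: "bracket_span A B = bracket_span B A"
proof -
  have "bracket_span A B \<subseteq> bracket_span B A" for A B
  proof (rule bracket_span_least[OF bracket_span_subspace])
    fix a b assume "a \<in> A" "b \<in> B"
    then have "- bracket b a \<in> bracket_span B A"
      by (intro subspace_neg[OF bracket_span_subspace] bracket_span_mem)
    then show "bracket a b \<in> bracket_span B A" using br_anti[of a b] by simp
  qed
  then show ?thesis by blast
qed

lemma br_comm: "br i j = br j i"
  unfolding br_def using bracket_span_comm[of "V i" "V j"] by auto

lemma br_nonzero: assumes "i \<in> I" "j \<in> I" shows "br i j \<noteq> 0 \<longleftrightarrow> (\<exists>x\<in>V i. \<exists>y\<in>V j. bracket x y \<noteq> 0)"
proof -
  have "br i j = 0 \<longleftrightarrow> bracket_span (V i) (V j) = {0}"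
    using br_span[OF assms] br_cases[OF assms] Vne VV_I zero_I by fastforce
  also have "\<dots> \<longleftrightarrow> (\<forall>x\<in>V i. \<forall>y\<in>V j. bracket x y = 0)"
  proof
    assume "bracket_span (V i) (V j) = {0}"
    then show "\<forall>x\<in>V i. \<forall>y\<in>V j. bracket x y = 0" using bracket_span_mem by blast
  next
    assume *: "\<forall>x\<in>V i. \<forall>y\<in>V j. bracket x y = 0"
    have "bracket_span (V i) (V j) \<subseteq> {0}" by (rule bracket_span_least[OF subspace_single_0]) (use * in simp)
    then show "bracket_span (V i) (V j) = {0}" using subspace_zero_mem[OF bracket_span_subspace] by blast
  qed
  finally show ?thesis by auto
qed

lemma VS_VV: "x \<in> VV p \<Longrightarrow> p \<in> J \<Longrightarrow> x \<in> VS J"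
  unfolding VV_def using V_sub_VS subspace_zero_mem[OF VS_subspace] by (auto split: if_splits)

text \<open>The summand \<open>V p\<close>, being [[V i, V j], V l], lies in the sum of the two
  summands given by the other arrangements, and \<open>V_VS_iff\<close> identifies it with one of
  them.\<close>

lemma br_jac: assumes p: "br (br i j) l = p" "p \<noteq> 0"
  shows "br (br j l) i = p \<or> br (br l i) j = p"
proof -
  have q: "br i j \<in> I" "l \<in> I" using br_dom[of "br i j" l] p by auto
  have "br i j \<noteq> 0" using q(1) zero_I by metis
  note q = q this
  have ij: "i \<in> I" "j \<in> I" using br_dom[OF q(3)] by auto
  have pI: "p \<in> I" using br_in[of "br i j" l] p by simp
  define S where "S = VS {br (br j l) i, br (br l i) j}"
  have Ss: "subspace S" unfolding S_def by (rule VS_subspace)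
  have *: "bracket (bracket x y) w \<in> S" if "x \<in> V i" "y \<in> V j" "w \<in> V l" for x y w
  proof -
    have "bracket (bracket x y) w = bracket x (bracket y w) - bracket y (bracket x w)"
      using br_deriv[of x y w] by simp
    moreover have "bracket x (bracket y w) \<in> VV (br i (br j l))" 
      by (intro br_mem) (use that ij q VV_I in simp_all)
    then have "bracket x (bracket y w) \<in> S" unfolding S_def by (rule VS_VV) (simp add: br_comm[of i])
    moreover have "bracket y (bracket x w) \<in> VV (br j (br i l))"
      by (intro br_mem) (use that ij q VV_I in simp_all)
    then have "bracket y (bracket x w) \<in> S" unfolding S_def by (rule VS_VV) (simp add: br_comm[of j] br_comm[of i l])
    ultimately show ?thesis using subspace_diff[OF Ss] by simp
  qed
  have "V p = bracket_span (V (br i j)) (V l)" using br_span[OF q(1,2)] p VV_I pI by simp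
  also have "\<dots> \<subseteq> S"
  proof (rule bracket_span_least[OF Ss])
    fix a w assume a: "a \<in> V (br i j)" and w: "w \<in> V l"
    have "V (br i j) = bracket_span (V i) (V j)" using br_span[OF ij] VV_I q by simp
    also have "\<dots> \<subseteq> {a. bracket a w \<in> S}"
      by (rule bracket_span_least[OF subspace_preimage[OF Ss linear_bracket_left]]) (use * w in simp)
    finally show "bracket a w \<in> S" using a by blast
  qed
  finally show ?thesis using V_VS_iff[OF pI] unfolding S_def by blast
qed

lemma VS_ideal: assumes J: "\<And>i j. j \<in> J \<Longrightarrow> br i j \<noteq> 0 \<Longrightarrow> br i j \<in> J" and u: "u \<in> VS J"
  shows "bracket x u \<in> VS J"
proof -
  have "VS J \<subseteq> {u. \<forall>x. bracket x u \<in> VS J}"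
  proof (rule VS_least)
    have "{u. \<forall>x. bracket x u \<in> VS J} = (\<Inter>x. {u. bracket x u \<in> VS J})" by auto
    then show "subspace {u. \<forall>x. bracket x u \<in> VS J}"
      using subspace_Inter[of "range (\<lambda>x. {u. bracket x u \<in> VS J})"] subspace_preimage[OF VS_subspace br_lin_r] by auto
    fix j assume j: "j \<in> I" "j \<in> J"
    show "V j \<subseteq> {u. \<forall>x. bracket x u \<in> VS J}"
    proof (intro subsetI CollectI allI)
      fix u x assume u: "u \<in> V j"
      have "x \<in> {x. bracket x u \<in> VS J}"
      proof (rule UNIV_span[OF subspace_preimage[OF VS_subspace linear_bracket_left]])
        show "L \<subseteq> {x. bracket x u \<in> VS J}" using Vst[OF j(1) _ u] V_sub_VS[OF j] by blast
        fix i assume i: "i \<in> I"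
        show "V i \<subseteq> {x. bracket x u \<in> VS J}"
        proof (intro subsetI CollectI)
          fix x assume "x \<in> V i"
          then have b: "bracket x u \<in> VV (br i j)" using br_mem i j u VV_I by simp
          show "bracket x u \<in> VS J"
          proof (cases "br i j = 0")
            case True then show ?thesis using b subspace_zero_mem[OF VS_subspace] by simp
          next
            case False then show ?thesis using VS_VV[OF b] J j by blast
          qed
        qed
      qed
      then show "bracket x u \<in> VS J" by simp
    qed
  qed
  then show ?thesis using u by blast
qed

text \<open>For nonempty \<open>J\<close>, the subspace \<open>VS J\<close> would be a nonzero ideal
  equal to its bracket with \<open>h\<close>.\<close>

lemma br_nil: assumes J: "J \<subseteq> I" "{p. p \<noteq> 0 \<and> (\<exists>i j. j \<in> J \<and> p = br i j)} = J" shows "J = {}"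
proof (rule ccontr)
  assume "J \<noteq> {}"
  then obtain j where j: "j \<in> J" "j \<in> I" using J(1) by blast
  have st: "bracket x u \<in> VS J" if "u \<in> VS J" for x u by (rule VS_ideal[OF _ that]) (use J(2) in blast)
  have "VS J \<noteq> {0}" using V_sub_VS[OF j(2,1)] Vne[OF j(2)] subspace_zero_mem[OF Vs[OF j(2)]] by blast
  then have "bracket_span h (VS J) \<noteq> VS J"
    using bracket_span_ideal_neq[OF h_ideal h_solv h_perfect VS_subspace] st by blast
  moreover have "bracket_span h (VS J) \<subseteq> VS J" by (rule bracket_span_least[OF VS_subspace]) (rule st)
  moreover have "VS J \<subseteq> bracket_span h (VS J)"
  proof (rule VS_least[OF bracket_span_subspace])
    fix p assume p: "p \<in> I" "p \<in> J"
    then obtain i l where il: "l \<in> J" "p = br i l" using J(2) by blast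
    have "br i l \<noteq> 0" using il p(1) zero_I by metis
    then have iI: "i \<in> I" "l \<in> I" using br_dom by blast+
    have "V p = bracket_span (V i) (V l)" using br_span[OF iI] VV_I p il by simp
    also have "\<dots> \<subseteq> bracket_span h (VS J)"
      by (rule bracket_span_least[OF bracket_span_subspace], rule bracket_span_mem)
        (use Vh[OF iI(1)] V_sub_VS[OF iI(2) il(1)] in blast)+
    finally show "V p \<subseteq> bracket_span h (VS J)" .
  qed
  ultimately show False by blast
qed

lemma center_L: "center L = {0}"
proof -
  have "subspace (center L)" unfolding subspace_def center_def
    using subspace_zero_mem[OF Ls] subspace_add[OF Ls] subspace_scale[OF Ls] by (auto simp: br_add_l br_scale_l)
  moreover have "bracket x y \<in> center L" if "x \<in> L" "y \<in> center L" for x y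
  proof -
    have "bracket y x = 0" using that unfolding center_def by blast
    then have "bracket x y = 0" using br_anti[of x y] by simp
    then show ?thesis using subspace_zero_mem[OF \<open>subspace (center L)\<close>] by simp
  qed
  ultimately have "lie_ideal (center L) L" unfolding lie_ideal_def by (auto simp: center_def)
  then have "center L = {0} \<or> center L = L" using simpL unfolding simple_def by blast
  moreover have "center L \<noteq> L"
  proof
    assume c: "center L = L"
    have "bracket_span L L \<subseteq> {0}"
      by (rule bracket_span_least[OF subspace_single_0]) (use c in \<open>auto simp: center_def\<close>)
    then have "bracket_span L L = {0}" using subspace_zero_mem[OF bracket_span_subspace] by blast
    then show False using simpL unfolding simple_def by blast
  qed
  ultimately show ?thesis by blast
qed

lemma wt: assumes w: "\<And>i j. br i j \<noteq> 0 \<Longrightarrow> w (br i j) = w i + w j" and i: "i \<in> I" shows "w i = (0::int)"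
proof -
  have "\<forall>x. \<exists>l v. l \<in> L \<and> fam v \<and> x = l + Ssum v" using Lh_dec h_fam by metis
  then obtain lp vp where lp: "\<And>x. lp x \<in> L" and vp: "\<And>x. fam (vp x)" and dec: "\<And>x. x = lp x + Ssum (vp x)"
    by metis
  \<comment> \<open>The chosen components do not depend on the choice, which makes \<open>D\<close>
    linear.\<close>
  have uniq: "vp x i = v i" if "l \<in> L" "fam v" "x = l + Ssum v" "i \<in> I" for x l v i
  proof -
    have "lp x - l = Ssum v - Ssum (vp x)" using dec[of x] that(3) by (simp add: algebra_simps)
    moreover have "lp x - l \<in> L" using lp that subspace_diff[OF Ls] by blast
    moreover have "Ssum v - Ssum (vp x) \<in> h" using fam_h[OF that(2)] fam_h[OF vp] subspace_diff[OF hs] by blast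
    ultimately have "Ssum v - Ssum (vp x) \<in> L \<inter> h" by auto
    then have "Ssum (vp x) = Ssum v" using Lh by auto
    then show ?thesis using fam_uniq[OF vp that(2) _ that(4)] by blast
  qed
  define D where "D x = (\<Sum>i\<in>I. of_int (w i) *s vp x i)" for x
  have D_dec: "D x = (\<Sum>i\<in>I. of_int (w i) *s v i)" if "l \<in> L" "fam v" "x = l + Ssum v" for x l v
    unfolding D_def by (rule sum.cong[OF refl]) (use uniq[OF that] in simp)
  have D_add: "D (x + y) = D x + D y" for x y
  proof -
    have "x + y = (lp x + Ssum (vp x)) + (lp y + Ssum (vp y))"
      by (rule arg_cong2[of _ _ _ _ "(+)", OF dec dec])
    also have "\<dots> = (lp x + lp y) + Ssum (\<lambda>i. vp x i + vp y i)" by (simp add: sum.distrib algebra_simps)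
    finally have "D (x + y) = (\<Sum>i\<in>I. of_int (w i) *s (vp x i + vp y i))"
      by (rule D_dec[OF subspace_add[OF Ls lp lp] fam_add[OF vp vp]])
    then show ?thesis unfolding D_def by (simp add: scale_right_distrib sum.distrib)
  qed
  have D_scale: "D (c *s x) = c *s D x" for c x
  proof -
    have "c *s x = c *s lp x + Ssum (\<lambda>i. c *s vp x i)"
      using dec[of x] by (metis scale_right_distrib scale_sum_right)
    then have "D (c *s x) = (\<Sum>i\<in>I. of_int (w i) *s c *s vp x i)"
      by (rule D_dec[OF subspace_scale[OF Ls lp] fam_scale[OF vp]])
    then show ?thesis unfolding D_def by (simp add: scale_sum_right mult.commute)
  qed
  have D_lin: "Vector_Spaces.linear scale scale D"
    by unfold_locales (simp_all add: D_add D_scale algebra_simps scale_right_distrib scale_left_distrib)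
  have D_L: "D l = 0" if "l \<in> L" for l
    using D_dec[OF that, of "\<lambda>_. 0" l] subspace_zero_mem[OF Vs] by simp
  have D_V: "D x = of_int (w i) *s x" if i: "i \<in> I" and x: "x \<in> V i" for i x
  proof -
    have "D x = (\<Sum>j\<in>I. of_int (w j) *s (if j = i then x else 0))"
      using D_dec[OF subspace_zero_mem[OF Ls] fam_single(1)[OF i x], of x] fam_single(2)[OF i x] by simp
    also have "\<dots> = (\<Sum>j\<in>I. if j = i then of_int (w j) *s x else 0)" by (rule sum.cong) auto
    also have "\<dots> = of_int (w i) *s x" using i by (simp add: sum.delta)
    finally show ?thesis .
  qed
  \<comment> \<open>\<open>F\<close> measures the failure of the Leibniz rule. It is bilinear, so it
    suffices that it vanishes on \<open>L\<close> and on the summands.\<close>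
  define F where "F x y = D (bracket x y) - bracket (D x) y - bracket x (D y)" for x y
  have F_r: "Vector_Spaces.linear scale scale (F x)" for x
    unfolding F_def by unfold_locales
      (simp_all add: D_add D_scale br_add_r br_scale_r br_add_l br_scale_l scale_right_diff_distrib algebra_simps scale_right_distrib scale_left_distrib)
  have F_l: "Vector_Spaces.linear scale scale (\<lambda>x. F x y)" for y
    unfolding F_def by unfold_locales
      (simp_all add: D_add D_scale br_add_r br_scale_r br_add_l br_scale_l scale_right_diff_distrib algebra_simps scale_right_distrib scale_left_distrib)
  have F_LV: "F l x = 0" "F x l = 0" if "l \<in> L" "j \<in> I" "x \<in> V j" for l x j
  proof -
    have b: "bracket l x \<in> V j" using Vst that by blast
    show 1: "F l x = 0" unfolding F_def using D_L[OF that(1)] D_V[OF that(2,3)] D_V[OF that(2) b] by (simp add: br_scale_r)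
    have "bracket x l \<in> V j" using b br_anti[of x l] subspace_neg[OF Vs[OF that(2)]] by simp
    then show "F x l = 0" unfolding F_def using D_L[OF that(1)] D_V[OF that(2,3)] D_V[OF that(2)] by (simp add: br_scale_l)
  qed
  have F_VV: "F x y = 0" if "i \<in> I" "j \<in> I" "x \<in> V i" "y \<in> V j" for x y i j
  proof (cases "br i j = 0")
    case True
    then have "bracket x y = 0" using br_nonzero[OF that(1,2)] that by blast
    moreover have "D 0 = 0" using D_L[OF subspace_zero_mem[OF Ls]] .
    ultimately show ?thesis unfolding F_def using D_V that by (simp add: br_scale_l br_scale_r)
  next
    case False
    have "bracket x y \<in> V (br i j)" using br_mem[of x i y j] VV_I that br_in[OF False] by simp
    then have "D (bracket x y) = of_int (w i + w j) *s bracket x y" using D_V br_in[OF False] w[OF False] by simp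
    then show ?thesis unfolding F_def using D_V that by (simp add: br_scale_l br_scale_r scale_left_distrib)
  qed
  have F0: "F x y = 0" for x y
  proof -
    have V0: "F x y = 0" if j: "j \<in> I" "y \<in> V j" for x y j
    proof -
      have "x \<in> {x. F x y \<in> {0}}"
        by (rule UNIV_span[OF subspace_preimage[OF subspace_single_0 F_l]]) (use F_LV[OF _ j] F_VV[OF _ j(1) _ j(2)] in auto)
      then show ?thesis by simp
    qed
    have L0: "F x y = 0" if y: "y \<in> L" for x y
    proof -
      have "F l y = 0" if "l \<in> L" for l unfolding F_def using D_L Lc y that by simp
      then have "x \<in> {x. F x y \<in> {0}}"
        using UNIV_span[OF subspace_preimage[OF subspace_single_0 F_l], of y x] F_LV(2)[OF y] by auto
      then show ?thesis by simp
    qed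
    have "y \<in> {y. F x y \<in> {0}}"
      by (rule UNIV_span[OF subspace_preimage[OF subspace_single_0 F_r]]) (use V0 L0 in auto)
    then show ?thesis by simp
  qed
  have "D \<in> derivations" unfolding derivations_def
    using D_lin F0 unfolding F_def by (auto simp: algebra_simps eq_diff_eq diff_eq_eq)
  then obtain r where r: "D = bracket r" using symp unfolding sympathetic_def by blast
  obtain l0 r0 where lr: "l0 \<in> L" "r0 \<in> h" "r = l0 + r0" using Lh_dec by blast
  \<comment> \<open>As \<open>D\<close> kills \<open>L\<close>, the two components of
    \<open>r\<close> have opposite brackets with \<open>x\<close>; one is in \<open>L\<close> and
    the other in \<open>h\<close>.\<close>
  have "bracket l0 x = 0" if x: "x \<in> L" for x
  proof -
    have "bracket l0 x + bracket r0 x = 0" using D_L[OF x] r lr by (simp add: br_add_l)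
    then have "bracket l0 x = - bracket r0 x" by (simp add: eq_neg_iff_add_eq_0)
    then have "bracket l0 x \<in> h" using hst'[OF lr(2)] subspace_neg[OF hs] by simp
    then show ?thesis using Lc[OF lr(1) x] Lh by blast
  qed
  then have "l0 \<in> center L" unfolding center_def using lr by blast
  then have rh: "r \<in> h" using center_L lr by simp
  show ?thesis
  proof (rule ccontr)
    assume wi: "w i \<noteq> 0"
    \<comment> \<open>Nilpotency is used through an ideal \<open>U\<close> of least dimension
      containing \<open>V i\<close>. If \<open>w i\<close> is nonzero, then \<open>bracket r\<close>
      multiplies \<open>V i\<close> by a nonzero scalar, so [h, U] is an ideal that still contains
      \<open>V i\<close> and must equal \<open>U\<close>.\<close>
    define G where "G n \<longleftrightarrow> (\<exists>U. subspace U \<and> V i \<subseteq> U \<and> (\<forall>x. \<forall>u\<in>U. bracket x u \<in> U) \<and> dim U = n)" for n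
    have "G (dim h)" unfolding G_def using hs Vh[OF i] hst by blast
    then have "G (LEAST n. G n)" by (rule LeastI)
    then obtain U where U: "subspace U" "V i \<subseteq> U" "\<And>x u. u \<in> U \<Longrightarrow> bracket x u \<in> U" "dim U = (LEAST n. G n)"
      unfolding G_def by blast
    define B where "B = bracket_span h U"
    have Bs: "subspace B" unfolding B_def by (rule bracket_span_subspace)
    have BU: "B \<subseteq> U" unfolding B_def by (rule bracket_span_least[OF U(1)]) (rule U(3))
    have "V i \<subseteq> B"
    proof
      fix v assume v: "v \<in> V i"
      have "bracket r v \<in> B" unfolding B_def using rh U(2) v by (intro bracket_span_mem) auto
      then have "of_int (w i) *s v \<in> B" using D_V[OF i v] r by simp
      then have "inverse (of_int (w i)) *s of_int (w i) *s v \<in> B" using subspace_scale[OF Bs] by blast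
      then show "v \<in> B" using wi by simp
    qed
    moreover have "bracket x u \<in> B" if "u \<in> B" for x u
    proof -
      have "B \<subseteq> {u. bracket x u \<in> B}" unfolding B_def
      proof (rule bracket_span_least[OF subspace_preimage[OF bracket_span_subspace br_lin_r]])
        fix a b assume ab: "a \<in> h" "b \<in> U"
        have "bracket (bracket x a) b + bracket a (bracket x b) \<in> bracket_span h U"
          by (intro subspace_add[OF bracket_span_subspace] bracket_span_mem hst U(3) ab)
        then show "bracket a b \<in> {u. bracket x u \<in> bracket_span h U}"
          by (simp add: br_deriv[of x a b])
      qed
      then show ?thesis using that by blast
    qed
    ultimately have "G (dim B)" unfolding G_def using Bs by blast
    then have "dim U \<le> dim B" unfolding U(4) by (rule Least_le)
    then have "B = U" using subspace_dim_equal[OF Bs U(1) BU] by blast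
    moreover have "U \<noteq> {0}" using U(2) Vne[OF i] subspace_zero_mem[OF Vs[OF i]] by blast
    ultimately show False
      using bracket_span_ideal_neq[OF h_ideal h_solv h_perfect U(1) _ U(3)] unfolding B_def by blast
  qed
qed

end

section \<open>Dimensions of images and spans\<close>

context fd_lie begin

lemma fd_pair: "finite_dimensional_vector_space_pair scale Basis scale Basis"
  by unfold_locales

lemma dim_image_inj:
  assumes f: "Vector_Spaces.linear scale scale f" and S: "subspace S" and inj: "\<And>x. x \<in> S \<Longrightarrow> f x = 0 \<Longrightarrow> x = 0"
  shows "dim (f ` S) = dim S"
proof -
  interpret P: finite_dimensional_vector_space_pair scale Basis scale Basis by (rule fd_pair)
  interpret f: Vector_Spaces.linear scale scale f by fact
  have "inj_on f S"
  proof (rule inj_onI)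
    fix x y assume xy: "x \<in> S" "y \<in> S" "f x = f y"
    then have "f (x - y) = 0" by (simp add: f.diff)
    then have "x - y = 0" using inj subspace_diff[OF S xy(1,2)] by blast
    then show "x = y" by simp
  qed
  moreover have sp: "span S = S" using S by (simp add: span_eq_iff)
  ultimately have "inj_on f (span S)" unfolding sp by blast
  then show ?thesis by (rule P.dim_image_eq[OF f])
qed

lemma kernel_ex:
  assumes f: "Vector_Spaces.linear scale scale f" and S: "subspace S" and im: "\<And>x. x \<in> S \<Longrightarrow> f x \<in> S'"
    and lt: "dim S' < dim S"
  shows "\<exists>x\<in>S. x \<noteq> 0 \<and> f x = 0"
proof (rule ccontr)
  assume "\<not> ?thesis"
  then have "dim (f ` S) = dim S" using dim_image_inj[OF f S] by blast
  moreover have "dim (f ` S) \<le> dim S'" by (rule dim_subset) (use im in blast)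
  ultimately show False using lt by simp
qed

lemma image_subspace: assumes f: "Vector_Spaces.linear scale scale f" and S: "subspace S" shows "subspace (f ` S)"
proof -
  interpret f: Vector_Spaces.linear scale scale f by fact
  show ?thesis unfolding subspace_def
  proof (intro conjI ballI allI)
    show "0 \<in> f ` S" using subspace_zero_mem[OF S] f.zero by force
    fix x y assume "x \<in> f ` S" "y \<in> f ` S"
    then obtain a b where ab: "a \<in> S" "b \<in> S" "x = f a" "y = f b" by blast
    then have "x + y = f (a + b)" by (simp add: f.add)
    then show "x + y \<in> f ` S" using subspace_add[OF S ab(1,2)] by blast
  next
    fix c x assume "x \<in> f ` S"
    then obtain a where a: "a \<in> S" "x = f a" by blast
    then have "c *s x = f (c *s a)" by (simp add: f.scale)
    then show "c *s x \<in> f ` S" using subspace_scale[OF S a(1)] by blast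
  qed
qed

lemma dim_nonzero: assumes "subspace S" "S \<noteq> {0}" shows "dim S \<ge> 1"
proof -
  have "\<not> S \<subseteq> {0}" using assms subspace_zero_mem[OF assms(1)] by blast
  then have "dim S \<noteq> 0" by simp
  then show ?thesis by linarith
qed

lemma dim1_span: assumes S: "subspace S" "dim S = 1" and v: "v \<in> S" "v \<noteq> 0" shows "S = span {v}"
proof -
  have "span {v} \<subseteq> S" using span_minimal[of "{v}" S] v S by simp
  moreover have "dim S \<le> dim (span {v})" using v S by simp
  ultimately show ?thesis using subspace_dim_equal[OF subspace_span S(1)] by blast
qed

lemma dim2_span: assumes S: "subspace S" "dim S = 2" and x: "x \<in> S" "x \<noteq> 0" and y: "y \<in> S" "y \<notin> span {x}"
  shows "S = span {y, x}"
proof -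
  have "span {y, x} \<subseteq> S" using span_minimal[of "{y,x}" S] x y S by simp
  moreover have "dim (span {y, x}) = 2" using x y by (simp add: dim_insert)
  ultimately show ?thesis using subspace_dim_equal[OF subspace_span S(1), of "{y, x}"] S(2) by simp
qed

lemma span1E: assumes "x \<in> span {v}" obtains c where "x = c *s v"
  using assms unfolding span_singleton by blast

end

section \<open>Trivial summands, the centre, and dimensions\<close>

context levi_setting begin

definition d :: "nat \<Rightarrow> nat" where "d i = dim (V i)"

lemma d_pos: "i \<in> I \<Longrightarrow> d i \<ge> 1"
  unfolding d_def using dim_nonzero Vs Vne by blast

lemma L_perfect: "bracket_span L L = L"
proof -
  have sub: "bracket_span L L \<subseteq> L" by (rule bracket_span_least[OF Ls]) (rule Lc)
  then have "lie_ideal (bracket_span L L) L"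
    unfolding lie_ideal_def using bracket_span_subspace bracket_span_mem[of _ L _ L] by blast
  then show ?thesis using simpL unfolding simple_def by blast
qed

text \<open>Operators on a line commute and \<open>L\<close> is perfect, so \<open>L\<close> acts by
  zero on a one-dimensional module. Conversely, under the zero action every line is a
  submodule.\<close>

lemma triv_iff: assumes i: "i \<in> I" shows "d i = 1 \<longleftrightarrow> (\<forall>x\<in>L. \<forall>v\<in>V i. bracket x v = 0)"
proof
  assume d: "d i = 1"
  obtain v where v: "v \<in> V i" "v \<noteq> 0" using Vne[OF i] subspace_zero_mem[OF Vs[OF i]] by blast
  have V: "V i = span {v}" using dim1_span[OF Vs[OF i] _ v] d unfolding d_def by blast
  have "L \<subseteq> {x. bracket x v \<in> {0}}"
  proof -
    have "bracket_span L L \<subseteq> {x. bracket x v \<in> {0}}"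
    proof (rule bracket_span_least[OF subspace_preimage[OF subspace_single_0 linear_bracket_left]])
      fix a b assume "a \<in> L" "b \<in> L"
      then have "bracket a v \<in> V i" "bracket b v \<in> V i" using Vst[OF i] v by blast+
      then obtain c e where "bracket a v = c *s v" "bracket b v = e *s v" unfolding V by (metis span1E)
      then have "bracket (bracket a b) v = 0"
        using br_deriv[of a b v] by (simp add: br_scale_r mult.commute)
      then show "bracket a b \<in> {x. bracket x v \<in> {0}}" by simp
    qed
    then show ?thesis unfolding L_perfect .
  qed
  then have z: "bracket x v = 0" if "x \<in> L" for x using that by auto
  show "\<forall>x\<in>L. \<forall>v\<in>V i. bracket x v = 0"
  proof (intro ballI)
    fix x u assume x: "x \<in> L" and "u \<in> V i"
    then obtain c where "u = c *s v" unfolding V by (metis span1E)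
    then show "bracket x u = 0" using z[OF x] by (simp add: br_scale_r)
  qed
next
  assume z: "\<forall>x\<in>L. \<forall>v\<in>V i. bracket x v = 0"
  obtain v where v: "v \<in> V i" "v \<noteq> 0" using Vne[OF i] subspace_zero_mem[OF Vs[OF i]] by blast
  have sp: "span {v} \<subseteq> V i" using span_minimal[of "{v}" "V i"] v Vs[OF i] by simp
  have "submodule L (span {v})" unfolding submodule_def using z sp subspace_span subspace_zero_mem[OF subspace_span] by auto
  then have "span {v} = {0} \<or> span {v} = V i" using Vsimple[OF i _ sp] by blast
  moreover have "span {v} \<noteq> {0}" using v span_base[of v "{v}"] by blast
  ultimately show "d i = 1" unfolding d_def using v by (metis dim_singleton dim_span)
qed

lemma triv_L: assumes "i \<in> I" "d i = 1" "x \<in> L" "v \<in> V i" shows "bracket x v = 0" "bracket v x = 0"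
proof -
  show "bracket x v = 0" using triv_iff assms by blast
  then show "bracket v x = 0" using br_anti[of v x] by simp
qed

lemma triv_basis: assumes "i \<in> I" "d i = 1" shows "\<exists>t\<in>V i. t \<noteq> 0 \<and> V i = span {t}"
proof -
  obtain v where v: "v \<in> V i" "v \<noteq> 0" using Vne[OF assms(1)] subspace_zero_mem[OF Vs[OF assms(1)]] by blast
  then show ?thesis using dim1_span[OF Vs[OF assms(1)] _ v] assms(2) unfolding d_def by blast
qed

text \<open>The vectors of \<open>V j\<close> killed by an \<open>L\<close>-stable set form a
  submodule. It is proper because the bracket is nonzero, hence zero by simplicity.\<close>

lemma annihilator_zero:
  assumes ij: "i \<in> I" "j \<in> I" "br i j \<noteq> 0" and T: "\<And>x t. x \<in> L \<Longrightarrow> t \<in> T \<Longrightarrow> bracket x t \<in> T"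
    "span T = V i" and y: "y \<in> V j" "\<And>t. t \<in> T \<Longrightarrow> bracket t y = 0"
  shows "y = 0"
proof -
  define K where "K = {y\<in>V j. \<forall>t\<in>T. bracket t y = 0}"
  have "subspace K" unfolding subspace_def K_def
    using subspace_zero_mem[OF Vs[OF ij(2)]] subspace_add[OF Vs[OF ij(2)]] subspace_scale[OF Vs[OF ij(2)]]
    by (auto simp: br_add_r br_scale_r)
  moreover have "bracket x u \<in> K" if x: "x \<in> L" and u: "u \<in> K" for x u
  proof -
    have "bracket t (bracket x u) = 0" if t: "t \<in> T" for t
    proof -
      have "bracket t (bracket x u) = bracket (bracket t x) u + bracket x (bracket t u)" by (rule br_deriv)
      moreover have "bracket t x = - bracket x t" by (rule br_anti)
      ultimately show ?thesis using u t T(1)[OF x t] unfolding K_def by (simp add: br_neg_l)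
    qed
    then show ?thesis using Vst[OF ij(2) x] u unfolding K_def by blast
  qed
  ultimately have "submodule L K" unfolding submodule_def by blast
  moreover have "K \<subseteq> V j" unfolding K_def by blast
  ultimately have "K = {0} \<or> K = V j" using Vsimple[OF ij(2)] by blast
  moreover have "K \<noteq> V j"
  proof
    assume K: "K = V j"
    have "bracket a b = 0" if a: "a \<in> V i" and b: "b \<in> V j" for a b
    proof -
      have "span T \<subseteq> {a. bracket a b \<in> {0}}"
        by (rule span_minimal[OF _ subspace_preimage[OF subspace_single_0 linear_bracket_left]])
          (use b K in \<open>auto simp: K_def\<close>)
      then show ?thesis using a T(2) by auto
    qed
    then show False using br_nonzero[OF ij(1,2)] ij(3) by blast
  qed
  ultimately show ?thesis using y unfolding K_def by blast
qed

lemma triv_inj: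
  assumes ij: "i \<in> I" "j \<in> I" "d i = 1" "br i j \<noteq> 0" and t: "t \<in> V i" "t \<noteq> 0" and y: "y \<in> V j" "bracket t y = 0"
  shows "y = 0"
proof (rule annihilator_zero[OF ij(1,2,4), of "{t, 0}"])
  show "span {t, 0} = V i" using dim1_span[OF Vs[OF ij(1)] _ t] ij(3) unfolding d_def
    by (simp add: insert_commute)
  show "\<And>x t'. x \<in> L \<Longrightarrow> t' \<in> {t, 0} \<Longrightarrow> bracket x t' \<in> {t, 0}" using triv_L[OF ij(1,3) _ t(1)] by auto
qed (use y in auto)

text \<open>If \<open>t\<close> spans \<open>V i\<close>, the bracket of the two summands is the
  image of \<open>V j\<close> under \<open>bracket t\<close>, which is injective there.\<close>

lemma br_triv_act: assumes n: "br i j \<noteq> 0" and d1: "d i = 1" shows "d (br i j) = d j"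
proof -
  have ij: "i \<in> I" "j \<in> I" using br_dom[OF n] by blast+
  obtain t where t: "t \<in> V i" "t \<noteq> 0" "V i = span {t}" using triv_basis[OF ij(1) d1] by blast
  have "V (br i j) = bracket_span (V i) (V j)" using br_span[OF ij] VV_I[OF br_in[OF n]] by simp
  also have "\<dots> = bracket t ` V j"
  proof
    show "bracket_span (V i) (V j) \<subseteq> bracket t ` V j"
    proof (rule bracket_span_least[OF image_subspace[OF br_lin_r Vs[OF ij(2)]]])
      fix a b assume a: "a \<in> V i" and b: "b \<in> V j"
      obtain c where "a = c *s t" using a unfolding t(3) by (metis span1E)
      then have "bracket a b = bracket t (c *s b)" by (simp add: br_scale_l br_scale_r)
      then show "bracket a b \<in> bracket t ` V j" using subspace_scale[OF Vs[OF ij(2)] b] by blast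
    qed
    show "bracket t ` V j \<subseteq> bracket_span (V i) (V j)" using bracket_span_mem t(1) by blast
  qed
  finally show ?thesis unfolding d_def
    using dim_image_inj[OF br_lin_r Vs[OF ij(2)], of t] triv_inj[OF ij d1 n t(1,2)] by simp
qed

lemma br_sq_triv: assumes "d i = 1" shows "br i i = 0"
proof (rule ccontr)
  assume n: "br i i \<noteq> 0"
  then have i: "i \<in> I" using br_dom by blast
  obtain t where t: "V i = span {t}" using triv_basis[OF i assms] by blast
  obtain x y where "x \<in> V i" "y \<in> V i" "bracket x y \<noteq> 0" using br_nonzero[OF i i] n by blast
  then show False unfolding t by (metis span1E br_scale_l br_scale_r bracket_self scale_zero_right)
qed

lemma VV_meet: assumes "x \<in> V p" "p \<in> I" "x \<in> VV q" "x \<noteq> 0" shows "p = q"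
proof (rule ccontr)
  assume n: "p \<noteq> q"
  have "x \<in> VS {q}" by (rule VS_VV[OF assms(3)]) simp
  then show False using VS_zero[OF assms(2) _ assms(1)] n assms(4) by blast
qed

lemma VV_dim: "br i j = 0 \<or> d (br i j) = 1 \<Longrightarrow> dim (VV (br i j)) \<le> 1"
  using VV_I[OF br_in, of i j] unfolding d_def by (cases "br i j = 0") auto

text \<open>Fix \<open>x\<close>, \<open>y\<close> with nonzero bracket. The image of
  \<open>V l\<close> under \<open>bracket y\<close> has dimension at most 1, so
  \<open>bracket y\<close> kills some nonzero \<open>w\<close>, and one term of the Jacobi identity
  for \<open>x\<close>, \<open>y\<close>, \<open>w\<close> disappears. The trivial
  \<open>bracket x y\<close> does not kill \<open>w\<close>, so the remaining term must lie in
  \<open>V p\<close>.\<close>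

lemma br_jac_triv:
  assumes p: "br (br i j) l = p" "p \<noteq> 0" and d1: "d (br i j) = 1" and dl: "d l \<ge> 2"
    and jl: "br j l = 0 \<or> d (br j l) = 1"
  shows "br (br l i) j = p"
proof -
  have q: "br i j \<in> I" "l \<in> I" using br_dom[of "br i j" l] p by auto
  have n: "br i j \<noteq> 0" using q(1) zero_I by metis
  have ij: "i \<in> I" "j \<in> I" using br_dom[OF n] by auto
  obtain x y where xy: "x \<in> V i" "y \<in> V j" "bracket x y \<noteq> 0" using br_nonzero[OF ij] n by blast
  have t: "bracket x y \<in> V (br i j)" using br_mem[of x i y j] xy VV_I ij q by simp
  have "dim (VV (br j l)) < dim (V l)" using VV_dim[OF jl] dl unfolding d_def by linarith
  from kernel_ex[OF br_lin_r Vs[OF q(2)] _ this, of y]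
  obtain w where w: "w \<in> V l" "w \<noteq> 0" "bracket y w = 0" using br_mem[of y j _ l] xy VV_I ij q by auto
  have n2: "bracket (bracket x y) w \<noteq> 0"
    using triv_inj[OF q d1 _ t xy(3) w(1)] p w(2) by blast
  have e: "bracket (bracket x y) w = - bracket y (bracket x w)"
    using br_deriv[of x y w] w(3) by (simp add: eq_neg_iff_add_eq_0)
  have "bracket y (bracket x w) \<in> VV (br j (br i l))"
    by (intro br_mem) (use xy w ij q VV_I in simp_all)
  then have "bracket (bracket x y) w \<in> VV (br j (br i l))" unfolding e by (rule subspace_neg[OF VVs])
  moreover have "bracket (bracket x y) w \<in> V p"
    using br_mem[of "bracket x y" "br i j" w l] t w VV_I q br_in[of "br i j" l] p by simp
  ultimately have "p = br j (br i l)" using VV_meet[OF _ _ _ n2] br_in[of "br i j" l] p by blast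
  then show ?thesis by (simp add: br_comm[of j] br_comm[of i l])
qed

text \<open>\<open>L\<close> kills the trivial summand, so if no bracket of summands reached it,
  [g, h] would lie in the sum of the others, against \<open>h_perfect\<close>.\<close>

lemma br_triv_nongen: assumes i: "i \<in> I" "d i = 1" shows "\<exists>j l. br j l = i"
proof (rule ccontr)
  assume c: "\<not> ?thesis"
  have "bracket_span UNIV h \<subseteq> VS (I - {i})"
  proof (rule bracket_span_least[OF VS_subspace])
    fix x y assume y: "y \<in> h"
    have "h \<subseteq> {y. \<forall>x. bracket x y \<in> VS (I - {i})}"
      unfolding VS_h
    proof (rule VS_least)
      have "{y. \<forall>x. bracket x y \<in> VS (I - {i})} = (\<Inter>x. {y. bracket x y \<in> VS (I - {i})})" by auto
      then show "subspace {y. \<forall>x. bracket x y \<in> VS (I - {i})}"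
        using subspace_Inter[of "range (\<lambda>x. {u. bracket x u \<in> VS (I - {i})})"] subspace_preimage[OF VS_subspace br_lin_r] by auto
      fix j assume j: "j \<in> I"
      show "V j \<subseteq> {y. \<forall>x. bracket x y \<in> VS (I - {i})}"
      proof (intro subsetI CollectI allI)
        fix u x assume u: "u \<in> V j"
        have "x \<in> {x. bracket x u \<in> VS (I - {i})}"
        proof (rule UNIV_span[OF subspace_preimage[OF VS_subspace linear_bracket_left]])
          show "L \<subseteq> {x. bracket x u \<in> VS (I - {i})}"
          proof (intro subsetI CollectI)
            fix x assume x: "x \<in> L"
            show "bracket x u \<in> VS (I - {i})"
            proof (cases "j = i")
              case True then show ?thesis using triv_L[OF i x] u subspace_zero_mem[OF VS_subspace] by simp
            next
              case False then show ?thesis using V_sub_VS[OF j, of "I - {i}"] Vst[OF j x u] j by blast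
            qed
          qed
          fix l assume l: "l \<in> I"
          show "V l \<subseteq> {x. bracket x u \<in> VS (I - {i})}"
          proof (intro subsetI CollectI)
            fix x assume "x \<in> V l"
            then have b: "bracket x u \<in> VV (br l j)" using br_mem l j u VV_I by simp
            show "bracket x u \<in> VS (I - {i})"
            proof (cases "br l j = 0")
              case True then show ?thesis using b subspace_zero_mem[OF VS_subspace] by simp
            next
              case False
              have "br l j \<noteq> i" using c by blast
              then have "br l j \<in> I - {i}" using br_in[OF False] by simp
              then show ?thesis by (rule VS_VV[OF b])
            qed
          qed
        qed
        then show "bracket x u \<in> VS (I - {i})" by simp
      qed
    qed
    then show "bracket x y \<in> VS (I - {i})" using y by blast
  qed
  then have "V i \<subseteq> VS (I - {i})" using h_perfect Vh[OF i(1)] by blast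
  then show False using V_VS_iff[OF i(1)] by blast
qed

lemma V_central: assumes i: "i \<in> I" "\<And>j. br i j = 0" and v: "v \<in> V i" and y: "y \<in> h" shows "bracket v y = 0"
proof -
  have "h \<subseteq> {y. bracket v y \<in> {0}}" unfolding VS_h
  proof (rule VS_least[OF subspace_preimage[OF subspace_single_0 br_lin_r]])
    fix j assume "j \<in> I"
    then show "V j \<subseteq> {y. bracket v y \<in> {0}}" using br_nonzero[OF i(1)] i(2) v by blast
  qed
  then show ?thesis using y by auto
qed

lemma br_central_nontriv: assumes i: "i \<in> I" "\<And>j. br i j = 0" shows "d i \<noteq> 1"
proof
  assume d1: "d i = 1"
  have "V i \<subseteq> center UNIV" unfolding center_def
  proof (intro subsetI CollectI conjI ballI)
    fix v y assume v: "v \<in> V i"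
    obtain l r where lr: "l \<in> L" "r \<in> h" "y = l + r" using Lh_dec by blast
    then show "bracket v y = 0" using triv_L(2)[OF i(1) d1 lr(1) v] V_central[OF i v lr(2)] by (simp add: br_add_r)
  qed simp
  then show False using symp Vne[OF i(1)] subspace_zero_mem[OF Vs[OF i(1)]] unfolding sympathetic_def by blast
qed

text \<open>Each central summand is a nonzero submodule of the simple centre of \<open>h\<close> and
  hence equal to it.\<close>

lemma br_central_uniq: assumes k: "card I \<ge> 5" and ij: "i \<in> I" "j \<in> I" "\<And>l. br i l = 0" "\<And>l. br j l = 0" shows "i = j"
proof -
  have Z: "simple_module L (center h)" using zc k unfolding I_def by simp
  have "V i = center h" if i: "i \<in> I" "\<And>l. br i l = 0" for i
  proof -
    have "V i \<subseteq> center h" unfolding center_def using V_central[OF i] Vh[OF i(1)] by blast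
    moreover have "submodule L (V i)" using sm i(1) unfolding I_def simple_module_def by blast
    ultimately have "V i = {0} \<or> V i = center h" using Z unfolding simple_module_def by blast
    then show ?thesis using Vne[OF i(1)] by blast
  qed
  then show ?thesis using V_inj ij by metis
qed

lemma dim_VS: "finite J \<Longrightarrow> J \<subseteq> I \<Longrightarrow> dim (VS J) = sum d J"
proof (induction J rule: finite_induct)
  case empty
  have "VS {} = {0}" unfolding VS_def using subspace_zero_mem[OF Vs] by (auto intro!: exI[of _ "\<lambda>_. 0"])
  then show ?case by simp
next
  case (insert i J)
  have i: "i \<in> I" using insert by blast
  have "VS (insert i J) = {x + y |x y. x \<in> V i \<and> y \<in> VS J}" (is "_ = ?S")
  proof
    have Ss: "subspace ?S" by (rule subspace_sums[OF Vs[OF i] VS_subspace])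
    have "V i \<subseteq> ?S" using subspace_zero_mem[OF VS_subspace] by force
    moreover have "VS J \<subseteq> ?S" using subspace_zero_mem[OF Vs[OF i]] by force
    ultimately show "VS (insert i J) \<subseteq> ?S" by (intro VS_least[OF Ss]) (use V_sub_VS in blast)
    have "VS J \<subseteq> VS (insert i J)" by (rule VS_least[OF VS_subspace]) (use V_sub_VS in blast)
    then show "?S \<subseteq> VS (insert i J)" using V_sub_VS[OF i, of "insert i J"] subspace_add[OF VS_subspace] by blast
  qed
  moreover have "V i \<inter> VS J = {0}"
    using VS_zero[OF i insert(2)] subspace_zero_mem[OF VS_subspace] subspace_zero_mem[OF Vs[OF i]] by blast
  ultimately have "dim (VS (insert i J)) = dim (V i) + dim (VS J)"
    using dim_sums_Int[OF Vs[OF i] VS_subspace, of J] by simp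
  then show ?case using insert d_def by simp
qed

lemma dim_total: "dim UNIV = dim L + sum d I"
proof -
  have "UNIV = {x + y |x y. x \<in> L \<and> y \<in> h}" using Lh_dec by blast
  then have "dim UNIV + dim (L \<inter> h) = dim L + dim h" using dim_sums_Int[OF Ls hs] by simp
  then show ?thesis using dim_VS[OF fin_I] VS_h Lh by simp
qed

text \<open>If two elements span \<open>L\<close>, their bracket spans [L, L], so the perfect
  \<open>L\<close> would be abelian.\<close>

lemma dim_L_ge: "dim L \<ge> 3"
proof (rule ccontr)
  assume "\<not> ?thesis"
  then have d2: "dim L \<le> 2" by simp
  obtain B where B: "B \<subseteq> L" "independent B" "L \<subseteq> span B" "card B = dim L" using basis_exists[of L] by blast
  have "finite B" using B(2) by (rule finiteI_independent)
  have "\<exists>x y. B \<subseteq> {x, y} \<and> x \<in> L \<and> y \<in> L"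
  proof -
    consider "card B = 0" | "card B = 1" | "card B = 2" using d2 B(4) by linarith
    then show ?thesis
    proof cases
      case 1 then show ?thesis using \<open>finite B\<close> subspace_zero_mem[OF Ls] by auto
    next
      case 2
      then obtain x where "B = {x}" using card_1_singletonE by blast
      then show ?thesis using B(1) by blast
    next
      case 3
      then obtain x y where "B = {x, y}" using card_2_iff by metis
      then show ?thesis using B(1) by blast
    qed
  qed
  then obtain x y where xy: "B \<subseteq> {x, y}" "x \<in> L" "y \<in> L" by blast
  have Lxy: "L \<subseteq> span {x, y}" using B(3) span_mono[OF xy(1)] by blast
  define S where "S = span {bracket x y}"
  have Ss: "subspace S" and zS: "bracket x y \<in> S" unfolding S_def by (auto intro: span_base subspace_span)
  have yS: "bracket y x \<in> S" using br_anti[of y x] subspace_neg[OF Ss zS] by simp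
  have 1: "bracket a b \<in> S" if a: "a \<in> L" and b: "b = x \<or> b = y" for a b
  proof -
    have "span {x, y} \<subseteq> {a. bracket a b \<in> S}"
      by (rule span_minimal[OF _ subspace_preimage[OF Ss linear_bracket_left]])
        (use b zS yS subspace_zero_mem[OF Ss] bracket_self in auto)
    then show ?thesis using a Lxy by blast
  qed
  have 2: "bracket a b \<in> S" if a: "a \<in> L" and b: "b \<in> L" for a b
  proof -
    have "span {x, y} \<subseteq> {b. bracket a b \<in> S}"
      by (rule span_minimal[OF _ subspace_preimage[OF Ss br_lin_r]]) (use 1[OF a] in auto)
    then show ?thesis using b Lxy by blast
  qed
  have LS: "L \<subseteq> S" using bracket_span_least[OF Ss 2, of L L] L_perfect by simp
  have "bracket a b = 0" if ab: "a \<in> L" "b \<in> L" for a b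
  proof -
    have "a \<in> span {bracket x y}" "b \<in> span {bracket x y}" using ab LS unfolding S_def by blast+
    then obtain c e where "a = c *s bracket x y" "b = e *s bracket x y" by (metis span1E)
    then show ?thesis by (simp add: br_scale_l br_scale_r bracket_self)
  qed
  then have "bracket_span L L \<subseteq> {0}" by (intro bracket_span_least[OF subspace_single_0]) simp
  then have "bracket_span L L = {0}" using subspace_zero_mem[OF bracket_span_subspace] by blast
  then show False using simpL unfolding simple_def by blast
qed

text \<open>With \<open>t0\<close>, \<open>s0\<close> spanning the trivial summands,
  \<open>x\<close>, \<open>y\<close> spanning \<open>V a\<close>, and
  \<open>bracket x y = om *s t0\<close>, the aim is that \<open>N = bracket t0 s0\<close> vanishes.
  Two test vectors in \<open>V b\<close> express \<open>om *s N\<close> by the two orders of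
  applying \<open>x\<close> and \<open>y\<close> to \<open>s0\<close>, and the Jacobi identity makes
  it equal to minus twice itself. Then \<open>V a\<close> kills the image of \<open>V b\<close>
  under \<open>t0\<close>, which is \<open>V c\<close>.\<close>

lemma br_cubic_triv:
  assumes dd: "d a = 2" "d b = 2" and ts: "br a a = t" "br a b = s" "d t = 1" "d s = 1"
    and c: "br t b = c" "br s a = c" "c \<noteq> 0" and tab: "br (br t a) b = 0"
  shows "br c a = 0"
proof -
  have I: "t \<in> I" "b \<in> I" "s \<in> I" "a \<in> I" "c \<in> I" using br_dom[of t b] br_dom[of s a] br_in[of t b] c by auto
  have nz: "t \<noteq> 0" "s \<noteq> 0" using I zero_I by metis+
  have Vm: "bracket u v \<in> V (br i j)" if "i \<in> I" "j \<in> I" "br i j \<in> I" "u \<in> V i" "v \<in> V j" for i j u v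
    using br_mem[of u i v j] VV_I that by simp
  obtain t0 where t0: "t0 \<in> V t" "t0 \<noteq> 0" "V t = span {t0}" using triv_basis I ts by blast
  obtain s0 where s0: "s0 \<in> V s" "s0 \<noteq> 0" "V s = span {s0}" using triv_basis I ts by blast
  obtain x y where xy: "x \<in> V a" "y \<in> V a" "bracket x y \<noteq> 0" using br_nonzero[OF I(4,4)] ts(1) nz by blast
  have "bracket x y \<in> V t" using Vm[OF I(4,4) _ xy(1,2)] ts I by simp
  then obtain om where om: "bracket x y = om *s t0" unfolding t0(3) by (metis span1E)
  then have om0: "om \<noteq> 0" using xy by auto
  define N where "N = bracket t0 s0"
  have "x \<noteq> 0" using xy by auto
  have "y \<notin> span {x}"
  proof
    assume "y \<in> span {x}" then obtain e where "y = e *s x" by (metis span1E)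
    then show False using xy(3) by (simp add: br_scale_r bracket_self)
  qed
  then have Vxy: "V a = span {y, x}" using dim2_span[OF Vs[OF I(4)] _ xy(1) \<open>x \<noteq> 0\<close> xy(2)] dd unfolding d_def by blast
  have nondeg: "w = 0" if w: "w \<in> V b" "bracket x w = 0" "bracket y w = 0" for w
  proof (rule annihilator_zero[OF I(4,2) _ _ _ w(1), of "V a"])
    show "br a b \<noteq> 0" using ts nz by simp
    show "span (V a) = V a" using Vs[OF I(4)] by (simp add: span_eq_iff)
    fix u assume "u \<in> V a"
    moreover have "span {y, x} \<subseteq> {u. bracket u w \<in> {0}}"
      by (rule span_minimal[OF _ subspace_preimage[OF subspace_single_0 linear_bracket_left]]) (use w in auto)
    ultimately show "bracket u w = 0" using Vxy by auto
  qed (use Vst[OF I(4)] in blast)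
  \<comment> \<open>The assumption \<open>tab\<close> lets \<open>bracket t0\<close> pass through
    \<open>u\<close>.\<close>
  have A: "\<exists>e. bracket u w = e *s s0 \<and> bracket u (bracket t0 w) = e *s N" if u: "u \<in> V a" and w: "w \<in> V b" for u w
  proof -
    have "bracket u w \<in> V s" using Vm[OF I(4,2) _ u w] ts I by simp
    then obtain e where e: "bracket u w = e *s s0" unfolding s0(3) by (metis span1E)
    have "bracket (bracket t0 u) w \<in> VV (br (br t a) b)" by (intro br_mem) (use t0 u w I VV_I in simp_all)
    then have "bracket (bracket t0 u) w = 0" using tab by simp
    then have "bracket t0 (bracket u w) = bracket u (bracket t0 w)" using br_deriv[of t0 u w] by simp
    then show ?thesis using e unfolding N_def by (auto simp: br_scale_r)
  qed
  have J: "om *s bracket t0 w = bracket x (bracket y w) - bracket y (bracket x w)" for w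
    using br_deriv[of x y w] om by (simp add: br_scale_l)
  have ker: "\<exists>w\<in>V b. w \<noteq> 0 \<and> bracket u w = 0" if u: "u \<in> V a" for u
  proof (rule kernel_ex[OF br_lin_r Vs[OF I(2)]])
    show "\<And>w. w \<in> V b \<Longrightarrow> bracket u w \<in> V s" using Vm[OF I(4,2) _ u] ts I by simp
    show "dim (V s) < dim (V b)" using ts dd unfolding d_def by simp
  qed
  \<comment> \<open>Killed by \<open>y\<close>, the vector \<open>w1\<close> leaves only one term of
    \<open>J\<close>; below, \<open>w2\<close> does the same for \<open>x\<close>.\<close>
  obtain w1 where w1: "w1 \<in> V b" "w1 \<noteq> 0" "bracket y w1 = 0" using ker[OF xy(2)] by blast
  obtain e1 where e1: "bracket x w1 = e1 *s s0" "bracket x (bracket t0 w1) = e1 *s N" using A[OF xy(1) w1(1)] by blast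
  have e1n: "e1 \<noteq> 0" using nondeg[OF w1(1) _ w1(3)] w1(2) e1 by auto
  have "om *s bracket x (bracket t0 w1) = - (e1 *s bracket x (bracket y s0))"
  proof -
    have "om *s bracket t0 w1 = - (e1 *s bracket y s0)" using J[of w1] w1(3) e1(1) by (simp add: br_scale_r)
    then have "bracket x (om *s bracket t0 w1) = bracket x (- (e1 *s bracket y s0))" by simp
    then show ?thesis by (simp add: br_scale_r br_neg_r)
  qed
  then have "e1 *s (om *s N) = e1 *s (- bracket x (bracket y s0))" using e1(2) by (simp add: mult.commute scale_minus_right)
  then have R1: "om *s N = - bracket x (bracket y s0)" using e1n scale_left_imp_eq by blast
  obtain w2 where w2: "w2 \<in> V b" "w2 \<noteq> 0" "bracket x w2 = 0" using ker[OF xy(1)] by blast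
  obtain e2 where e2: "bracket y w2 = e2 *s s0" "bracket y (bracket t0 w2) = e2 *s N" using A[OF xy(2) w2(1)] by blast
  have e2n: "e2 \<noteq> 0" using nondeg[OF w2(1,3)] w2(2) e2 by auto
  have "om *s bracket y (bracket t0 w2) = e2 *s bracket y (bracket x s0)"
  proof -
    have "om *s bracket t0 w2 = e2 *s bracket x s0" using J[of w2] w2(3) e2(1) by (simp add: br_scale_r)
    then have "bracket y (om *s bracket t0 w2) = bracket y (e2 *s bracket x s0)" by simp
    then show ?thesis by (simp add: br_scale_r)
  qed
  then have "e2 *s (om *s N) = e2 *s bracket y (bracket x s0)" using e2(2) by (simp add: mult.commute)
  then have R2: "om *s N = bracket y (bracket x s0)" using e2n scale_left_imp_eq by blast
  have "om *s N = bracket (bracket x y) s0" unfolding N_def using om by (simp add: br_scale_l)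
  also have "\<dots> = bracket x (bracket y s0) - bracket y (bracket x s0)" using br_deriv[of x y s0] by simp
  also have "\<dots> = - (om *s N) - om *s N" using R1 R2 by simp
  finally have "om *s N + om *s N + om *s N = 0" by (simp add: algebra_simps)
  then have "(om + om + om) *s N = 0" by (simp only: scale_left_distrib)
  moreover have "om + om + om \<noteq> 0" using om0 by simp
  ultimately have N0: "N = 0" using scale_eq_0_iff by blast
  have "bracket v u = 0" if v: "v \<in> V c" and u: "u \<in> V a" for v u
  proof -
    have "V c = bracket_span (V t) (V b)" using br_span[OF I(1,2)] VV_I I c by simp
    also have "\<dots> \<subseteq> {v. bracket v u \<in> {0}}"
    proof (rule bracket_span_least[OF subspace_preimage[OF subspace_single_0 linear_bracket_left]])
      fix t' w assume t': "t' \<in> V t" and w: "w \<in> V b"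
      obtain e where e: "t' = e *s t0" using t' unfolding t0(3) by (metis span1E)
      have "bracket u (bracket t0 w) = 0" using A[OF u w] N0 by auto
      then have "bracket (bracket t0 w) u = 0" using br_anti[of "bracket t0 w" u] by simp
      then show "bracket t' w \<in> {v. bracket v u \<in> {0}}" using e by (simp add: br_scale_l)
    qed
    finally show ?thesis using v by auto
  qed
  then show ?thesis using br_nonzero[OF I(5,4)] by blast
qed

end

section \<open>Rank and nullity, coordinates, and eigenvectors of inner derivations\<close>

context fd_lie begin

text \<open>Induction over a basis: a new basis vector enlarges the image or, after subtraction of a
  vector with the same image, the kernel.\<close>

lemma rank_nullity_le:
  assumes f: "Vector_Spaces.linear scale scale f" and S: "subspace S"
  shows "dim S \<le> dim {x\<in>S. f x = 0} + dim (f ` S)"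
proof -
  interpret f: Vector_Spaces.linear scale scale f by fact
  obtain B where B: "B \<subseteq> S" "independent B" "S \<subseteq> span B" using maximal_independent_subset by blast
  have "finite B" using B(2) by (rule finiteI_independent)
  have "dim (span B) \<le> dim {x\<in>span B. f x = 0} + dim (f ` span B)" using \<open>finite B\<close>
  proof (induction B)
    case empty then show ?case by simp
  next
    case (insert b B)
    let ?K = "\<lambda>B. {x\<in>span B. f x = 0}"
    have mono: "span B \<subseteq> span (insert b B)" by (rule span_mono) auto
    have bS: "b \<in> span (insert b B)" by (rule span_base) simp
    have le: "dim (?K B) \<le> dim (?K (insert b B))" "dim (f ` span B) \<le> dim (f ` span (insert b B))"
      by (rule dim_subset, use mono in blast)+
    have d: "dim (span (insert b B)) \<le> dim (span B) + 1" by (simp add: dim_insert)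
    show ?case
    proof (cases "b \<in> span B")
      case True then have "span (insert b B) = span B" by (rule span_redundant)
      then show ?thesis using insert.IH by simp
    next
      case b: False
      show ?thesis
      proof (cases "f b \<in> f ` span B")
        case True
        then obtain s where s: "s \<in> span B" "f b = f s" by blast
        have "b - s \<in> ?K (insert b B)" using s mono bS by (simp add: f.diff span_diff subset_iff)
        then have "insert (b - s) (?K B) \<subseteq> ?K (insert b B)" using mono by blast
        then have "dim (insert (b - s) (?K B)) \<le> dim (?K (insert b B))" by (rule dim_subset)
        moreover have "b - s \<notin> span (?K B)"
        proof
          assume "b - s \<in> span (?K B)"
          moreover have "span (?K B) \<subseteq> span B" by (rule span_minimal) (auto intro: subspace_span)
          ultimately have "(b - s) + s \<in> span B" using s(1) span_add by blast
          then show False using b by simp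
        qed
        ultimately have "dim (?K B) + 1 \<le> dim (?K (insert b B))" by (simp add: dim_insert)
        then show ?thesis using insert.IH le d by linarith
      next
        case False
        have "insert (f b) (f ` span B) \<subseteq> f ` span (insert b B)" using mono bS by blast
        then have "dim (insert (f b) (f ` span B)) \<le> dim (f ` span (insert b B))" by (rule dim_subset)
        moreover have "span (f ` span B) = f ` span B"
          using image_subspace[OF f subspace_span] by (simp add: span_eq_iff)
        ultimately have "dim (f ` span B) + 1 \<le> dim (f ` span (insert b B))" using False by (simp add: dim_insert)
        then show ?thesis using insert.IH le d by linarith
      qed
    qed
  qed
  moreover have "span B = S" using B S by (metis span_subspace)
  ultimately show ?thesis by simp
qed

lemma dim3_span: assumes S: "subspace S" "dim S = 3" and x: "x \<in> S" "x \<noteq> 0" and y: "y \<in> S" "y \<notin> span {x}"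
    and z: "z \<in> S" "z \<notin> span {y, x}"
  shows "S = span {z, y, x}"
proof -
  have "span {z, y, x} \<subseteq> S" using span_minimal[of "{z,y,x}" S] x y z S by simp
  moreover have "dim {z, y, x} = 3" using x y z by (simp add: dim_insert)
  ultimately show ?thesis using subspace_dim_equal[OF subspace_span S(1), of "{z, y, x}"] S(2) by simp
qed

lemma span2E: assumes "v \<in> span {y, x}" obtains a b where "v = a *s y + b *s x"
proof -
  obtain a where "v - a *s y \<in> span {x}" using assms span_breakdown_eq[of v y "{x}"] by blast
  then obtain b where "v - a *s y = b *s x" by (metis span1E)
  then have "v = a *s y + b *s x" by (simp add: algebra_simps)
  then show ?thesis using that by blast
qed

lemma span3E: assumes "v \<in> span {z, y, x}" obtains a b c where "v = a *s z + b *s y + c *s x"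
proof -
  obtain a where "v - a *s z \<in> span {y, x}" using assms span_breakdown_eq[of v z "{y,x}"] by blast
  then obtain b c where "v - a *s z = b *s y + c *s x" by (metis span2E)
  then have "v = a *s z + b *s y + c *s x" by (simp add: algebra_simps)
  then show ?thesis using that by blast
qed

lemma indep3: assumes x: "x \<noteq> 0" and y: "y \<notin> span {x}" and z: "z \<notin> span {y, x}" and e: "a *s z + b *s y + c *s x = 0"
  shows "a = 0" "b = 0" "c = 0"
proof -
  show a: "a = 0"
  proof (rule ccontr)
    assume "a \<noteq> 0"
    have m: "y \<in> span {y, x}" "x \<in> span {y, x}" by (auto intro: span_base)
    have "a *s z + (b *s y + c *s x) = 0" using e by (simp only: add.assoc)
    then have "a *s z = - (b *s y + c *s x)" by (rule eq_neg_iff_add_eq_0[THEN iffD2])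
    then have "a *s z \<in> span {y, x}" using m by (metis span_neg span_add span_scale)
    then have "inverse a *s a *s z \<in> span {y, x}" by (rule span_scale)
    then show False using z \<open>a \<noteq> 0\<close> by simp
  qed
  show b: "b = 0"
  proof (rule ccontr)
    assume "b \<noteq> 0"
    have "b *s y = - (c *s x)" using e a by (simp add: eq_neg_iff_add_eq_0)
    then have "b *s y \<in> span {x}" using span_base[of x "{x}"] by (metis span_neg span_scale singletonI)
    then have "inverse b *s b *s y \<in> span {x}" by (rule span_scale)
    then show False using y \<open>b \<noteq> 0\<close> by simp
  qed
  show "c = 0" using e a b x by simp
qed

lemma bracket_span3:
  assumes "A \<subseteq> span {z, y, x}" "subspace S" "bracket x y \<in> S" "bracket x z \<in> S" "bracket y z \<in> S"
  shows "bracket_span A A \<subseteq> S"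
proof (rule bracket_span_least[OF assms(2)])
  fix a b assume ab: "a \<in> A" "b \<in> A"
  have n: "bracket y x \<in> S" "bracket z x \<in> S" "bracket z y \<in> S"
    using assms(3-5) subspace_neg[OF assms(2)] br_anti[of y x] br_anti[of z x] br_anti[of z y] by simp_all
  have 1: "bracket a b \<in> S" if "b \<in> {x, y, z}" for b
  proof -
    have "span {z, y, x} \<subseteq> {a. bracket a b \<in> S}"
      by (rule span_minimal[OF _ subspace_preimage[OF assms(2) linear_bracket_left]])
        (use that n assms(3-5) subspace_zero_mem[OF assms(2)] bracket_self in auto)
    then show ?thesis using ab(1) assms(1) by blast
  qed
  have "span {z, y, x} \<subseteq> {b. bracket a b \<in> S}"
    by (rule span_minimal[OF _ subspace_preimage[OF assms(2) br_lin_r]]) (use 1 in auto)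
  then show "bracket a b \<in> S" using ab(2) assms(1) by blast
qed

text \<open>Subtracting \<open>\<mu> a\<close> times the sum from its image under
  \<open>bracket H\<close> removes the summand at \<open>a\<close> and scales the others by nonzero
  factors.\<close>

lemma eig_sum_zero:
  assumes "finite A" "\<And>m. m \<in> A \<Longrightarrow> bracket H (y m) = \<mu> m *s y m" "inj_on \<mu> A" "(\<Sum>m\<in>A. y m) = 0" "m \<in> A"
  shows "y m = 0"
  using assms
proof (induction A arbitrary: y m rule: finite_induct)
  case empty then show ?case by simp
next
  case (insert a A)
  have "bracket H (\<Sum>m\<in>insert a A. y m) = (\<Sum>m\<in>insert a A. \<mu> m *s y m)"
    unfolding br_sum_r by (rule sum.cong) (use insert.prems in auto)
  then have 1: "(\<Sum>m\<in>insert a A. \<mu> m *s y m) = 0" unfolding insert.prems(3) by simp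
  have "(\<Sum>m\<in>insert a A. \<mu> a *s y m) = \<mu> a *s (\<Sum>m\<in>insert a A. y m)" by (simp only: scale_sum_right)
  then have "(\<Sum>m\<in>insert a A. \<mu> a *s y m) = 0" unfolding insert.prems(3) by simp
  then have "(\<Sum>m\<in>insert a A. \<mu> m *s y m) - (\<Sum>m\<in>insert a A. \<mu> a *s y m) = 0" unfolding 1 by simp
  then have "(\<Sum>m\<in>insert a A. (\<mu> m - \<mu> a) *s y m) = 0"
    by (simp only: sum_subtractf[symmetric] scale_left_diff_distrib[symmetric])
  then have 2: "(\<Sum>m\<in>A. (\<mu> m - \<mu> a) *s y m) = 0" unfolding sum.insert[OF insert.hyps] by simp
  have "(\<mu> m - \<mu> a) *s y m = 0" if "m \<in> A" for m
  proof (rule insert.IH[OF _ _ 2 that])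
    show "bracket H ((\<mu> m - \<mu> a) *s y m) = \<mu> m *s (\<mu> m - \<mu> a) *s y m" if "m \<in> A" for m
      using insert.prems(1)[of m] that by (simp add: br_scale_r mult.commute)
    show "inj_on \<mu> A" using insert.prems(2) by (rule inj_on_subset) auto
  qed
  moreover have "\<mu> m \<noteq> \<mu> a" if "m \<in> A" for m using insert.prems(2) insert.hyps(2) that unfolding inj_on_def by blast
  ultimately have z: "y m = 0" if "m \<in> A" for m using that scale_eq_0_iff by (metis right_minus_eq)
  then have "(\<Sum>m\<in>A. y m) = 0" by (intro sum.neutral) simp
  then have "y a = 0" using insert.prems(3) unfolding sum.insert[OF insert.hyps] by simp
  then show ?case using z insert.prems(4) by blast
qed

lemma eig_independent:
  assumes "finite A" "\<And>m. m \<in> A \<Longrightarrow> bracket H (f m) = \<mu> m *s f m" "inj_on \<mu> A" "\<And>m. m \<in> A \<Longrightarrow> f m \<noteq> 0"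
  shows "independent (f ` A)" "card (f ` A) = card A"
proof -
  have inj: "inj_on f A"
  proof (rule inj_onI)
    fix m n assume mn: "m \<in> A" "n \<in> A" "f m = f n"
    then have "\<mu> m *s f m = \<mu> n *s f m" using assms(2) by metis
    then have "\<mu> m = \<mu> n" using assms(4)[OF mn(1)] by simp
    then show "m = n" using assms(3) mn unfolding inj_on_def by blast
  qed
  then show "card (f ` A) = card A" by (rule card_image)
  show "independent (f ` A)"
  proof
    assume "dependent (f ` A)"
    then obtain u where u: "\<exists>x\<in>f ` A. u x \<noteq> 0" "(\<Sum>x\<in>f ` A. u x *s x) = 0"
      using dependent_finite[of "f ` A"] assms(1) by auto
    have s: "(\<Sum>m\<in>A. u (f m) *s f m) = 0" using u(2) sum.reindex[OF inj, of "\<lambda>x. u x *s x"] by (simp add: o_def)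
    have "u (f m) *s f m = 0" if "m \<in> A" for m
      by (rule eig_sum_zero[OF assms(1) _ assms(3) s that, of H]) (simp add: br_scale_r assms(2) mult.commute)
    then show False using u(1) assms(4) by auto
  qed
qed

text \<open>Vectors in the span are sums of eigenvectors with eigenvalues in \<open>A\<close>. With
  \<open>- x\<close> adjoined at a further eigenvalue \<open>m\<close>, such a sum would vanish,
  against independence.\<close>

lemma eig_span:
  assumes A: "finite A" and S: "\<And>s. s \<in> S \<Longrightarrow> \<exists>l\<in>A. bracket H s = l *s s"
    and x: "x \<in> span S" "x \<noteq> 0" "bracket H x = m *s x"
  shows "m \<in> A"
proof (rule ccontr)
  assume m: "m \<notin> A"
  define X where "X = {\<Sum>l\<in>A. y l | y. \<forall>l\<in>A. bracket H (y l) = l *s y l}"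
  have Xs: "subspace X" unfolding subspace_def
  proof (intro conjI ballI allI)
    show "0 \<in> X" unfolding X_def by (auto intro!: exI[of _ "\<lambda>_. 0"])
  next
    fix u v assume "u \<in> X" "v \<in> X"
    then obtain y y' where y: "u = (\<Sum>l\<in>A. y l)" "\<forall>l\<in>A. bracket H (y l) = l *s y l"
      "v = (\<Sum>l\<in>A. y' l)" "\<forall>l\<in>A. bracket H (y' l) = l *s y' l" unfolding X_def by blast
    then have "u + v = (\<Sum>l\<in>A. y l + y' l)" "\<forall>l\<in>A. bracket H (y l + y' l) = l *s (y l + y' l)"
      by (simp_all add: sum.distrib br_add_r scale_right_distrib)
    then show "u + v \<in> X" unfolding X_def by (intro CollectI exI[of _ "\<lambda>l. y l + y' l"]) simp
  next
    fix c u assume "u \<in> X"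
    then obtain y where y: "u = (\<Sum>l\<in>A. y l)" "\<forall>l\<in>A. bracket H (y l) = l *s y l" unfolding X_def by blast
    then have "c *s u = (\<Sum>l\<in>A. c *s y l)" "\<forall>l\<in>A. bracket H (c *s y l) = l *s (c *s y l)"
      by (simp_all add: scale_sum_right br_scale_r mult.commute)
    then show "c *s u \<in> X" unfolding X_def by (intro CollectI exI[of _ "\<lambda>l. c *s y l"]) simp
  qed
  have "S \<subseteq> X"
  proof
    fix s assume "s \<in> S"
    then obtain l where l: "l \<in> A" "bracket H s = l *s s" using S by blast
    have "s = (\<Sum>l'\<in>A. if l' = l then s else 0)" using A l(1) by simp
    then show "s \<in> X" unfolding X_def using l by (intro CollectI exI[of _ "\<lambda>l'. if l' = l then s else 0"]) simp
  qed
  then have "x \<in> X" using span_minimal[OF _ Xs] x(1) by blast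
  then obtain y where y: "x = (\<Sum>l\<in>A. y l)" "\<forall>l\<in>A. bracket H (y l) = l *s y l" unfolding X_def by blast
  define z where "z l = (if l = m then - x else y l)" for l
  have "(\<Sum>l\<in>A. z l) = (\<Sum>l\<in>A. y l)" by (rule sum.cong) (use m in \<open>auto simp: z_def\<close>)
  then have "(\<Sum>l\<in>insert m A. z l) = 0" using A m y(1) by (simp add: z_def)
  then have "z m = 0"
    by (rule eig_sum_zero[OF _ _ _ , of "insert m A" H z "\<lambda>l. l", rotated 3])
      (use A y(2) x(3) in \<open>auto simp: z_def br_neg_r\<close>)
  then show False using x(2) unfolding z_def by simp
qed

end

section \<open>Levi subalgebras with a two-dimensional module or of dimension 3\<close>

context levi_setting begin

lemma faithful: assumes i: "i \<in> I" "d i \<noteq> 1" and l: "l \<in> L" "\<And>w. w \<in> V i \<Longrightarrow> bracket l w = 0" shows "l = 0"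
proof -
  define K where "K = {l\<in>L. \<forall>w\<in>V i. bracket l w = 0}"
  have "subspace K" unfolding subspace_def K_def
    using subspace_zero_mem[OF Ls] subspace_add[OF Ls] subspace_scale[OF Ls] by (auto simp: br_add_l br_scale_l)
  moreover have "bracket x k \<in> K" if x: "x \<in> L" and k: "k \<in> K" for x k
  proof -
    have "bracket (bracket x k) w = 0" if w: "w \<in> V i" for w
      using br_deriv[of x k w] k w Vst[OF i(1) x w] unfolding K_def by simp
    then show ?thesis using Lc[OF x] k unfolding K_def by blast
  qed
  ultimately have "lie_ideal K L" unfolding lie_ideal_def K_def by blast
  then have "K = {0} \<or> K = L" using simpL unfolding simple_def by blast
  moreover have "K \<noteq> L" using triv_iff[OF i(1)] i(2) unfolding K_def by blast
  ultimately show ?thesis using l unfolding K_def by blast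
qed

text \<open>The action on a nontrivial summand is faithful. If \<open>L\<close> had dimension at
  least 4, counting dimensions through the annihilator \<open>K\<close> of \<open>u\<close> would
  make both orbit maps onto, so some element would act as the identity on the plane. It would be
  central in \<open>L\<close>, hence zero.\<close>

lemma two_dim_L: assumes i: "i \<in> I" "d i = 2" shows "dim L = 3"
proof (rule ccontr)
  assume "dim L \<noteq> 3"
  then have L4: "dim L \<ge> 4" using dim_L_ge by linarith
  have W: "subspace (V i)" "dim (V i) = 2" using Vs i unfolding d_def by auto
  obtain u where u: "u \<in> V i" "u \<noteq> 0" using Vne[OF i(1)] subspace_zero_mem[OF W(1)] by blast
  have "\<not> V i \<subseteq> span {u}" using dim_subset[of "V i" "span {u}"] W(2) u by auto
  then obtain v where v: "v \<in> V i" "v \<notin> span {u}" by blast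
  have Vuv: "V i = span {v, u}" by (rule dim2_span[OF W u v])
  define K where "K = {l\<in>L. bracket l u = 0}"
  have Ks: "subspace K" unfolding subspace_def K_def
    using subspace_zero_mem[OF Ls] subspace_add[OF Ls] subspace_scale[OF Ls] by (auto simp: br_add_l br_scale_l)
  let ?f = "\<lambda>l. bracket l v" and ?g = "\<lambda>l. bracket l u"
  have f: "Vector_Spaces.linear scale scale ?f" "Vector_Spaces.linear scale scale ?g" by (rule linear_bracket_left)+
  have kill: "l = 0" if l: "l \<in> L" "bracket l u = 0" "bracket l v = 0" for l
  proof (rule faithful[OF i(1) _ l(1)])
    have "span {v, u} \<subseteq> {w. bracket l w \<in> {0}}"
      by (rule span_minimal[OF _ subspace_preimage[OF subspace_single_0 br_lin_r]]) (use l in auto)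
    then show "bracket l w = 0" if "w \<in> V i" for w using that Vuv by auto
  qed (use i in simp)
  have fK: "dim (?f ` K) = dim K" by (rule dim_image_inj[OF f(1) Ks]) (use kill in \<open>auto simp: K_def\<close>)
  have sub: "?f ` K \<subseteq> V i" "?g ` L \<subseteq> V i" using Vst[OF i(1)] u v unfolding K_def by auto
  have "dim (?f ` K) \<le> 2" "dim (?g ` L) \<le> 2" using dim_subset[OF sub(1)] dim_subset[OF sub(2)] W(2) by simp_all
  moreover have "dim L \<le> dim K + dim (?g ` L)" using rank_nullity_le[OF f(2) Ls] unfolding K_def .
  ultimately have "dim (?f ` K) = 2" "dim (?g ` L) = 2" using fK L4 by linarith+
  then have eq: "?f ` K = V i" "?g ` L = V i"
    using subspace_dim_equal[OF image_subspace[OF f(1) Ks] W(1) sub(1)]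
      subspace_dim_equal[OF image_subspace[OF f(2) Ls] W(1) sub(2)] W(2) by simp_all
  obtain l1 where l1: "l1 \<in> L" "bracket l1 u = u" using eq(2) u(1) by (metis imageE)
  have "v - bracket l1 v \<in> V i" using Vst[OF i(1) l1(1) v(1)] v(1) subspace_diff[OF W(1)] by blast
  then obtain l2 where l2: "l2 \<in> K" "bracket l2 v = v - bracket l1 v" using eq(1) by (metis imageE)
  define l where "l = l1 + l2"
  have l: "l \<in> L" "bracket l u = u" "bracket l v = v"
    using l1 l2 subspace_add[OF Ls] unfolding l_def K_def by (auto simp: br_add_l)
  have id: "bracket l w = w" if w: "w \<in> V i" for w
  proof -
    have "w \<in> span {v, u}" using w Vuv by simp
    then obtain a b where "w = a *s v + b *s u" by (rule span2E)
    then show ?thesis using l by (simp add: br_add_r br_scale_r)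
  qed
  have "bracket l m = 0" if m: "m \<in> L" for m
  proof (rule faithful[OF i(1) _ Lc[OF l(1) m]])
    fix w assume w: "w \<in> V i"
    show "bracket (bracket l m) w = 0" using br_deriv[of l m w] id[OF w] id[OF Vst[OF i(1) m w]] by simp
  qed (use i in simp)
  then have "l \<in> center L" unfolding center_def using l(1) by blast
  then have "l = 0" using center_L by blast
  then show False using l(2) u by simp
qed

text \<open>Perfectness is what keeps structure constants away from zero: it bounds centralizers,
  and it prevents the third basis vector from dropping out of the brackets. The Jacobi identity then
  fixes the last eigenvalue to be -2.\<close>

lemma sl2_triple_ex: assumes L3: "dim L = 3"
  shows "\<exists>H E F. H \<in> L \<and> E \<in> L \<and> F \<in> L \<and> bracket H E = 2 *s E \<and> bracket H F = (-2) *s F \<and> bracket E F = H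
    \<and> L = span {F, H, E}"
proof -
  have proper: "\<not> L \<subseteq> span {y, x}" for x y
  proof
    assume "L \<subseteq> span {y, x}"
    then have "dim L \<le> dim {y, x}" using dim_subset[of L "span {y, x}"] by simp
    also have "\<dots> \<le> card {y, x}" by (rule dim_le_card') simp
    also have "\<dots> \<le> 2" by (simp add: card_insert_if)
    finally show False using L3 by simp
  qed
  have ne: "\<not> L \<subseteq> span {x}" for x using proper[of x x] by simp
  have nz: "L \<noteq> {0}" using L3 by auto
  obtain x0 where x0: "x0 \<in> L" "x0 \<noteq> 0" using nz subspace_zero_mem[OF Ls] by blast
  \<comment> \<open>Otherwise [L, L] would be spanned by two brackets.\<close>
  have ker: "z \<in> span {x0}" if z: "z \<in> L" "bracket x0 z = 0" for z
  proof (rule ccontr)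
    assume n: "z \<notin> span {x0}"
    obtain y where y: "y \<in> L" "y \<notin> span {z, x0}" using proper by blast
    have Le: "L = span {y, z, x0}" by (rule dim3_span[OF Ls L3 x0 z(1) n y])
    have "bracket_span L L \<subseteq> span {bracket x0 y, bracket z y}"
      by (rule bracket_span3[of L y z x0]) (use Le z in \<open>auto intro: span_base span_zero\<close>)
    then show False using L_perfect proper by simp
  qed
  define M where "M = bracket x0 ` L"
  have Ms: "subspace M" unfolding M_def by (rule image_subspace[OF br_lin_r Ls])
  have M_L: "M \<subseteq> L" unfolding M_def using Lc x0 by blast
  have "M \<noteq> {0}"
  proof
    assume "M = {0}"
    then have "L \<subseteq> span {x0}" using ker unfolding M_def by blast
    then show False using ne by blast
  qed
  then have "\<not> M \<subseteq> {0}" using subspace_zero_mem[OF Ms] by blast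
  moreover have "bracket x0 u \<in> M" if "u \<in> M" for u using that M_L unfolding M_def by blast
  ultimately obtain u c where u: "u \<in> M" "u \<noteq> 0" "bracket x0 u = c *s u"
    using eigenvector_mod[OF br_lin_r[of x0] Ms subspace_single_0] by auto
  \<comment> \<open>If the eigenvalue of \<open>u\<close> is 0, then \<open>u\<close> is a multiple
    of \<open>x0\<close> and also a bracket \<open>bracket x0 w\<close>, so \<open>x0\<close> is an
    eigenvector of \<open>w\<close> with nonzero eigenvalue.\<close>
  have "\<exists>y\<in>L. \<exists>x\<in>L. \<exists>c. x \<noteq> 0 \<and> c \<noteq> 0 \<and> bracket y x = c *s x"
  proof (cases "c = 0")
    case False then show ?thesis using u x0 M_L by blast
  next
    case True
    then have "u \<in> span {x0}" using ker u M_L by auto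
    then obtain e where e: "u = e *s x0" by (metis span1E)
    then have "e \<noteq> 0" using u by auto
    obtain w where w: "w \<in> L" "u = bracket x0 w" using u(1) unfolding M_def by blast
    have "bracket w x0 = (- e) *s x0" using w(2) e br_anti[of w x0] by simp
    then show ?thesis using w(1) x0 \<open>e \<noteq> 0\<close> by (metis neg_equal_0_iff_equal)
  qed
  then obtain h0 x c where hx: "h0 \<in> L" "x \<in> L" "x \<noteq> 0" "c \<noteq> 0" "bracket h0 x = c *s x" by blast
  define hh where "hh = (2 / c) *s h0"
  have hL: "hh \<in> L" unfolding hh_def using hx subspace_scale[OF Ls] by blast
  have hhx: "bracket hh x = 2 *s x" unfolding hh_def using hx by (simp add: br_scale_l)
  then have hxh: "bracket x hh = (-2) *s x" using br_anti[of x hh] by simp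
  have hn: "hh \<notin> span {x}"
  proof
    assume "hh \<in> span {x}" then obtain e where "hh = e *s x" by (metis span1E)
    then have "2 *s x = 0" using hhx by (simp add: br_scale_l bracket_self)
    then show False using hx by simp
  qed
  obtain y where y: "y \<in> L" "y \<notin> span {hh, x}" using proper by blast
  have Le: "L = span {y, hh, x}" by (rule dim3_span[OF Ls L3 hx(2,3) hL hn y])
  have "bracket hh y \<in> span {y, hh, x}" "bracket x y \<in> span {y, hh, x}" using Lc hL hx(2) y(1) unfolding Le[symmetric] by blast+
  then obtain c a b r p q where hy: "bracket hh y = c *s y + a *s hh + b *s x" and xy: "bracket x y = r *s y + p *s hh + q *s x"
    by (metis span3E)
  \<comment> \<open>Coefficients along \<open>y\<close>, \<open>hh\<close>, \<open>x\<close> are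
    compared on both sides.\<close>
  have "bracket hh (bracket x y) = bracket (bracket hh x) y + bracket x (bracket hh y)" by (rule br_deriv)
  then have "r *s (c *s y + a *s hh + b *s x) + q *s (2 *s x)
      = 2 *s (r *s y + p *s hh + q *s x) + (c *s (r *s y + p *s hh + q *s x) + a *s ((-2) *s x))"
    by (simp only: hhx hy xy br_add_r br_scale_r br_scale_l bracket_self hxh) (simp add: hy xy hhx bracket_self)
  then have "(r * c - 2 * r - c * r) *s y + (r * a - 2 * p - c * p) *s hh + (r * b + 2 * q - 2 * q - c * q + 2 * a) *s x = 0"
    by (simp add: scale_left_diff_distrib scale_left_distrib scale_right_distrib algebra_simps)
  from indep3[OF hx(3) hn y(2) this] have co: "r = 0" "r * a - 2 * p - c * p = 0" "c * q = 2 * a"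
    by (simp_all add: algebra_simps)
  have p0: "p \<noteq> 0"
  proof
    assume "p = 0"
    then have "bracket x y = q *s x" using xy co by simp
    then have "bracket_span L L \<subseteq> span {bracket hh y, x}"
      by (intro bracket_span3[of L y hh x]) (use Le hxh in \<open>auto intro: span_base span_scale span_neg\<close>)
    then show False using L_perfect proper by simp
  qed
  have "(2 + c) * p = r * a - (r * a - 2 * p - c * p)" by (simp add: algebra_simps)
  then have "(2 + c) * p = 0" unfolding co(2) using co(1) by simp
  then have c2: "c = -2" using p0 by (simp add: eq_neg_iff_add_eq_0 add.commute)
  then have "- q = a" using co by simp
  then have qa: "q = - a" by auto
  \<comment> \<open>These constants remove the components of \<open>bracket hh y\<close> along
    \<open>hh\<close> and \<open>x\<close>, so that \<open>y'\<close> is an eigenvector.\<close>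
  define s and t where "s = - a / 2" and "t = - b / 4"
  define y' where "y' = y + s *s hh + t *s x"
  have y'L: "y' \<in> L" unfolding y'_def using y(1) hL hx(2) subspace_add[OF Ls] subspace_scale[OF Ls] by blast
  have "bracket hh y' = (-2) *s y + a *s hh + b *s x + t *s (2 *s x)"
    unfolding y'_def by (simp only: br_add_r br_scale_r hy hhx bracket_self c2) simp
  also have "\<dots> = (-2) *s y + a *s hh + (b + 2 * t) *s x" by (simp add: scale_left_distrib mult.commute)
  also have "\<dots> = (-2) *s y'"
  proof -
    have eq: "(-2) *s y' = (-2) *s y + (-2 * s) *s hh + (-2 * t) *s x" unfolding y'_def
      by (simp only: scale_right_distrib scale_scale)
    have st: "-2 * s = a" "-2 * t = b + 2 * t" unfolding s_def t_def by simp_all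
    show ?thesis by (simp only: eq st)
  qed
  finally have hy': "bracket hh y' = (-2) *s y'" .
  have "bracket x y' = p *s hh + q *s x + s *s ((-2) *s x)"
    unfolding y'_def by (simp only: br_add_r br_scale_r xy hxh bracket_self co(1)) simp
  also have "\<dots> = p *s hh + (q + s * (-2)) *s x" by (simp only: scale_left_distrib scale_scale add.assoc)
  also have "q + s * (-2) = 0" unfolding s_def qa by simp
  finally have xy': "bracket x y' = p *s hh" by simp
  define F where "F = inverse p *s y'"
  have FL: "F \<in> L" unfolding F_def using y'L subspace_scale[OF Ls] by blast
  have 1: "bracket hh F = (-2) *s F" "bracket x F = hh" unfolding F_def using hy' xy' p0 by (simp_all add: br_scale_r)
  have "L \<subseteq> span {F, hh, x}"
  proof -
    have m: "F \<in> span {F, hh, x}" "hh \<in> span {F, hh, x}" "x \<in> span {F, hh, x}" by (auto intro: span_base)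
    have pF: "p *s F = y'" unfolding F_def using p0 by simp
    have "y = p *s F - s *s hh - t *s x" unfolding pF y'_def by simp
    then have "y \<in> span {F, hh, x}" using m by (metis span_diff span_scale)
    then have "{y, hh, x} \<subseteq> span {F, hh, x}" using m by blast
    then show ?thesis unfolding Le by (rule span_minimal) (rule subspace_span)
  qed
  moreover have "span {F, hh, x} \<subseteq> L" by (rule span_minimal[OF _ Ls]) (use FL hL hx in blast)
  ultimately have "L = span {F, hh, x}" by blast
  then show ?thesis using FL hL hx(2) 1 hhx by blast
qed

end

section \<open>Weights of simple modules over sl2\<close>

locale sl2_setting = levi_setting scale bracket Basis L h k V
  for scale :: "complex \<Rightarrow> 'a::ab_group_add \<Rightarrow> 'a" (infixr "*s" 75) and bracket and Basis and L h k V +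
  fixes H E F :: 'a
  assumes HL: "H \<in> L" and EL: "E \<in> L" and FL: "F \<in> L"
    and HE: "bracket H E = 2 *s E" and HF: "bracket H F = (-2) *s F" and EF: "bracket E F = H"
    and LHEF: "L = span {F, H, E}"
begin

lemma eig_shift_E: "bracket H v = c *s v \<Longrightarrow> bracket H (bracket E v) = (c + 2) *s bracket E v"
  using br_deriv[of H E v] by (simp add: HE br_scale_l br_scale_r scale_left_distrib add.commute)

lemma eig_shift_F: "bracket H v = c *s v \<Longrightarrow> bracket H (bracket F v) = (c - 2) *s bracket F v"
  using br_deriv[of H F v] by (simp add: HF br_neg_l br_scale_l br_scale_r scale_left_diff_distrib)

lemma eig_finite:
  assumes "\<And>m. bracket H (f m) = \<mu> m *s f m" "inj \<mu>" shows "\<exists>m::nat. f m = 0"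
proof (rule ccontr)
  assume "\<not> ?thesis"
  then have n: "f m \<noteq> 0" for m by blast
  have i: "inj_on \<mu> {..dimension}" using assms(2) by (rule inj_on_subset) simp
  have "independent (f ` {..dimension})" "card (f ` {..dimension}) = card {..dimension}"
    using eig_independent[of "{..dimension}" H f \<mu>] assms(1) n i by simp_all
  then show False using independent_card_le_dim[of "f ` {..dimension}" UNIV] dim_UNIV dimension_def by fastforce
qed

text \<open>An eigenvector of \<open>H\<close> is raised by \<open>E\<close> as long as it stays
  nonzero, and the result is lowered by \<open>F\<close>. The resulting string spans a submodule,
  which is everything by simplicity.\<close>

lemma weight_basis:
  assumes i: "i \<in> I"
  shows "\<exists>e n. d i = Suc n \<and> (\<forall>m\<le>n. e m \<in> V i \<and> e m \<noteq> 0 \<and> bracket H (e m) = (of_nat n - 2 * of_nat m) *s e m)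
    \<and> V i = span (e ` {..n}) \<and> (\<forall>m. bracket F (e m) = e (Suc m))"
proof -
  have W: "subspace (V i)" "\<not> V i \<subseteq> {0}" using Vs[OF i] Vne[OF i] subspace_zero_mem by blast+
  have st: "bracket x v \<in> V i" if "x \<in> {H, E, F}" "v \<in> V i" for x v using Vst[OF i] HL EL FL that by blast
  from eigenvector_mod[OF br_lin_r W(1) subspace_single_0 W(2), of H]
  obtain u \<mu> where u: "u \<in> V i" "u \<noteq> 0" "bracket H u = \<mu> *s u" using st by auto
  define g where "g m = (bracket E ^^ m) u" for m
  have gH: "bracket H (g m) = (\<mu> + 2 * of_nat m) *s g m" for m
  proof (induction m)
    case 0 then show ?case using u by (simp add: g_def)
  next
    case (Suc m)
    have "g (Suc m) = bracket E (g m)" by (simp add: g_def)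
    then show ?case using eig_shift_E[OF Suc] by (simp add: algebra_simps)
  qed
  have gV: "g m \<in> V i" for m by (induction m) (use u st in \<open>simp_all add: g_def\<close>)
  have "\<exists>m. g m = 0" by (rule eig_finite[OF gH]) (simp add: inj_def)
  define m1 where "m1 = (LEAST m. g m = 0)"
  have m1: "g m1 = 0" unfolding m1_def by (rule LeastI_ex) fact
  have "g 0 = u" by (simp add: g_def)
  then have "m1 \<noteq> 0" using m1 u(2) by metis
  then obtain m0 where m0: "m1 = Suc m0" by (cases m1) auto
  have g0: "g m0 \<noteq> 0" using not_less_Least[of m0 "\<lambda>m. g m = 0"] m0 unfolding m1_def by auto
  define nu where "nu = \<mu> + 2 * of_nat m0"
  define e where "e m = (bracket F ^^ m) (g m0)" for m
  have e0: "e 0 = g m0" and eS: "bracket F (e m) = e (Suc m)" for m by (simp_all add: e_def)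
  have Ee0: "bracket E (e 0) = 0" using m1 m0 by (simp add: e0 g_def)
  have eV: "e m \<in> V i" for m by (induction m) (use gV st in \<open>simp_all add: e_def\<close>)
  have eH: "bracket H (e m) = (nu - 2 * of_nat m) *s e m" for m
  proof (induction m)
    case 0 then show ?case using gH[of m0] by (simp add: e0 nu_def)
  next
    case (Suc m) then show ?case using eig_shift_F[OF Suc] unfolding eS by (simp add: algebra_simps)
  qed
  \<comment> \<open>At the end of the string the left side vanishes, which forces
    \<open>nu = n\<close>.\<close>
  have eE: "bracket E (e (Suc m)) = (of_nat (Suc m) * (nu - of_nat m)) *s e m" for m
  proof (induction m)
    case 0
    have "bracket E (e (Suc 0)) = bracket H (e 0) + bracket F (bracket E (e 0))"
      using br_deriv[of E F "e 0"] by (simp add: EF eS)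
    then show ?case using eH[of 0] Ee0 by simp
  next
    case (Suc m)
    have "bracket E (e (Suc (Suc m))) = bracket H (e (Suc m)) + bracket F (bracket E (e (Suc m)))"
      using br_deriv[of E F "e (Suc m)"] by (simp add: EF eS)
    also have "\<dots> = (nu - 2 * of_nat (Suc m)) *s e (Suc m) + (of_nat (Suc m) * (nu - of_nat m)) *s e (Suc m)"
      by (simp only: eH Suc br_scale_r eS)
    also have "\<dots> = (nu - 2 * of_nat (Suc m) + of_nat (Suc m) * (nu - of_nat m)) *s e (Suc m)"
      by (simp only: scale_left_distrib)
    also have "nu - 2 * of_nat (Suc m) + of_nat (Suc m) * (nu - of_nat m) = of_nat (Suc (Suc m)) * (nu - of_nat (Suc m))"
      by (simp add: algebra_simps)
    finally show ?case .
  qed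
  have "\<exists>m. e m = 0" by (rule eig_finite[OF eH]) (simp add: inj_def)
  define m2 where "m2 = (LEAST m. e m = 0)"
  have m2: "e m2 = 0" unfolding m2_def by (rule LeastI_ex) fact
  have "m2 \<noteq> 0" using m2 g0 e0 by metis
  then obtain n where n: "m2 = Suc n" by (cases m2) auto
  have en: "e m \<noteq> 0" if "m \<le> n" for m using not_less_Least[of m "\<lambda>m. e m = 0"] that n unfolding m2_def by auto
  have "(of_nat (Suc n) * (nu - of_nat n)) *s e n = 0" using eE[of n] m2 n by simp
  then have "of_nat (Suc n) * (nu - of_nat n) = (0::complex)" using en[of n] scale_eq_0_iff by blast
  then have nu: "nu = of_nat n" by (metis mult_eq_0_iff of_nat_eq_0_iff nat.distinct(1) eq_iff_diff_eq_0)
  define U where "U = span (e ` {..n})"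
  have Us: "subspace U" unfolding U_def by (rule subspace_span)
  have eU: "e m \<in> U" if "m \<le> Suc n" for m
  proof (cases "m = Suc n")
    case True then show ?thesis using m2 n subspace_zero_mem[OF Us] by simp
  next
    case False then show ?thesis unfolding U_def using that by (intro span_base) auto
  qed
  have UV: "U \<subseteq> V i" unfolding U_def by (rule span_minimal) (use eV W in auto)
  have st3: "bracket x w \<in> U" if x: "x \<in> {F, H, E}" and w: "w \<in> U" for x w
  proof -
    have "span (e ` {..n}) \<subseteq> {w. bracket x w \<in> U}"
    proof (rule span_minimal[OF _ subspace_preimage[OF Us br_lin_r]])
      have "bracket x (e m) \<in> U" if m: "m \<le> n" for m
      proof -
        have "bracket F (e m) \<in> U" unfolding eS using eU m by simp
        moreover have "bracket H (e m) \<in> U" unfolding eH using eU m subspace_scale[OF Us] by simp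
        moreover have "bracket E (e m) \<in> U"
        proof (cases m)
          case 0 then show ?thesis using Ee0 subspace_zero_mem[OF Us] by simp
        next
          case (Suc m') then show ?thesis using eE[of m'] eU[of m'] m subspace_scale[OF Us] by simp
        qed
        ultimately show ?thesis using x by auto
      qed
      then show "e ` {..n} \<subseteq> {w. bracket x w \<in> U}" by auto
    qed
    then show ?thesis using w unfolding U_def by blast
  qed
  have "bracket x w \<in> U" if x: "x \<in> L" and w: "w \<in> U" for x w
  proof -
    have "span {F, H, E} \<subseteq> {x. bracket x w \<in> U}"
      by (rule span_minimal[OF _ subspace_preimage[OF Us linear_bracket_left]]) (use st3 w in auto)
    then show ?thesis using x LHEF by blast
  qed
  then have "submodule L U" unfolding submodule_def using Us by blast
  then have "U = {0} \<or> U = V i" using Vsimple[OF i _ UV] by blast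
  moreover have "U \<noteq> {0}" using eU[of 0] en[of 0] by auto
  ultimately have VU: "V i = span (e ` {..n})" unfolding U_def by blast
  have "inj_on (\<lambda>m. nu - 2 * of_nat m :: complex) {..n}" by (simp add: inj_on_def)
  from eig_independent[of "{..n}" H e, OF _ _ this] have "independent (e ` {..n})" "card (e ` {..n}) = Suc n"
    using eH en by simp_all
  then have "d i = Suc n" unfolding d_def VU by (simp add: dim_eq_card_independent)
  then show ?thesis using eV en eH VU eS unfolding nu by blast
qed

end

context fd_lie begin

lemma bracket_span_span: "bracket_span (span X) (span Y) \<subseteq> bracket_span X Y"
proof (rule bracket_span_least[OF bracket_span_subspace])
  fix a b assume a: "a \<in> span X" and b: "b \<in> span Y"
  have 1: "bracket a y \<in> bracket_span X Y" if "y \<in> Y" for y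
  proof -
    have "span X \<subseteq> {a. bracket a y \<in> bracket_span X Y}"
      by (rule span_minimal[OF _ subspace_preimage[OF bracket_span_subspace linear_bracket_left]])
        (use that bracket_span_mem in auto)
    then show ?thesis using a by blast
  qed
  have "span Y \<subseteq> {b. bracket a b \<in> bracket_span X Y}"
    by (rule span_minimal[OF _ subspace_preimage[OF bracket_span_subspace br_lin_r]]) (use 1 in auto)
  then show "bracket a b \<in> bracket_span X Y" using b by blast
qed

lemma eig_bracket: "bracket H x = a *s x \<Longrightarrow> bracket H y = b *s y \<Longrightarrow> bracket H (bracket x y) = (a + b) *s bracket x y"
  using br_deriv[of H x y] by (simp add: br_scale_l br_scale_r scale_left_distrib)

end

context levi_setting begin

text \<open>The exterior square of a plane is a line.\<close>

lemma br_sq_two: assumes n: "br i i \<noteq> 0" and d2: "d i = 2" shows "d (br i i) = 1"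
proof -
  have i: "i \<in> I" using br_dom[OF n] by blast
  have W: "subspace (V i)" "dim (V i) = 2" using Vs i d2 unfolding d_def by auto
  obtain u where u: "u \<in> V i" "u \<noteq> 0" using Vne[OF i] subspace_zero_mem[OF W(1)] by blast
  have "\<not> V i \<subseteq> span {u}" using dim_subset[of "V i" "span {u}"] W(2) u by auto
  then obtain v where v: "v \<in> V i" "v \<notin> span {u}" by blast
  have Vuv: "V i = span {v, u}" by (rule dim2_span[OF W u v])
  have "V (br i i) = bracket_span (V i) (V i)" using br_span[OF i i] VV_I[OF br_in[OF n]] by simp
  also have "\<dots> \<subseteq> bracket_span {v, u} {v, u}" unfolding Vuv by (rule bracket_span_span)
  also have "\<dots> \<subseteq> span {bracket u v}"
  proof (rule bracket_span_least[OF subspace_span])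
    have m: "bracket u v \<in> span {bracket u v}" by (rule span_base) simp
    then have "bracket v u \<in> span {bracket u v}" using br_anti[of v u] span_neg by simp
    then show "bracket a b \<in> span {bracket u v}" if "a \<in> {v, u}" "b \<in> {v, u}" for a b
      using that m by (auto simp: bracket_self span_zero)
  qed
  finally have "d (br i i) \<le> dim (span {bracket u v})" unfolding d_def by (rule dim_subset)
  also have "\<dots> \<le> 1" by simp
  finally show ?thesis using d_pos[OF br_in[OF n]] by simp
qed

text \<open>An alternating form on a space of dimension 3 has a radical, whereas
  \<open>annihilator_zero\<close> makes it nondegenerate. No weights occur, so this serves Levi
  subalgebras of any dimension.\<close>

lemma br_sq_three: assumes n: "br i i \<noteq> 0" and d3: "d i = 3" shows "d (br i i) \<noteq> 1"
proof
  assume d1: "d (br i i) = 1"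
  have i: "i \<in> I" using br_dom[OF n] by blast
  have W: "subspace (V i)" "dim (V i) = 3" using Vs i d3 unfolding d_def by auto
  have mem: "bracket u v \<in> V (br i i)" if "u \<in> V i" "v \<in> V i" for u v
    using br_mem[of u i v i] VV_I i br_in[OF n] that by simp
  have rad: "y = 0" if "y \<in> V i" "\<And>t. t \<in> V i \<Longrightarrow> bracket t y = 0" for y
    by (rule annihilator_zero[OF i i n _ _ that(1), of "V i"]) (use Vst[OF i] that(2) W(1) in \<open>auto simp: span_eq_iff\<close>)
  obtain x where x: "x \<in> V i" "x \<noteq> 0" using Vne[OF i] subspace_zero_mem[OF W(1)] by blast
  then obtain y0 where y0: "y0 \<in> V i" "bracket y0 x \<noteq> 0" using rad by blast
  define K where "K = {y\<in>V i. bracket x y = 0}"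
  have Ks: "subspace K" unfolding subspace_def K_def
    using subspace_zero_mem[OF W(1)] subspace_add[OF W(1)] subspace_scale[OF W(1)] by (auto simp: br_add_r br_scale_r)
  have "dim (V i) \<le> dim K + dim (bracket x ` V i)" using rank_nullity_le[OF br_lin_r W(1), of x] unfolding K_def .
  moreover have "dim (bracket x ` V i) \<le> dim (V (br i i))" by (rule dim_subset) (use mem x in blast)
  ultimately have "dim (V (br i i)) < dim K" using W(2) d1 unfolding d_def by linarith
  from kernel_ex[OF br_lin_r Ks _ this, of y0]
  obtain y where y: "y \<in> K" "y \<noteq> 0" "bracket y0 y = 0" using mem y0(1) unfolding K_def by blast
  have yV: "y \<in> V i" "bracket x y = 0" using y(1) unfolding K_def by auto
  have yx: "y \<notin> span {x}"
  proof
    assume "y \<in> span {x}" then obtain c where c: "y = c *s x" by (metis span1E)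
    then have "c \<noteq> 0" using y(2) by auto
    then show False using y(3) y0(2) c by (simp add: br_scale_r)
  qed
  have "y0 \<notin> span {y, x}"
  proof
    assume "y0 \<in> span {y, x}" then obtain a b where "y0 = a *s y + b *s x" by (metis span2E)
    then have "bracket y0 x = a *s bracket y x" by (simp add: br_add_l br_scale_l bracket_self)
    also have "bracket y x = 0" using yV(2) br_anti[of y x] by simp
    finally show False using y0(2) by simp
  qed
  then have V: "V i = span {y0, y, x}" by (rule dim3_span[OF W x yV(1) yx y0(1)])
  have "bracket t y = 0" if t: "t \<in> V i" for t
  proof -
    have "span {y0, y, x} \<subseteq> {t. bracket t y \<in> {0}}"
      by (rule span_minimal[OF _ subspace_preimage[OF subspace_single_0 linear_bracket_left]])
        (use y(3) yV(2) bracket_self in auto)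
    then show ?thesis using t V by auto
  qed
  then show False using rad[OF yV(1)] y(2) by blast
qed

lemma table_base: "bracket_table_base I br d"
proof
  show "finite I" "0 \<notin> I" "I \<noteq> {}" using fin_I zero_I I_ne by blast+
  show "br i j \<in> I" if "br i j \<noteq> 0" for i j using br_in that .
  show "br i j = 0" if "i \<notin> I" for i j using that br_dom by blast
  show "br i j = br j i" for i j by (rule br_comm)
  show "br (br j l) i = p \<or> br (br l i) j = p" if "br (br i j) l = p" "p \<noteq> 0" for i j l p using br_jac that .
  show "J = {}" if "J \<subseteq> I" "{p. p \<noteq> 0 \<and> (\<exists>i j. j \<in> J \<and> p = br i j)} = J" for J using br_nil that .
  show "w i = 0" if "\<And>i j. br i j \<noteq> 0 \<Longrightarrow> w (br i j) = w i + w j" "i \<in> I" for w :: "nat \<Rightarrow> int" and i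
    by (rule wt) (use that in blast)+
  show "1 \<le> d i" if "i \<in> I" for i using d_pos that .
  show "\<exists>j l. br j l = i" if "i \<in> I" "d i = 1" for i using br_triv_nongen that .
  show "d i \<noteq> 1" if "i \<in> I" "\<And>j. br i j = 0" for i
    by (rule br_central_nontriv) (use that in blast)+
qed

end

context sl2_setting begin

text \<open>The highest weight of the value is a weight of the product, hence differs from the sum
  of the highest weights by an even number; dimensions are highest weights plus one.\<close>

lemma br_parity: assumes n: "br i j \<noteq> 0" shows "odd (d i + d j + d (br i j))"
proof -
  let ?p = "br i j"
  have ij: "i \<in> I" "j \<in> I" "?p \<in> I" using br_dom[OF n] br_in[OF n] by blast+
  obtain e a where e: "d i = Suc a" "\<And>m. m \<le> a \<Longrightarrow> bracket H (e m) = (of_nat a - 2 * of_nat m) *s e m" "V i = span (e ` {..a})"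
    using weight_basis[OF ij(1)] by blast
  obtain f b where f: "d j = Suc b" "\<And>m. m \<le> b \<Longrightarrow> bracket H (f m) = (of_nat b - 2 * of_nat m) *s f m" "V j = span (f ` {..b})"
    using weight_basis[OF ij(2)] by blast
  obtain g c where g: "d ?p = Suc c" "g (0::nat) \<in> V ?p" "g 0 \<noteq> 0" "bracket H (g 0) = of_nat c *s g 0"
    using weight_basis[OF ij(3)] by fastforce
  let ?A = "(\<lambda>m. of_nat a + of_nat b - 2 * of_nat m :: complex) ` {..a + b}"
  have "V ?p = bracket_span (V i) (V j)" using br_span[OF ij(1,2)] VV_I[OF ij(3)] by simp
  also have "\<dots> \<subseteq> bracket_span (e ` {..a}) (f ` {..b})" unfolding e(3) f(3) by (rule bracket_span_span)
  finally have gs: "g 0 \<in> span {bracket x y |x y. x \<in> e ` {..a} \<and> y \<in> f ` {..b}}" using g(2) unfolding bracket_span_def by blast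
  have "of_nat c \<in> ?A"
  proof (rule eig_span[OF _ _ gs g(3,4)])
    fix s assume "s \<in> {bracket x y |x y. x \<in> e ` {..a} \<and> y \<in> f ` {..b}}"
    then obtain m l where ml: "m \<le> a" "l \<le> b" "s = bracket (e m) (f l)" by auto
    have "bracket H s = (of_nat a - 2 * of_nat m + (of_nat b - 2 * of_nat l)) *s s"
      unfolding ml(3) by (rule eig_bracket[OF e(2)[OF ml(1)] f(2)[OF ml(2)]])
    also have "of_nat a - 2 * of_nat m + (of_nat b - 2 * of_nat l) = of_nat a + of_nat b - 2 * (of_nat (m + l) :: complex)"
      by (simp add: algebra_simps)
    finally have "bracket H s = (of_nat a + of_nat b - 2 * of_nat (m + l)) *s s" .
    moreover have "of_nat a + of_nat b - 2 * of_nat (m + l) \<in> ?A"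
      by (rule image_eqI[OF refl]) (use ml(1,2) in simp)
    ultimately show "\<exists>c\<in>?A. bracket H s = c *s s" by blast
  qed simp
  then obtain m where "(of_nat c :: complex) = of_nat a + of_nat b - 2 * of_nat m" by blast
  then have "(of_nat (c + 2 * m) :: complex) = of_nat (a + b)" by (simp add: algebra_simps)
  then have "c + 2 * m = a + b" by (rule of_nat_eq_iff[THEN iffD1])
  then have "a + b + c = 2 * (c + m)" by simp
  then have "even (a + b + c)" by simp
  then show ?thesis using e(1) f(1) g(1) by simp
qed

lemma triv_H: assumes "p \<in> I" "d p = 1" "x \<in> V p" shows "bracket H x = 0"
  using triv_L(1)[OF assms(1,2) HL assms(3)] .

text \<open>The highest weight vector of \<open>V i\<close> has a nonzero bracket with some weight
  vector of \<open>V j\<close>. The value has weight 0, so \<open>V j\<close> contains the opposite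
  weight.\<close>

lemma br_triv_dual_le: assumes n: "br i j \<noteq> 0" and d1: "d (br i j) = 1" shows "d i \<le> d j"
proof -
  have ij: "i \<in> I" "j \<in> I" "br i j \<in> I" using br_dom[OF n] br_in[OF n] by blast+
  obtain e a where e: "d i = Suc a" "e (0::nat) \<in> V i" "e 0 \<noteq> 0" "bracket H (e 0) = of_nat a *s e 0"
    using weight_basis[OF ij(1)] by fastforce
  obtain f b where f: "d j = Suc b" "\<And>m. m \<le> b \<Longrightarrow> f m \<in> V j \<and> bracket H (f m) = (of_nat b - 2 * of_nat m) *s f m" "V j = span (f ` {..b})"
    using weight_basis[OF ij(2)] by blast
  have "\<exists>m\<le>b. bracket (e 0) (f m) \<noteq> 0"
  proof (rule ccontr)
    assume c: "\<not> ?thesis"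
    have "span (f ` {..b}) \<subseteq> {w. bracket (e 0) w \<in> {0}}"
      by (rule span_minimal[OF _ subspace_preimage[OF subspace_single_0 br_lin_r]]) (use c in auto)
    then have z: "bracket (e 0) w = 0" if "w \<in> V j" for w using that f(3) by auto
    have "e 0 = 0"
      by (rule annihilator_zero[OF ij(2,1) _ _ _ e(2), of "V j"])
        (use n br_comm[of i j] Vst[OF ij(2)] Vs[OF ij(2)] z br_anti[of _ "e 0"] in \<open>auto simp: span_eq_iff\<close>)
    then show False using e(3) by simp
  qed
  then obtain m where m: "m \<le> b" "bracket (e 0) (f m) \<noteq> 0" by blast
  have "bracket (e 0) (f m) \<in> V (br i j)" using br_mem[of "e 0" i "f m" j] VV_I ij e(2) f(2)[OF m(1)] by simp
  then have "bracket H (bracket (e 0) (f m)) = 0" by (rule triv_H[OF ij(3) d1])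
  moreover have "bracket H (bracket (e 0) (f m)) = (of_nat a + (of_nat b - 2 * of_nat m)) *s bracket (e 0) (f m)"
    by (rule eig_bracket[OF e(4)]) (use f(2)[OF m(1)] in blast)
  ultimately have "(of_nat a + (of_nat b - 2 * of_nat m)) *s bracket (e 0) (f m) = 0" by simp
  then have "of_nat a + (of_nat b - 2 * of_nat m) = (0::complex)" using m(2) scale_eq_0_iff by blast
  then have "(of_nat (a + b) :: complex) = of_nat (2 * m)" by (simp add: algebra_simps)
  then have "a + b = 2 * m" by (rule of_nat_eq_iff[THEN iffD1])
  then show ?thesis using m(1) e(1) f(1) by simp
qed

text \<open>Odd dimension gives a vector \<open>e m\<close> of weight 0. With values in a trivial
  summand it can only pair with weight 0, that is with itself, and \<open>bracket_self\<close> puts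
  it into the zero radical.\<close>

lemma br_sq_odd: assumes n: "br i i \<noteq> 0" and odd: "odd (d i)" shows "d (br i i) \<noteq> 1"
proof
  assume d1: "d (br i i) = 1"
  have i: "i \<in> I" "br i i \<in> I" using br_dom[OF n] br_in[OF n] by blast+
  obtain e a where e: "d i = Suc a" "\<And>m. m \<le> a \<Longrightarrow> e m \<in> V i \<and> e m \<noteq> 0 \<and> bracket H (e m) = (of_nat a - 2 * of_nat m) *s e m" "V i = span (e ` {..a})"
    using weight_basis[OF i(1)] by blast
  obtain m where m: "a = 2 * m" using odd e(1) by (auto elim: evenE)
  have ma: "m \<le> a" using m by simp
  have em: "e m \<in> V i" "e m \<noteq> 0" "bracket H (e m) = 0 *s e m" using e(2)[OF ma] m by auto
  have 0: "bracket (e l) (e m) = 0" if l: "l \<le> a" for l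
  proof (cases "l = m")
    case True then show ?thesis by (simp add: bracket_self)
  next
    case False
    have "bracket (e l) (e m) \<in> V (br i i)" using br_mem[of "e l" i "e m" i] VV_I i em e(2)[OF l] by simp
    then have "bracket H (bracket (e l) (e m)) = 0" by (rule triv_H[OF i(2) d1])
    moreover have "bracket H (bracket (e l) (e m)) = (of_nat a - 2 * of_nat l + 0) *s bracket (e l) (e m)"
      by (rule eig_bracket[OF _ em(3)]) (use e(2)[OF l] in blast)
    ultimately have "(of_nat a - 2 * of_nat l + 0) *s bracket (e l) (e m) = 0" by simp
    moreover have "of_nat a - 2 * of_nat l + 0 \<noteq> (0::complex)" using m False by simp
    ultimately show ?thesis using scale_eq_0_iff by blast
  qed
  have "span (e ` {..a}) \<subseteq> {w. bracket w (e m) \<in> {0}}"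
    by (rule span_minimal[OF _ subspace_preimage[OF subspace_single_0 linear_bracket_left]]) (use 0 in auto)
  then have z: "bracket w (e m) = 0" if "w \<in> V i" for w using that e(3) by auto
  have "e m = 0"
    by (rule annihilator_zero[OF i(1) i(1) n _ _ em(1), of "V i"])
      (use Vst[OF i(1)] Vs[OF i(1)] z in \<open>auto simp: span_eq_iff\<close>)
  then show False using em(2) by simp
qed

text \<open>The form \<open>\<beta>\<close> is symmetric because \<open>t0\<close> kills brackets
  within \<open>V i\<close>. Invariance under \<open>H\<close> kills its two diagonal values on the
  weight basis, and invariance under \<open>F\<close> the mixed one.\<close>

lemma br_sym_triv:
  assumes d2: "d i = 2" and d1: "d t = 1" and c: "br t i = c" "c \<noteq> 0" and tii: "br t (br i i) = 0" and n: "br c i \<noteq> 0"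
  shows "d (br c i) \<noteq> 1"
proof
  assume du: "d (br c i) = 1"
  have I: "t \<in> I" "i \<in> I" "c \<in> I" "br c i \<in> I" using br_dom[of t i] br_in[of t i] c br_in[OF n] by auto
  obtain t0 where t0: "t0 \<in> V t" "t0 \<noteq> 0" "V t = span {t0}" using triv_basis[OF I(1) d1] by blast
  obtain e a where e: "d i = Suc a" "\<And>m. m \<le> a \<Longrightarrow> e m \<in> V i \<and> bracket H (e m) = (of_nat a - 2 * of_nat m) *s e m"
    "V i = span (e ` {..a})" "bracket F (e 0) = e (Suc 0)" using weight_basis[OF I(2)] by blast
  have a1: "a = 1" using e(1) d2 by simp
  have ee: "e 0 \<in> V i" "e 1 \<in> V i" "bracket H (e 0) = 1 *s e 0" "bracket H (e 1) = (-1) *s e 1"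
    using e(2)[of 0] e(2)[of 1] a1 by auto
  define \<beta> where "\<beta> x y = bracket (bracket t0 x) y" for x y
  have \<beta>m: "\<beta> x y \<in> V (br c i)" if "x \<in> V i" "y \<in> V i" for x y
  proof -
    have "bracket t0 x \<in> VV (br t i)" by (intro br_mem) (use t0 that I VV_I in simp_all)
    then have "bracket t0 x \<in> VV c" using c by simp
    then have "\<beta> x y \<in> VV (br c i)" unfolding \<beta>_def by (rule br_mem) (use that I VV_I in simp)
    then show ?thesis using VV_I I by simp
  qed
  have \<beta>s: "\<beta> x y = \<beta> y x" if "x \<in> V i" "y \<in> V i" for x y
  proof -
    have "bracket x y \<in> VV (br i i)" by (intro br_mem) (use that I VV_I in simp_all)
    then have "bracket t0 (bracket x y) \<in> VV (br t (br i i))"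
      by (rule br_mem[rotated]) (use t0 I VV_I in simp)
    then have "bracket t0 (bracket x y) = 0" using tii by simp
    then have "\<beta> x y = - bracket x (bracket t0 y)" using br_deriv[of t0 x y] unfolding \<beta>_def by (simp add: eq_neg_iff_add_eq_0)
    then show ?thesis using br_anti[of "bracket t0 y" x] unfolding \<beta>_def by simp
  qed
  have inv: "\<beta> (bracket l x) y + \<beta> x (bracket l y) = 0" if l: "l \<in> L" and xy: "x \<in> V i" "y \<in> V i" for l x y
  proof -
    have lt: "bracket l t0 = 0" using triv_L(1)[OF I(1) d1 l t0(1)] .
    have "bracket l (\<beta> x y) = 0" using triv_L(1)[OF I(4) du l \<beta>m[OF xy]] .
    moreover have "bracket l (\<beta> x y) = bracket (bracket l (bracket t0 x)) y + bracket (bracket t0 x) (bracket l y)"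
      unfolding \<beta>_def by (rule br_deriv)
    moreover have "bracket l (bracket t0 x) = bracket t0 (bracket l x)" using br_deriv[of l t0 x] lt by simp
    ultimately show ?thesis unfolding \<beta>_def by simp
  qed
  have dbl: "x = 0" if "x + x = 0" for x :: 'a
  proof -
    have "(1 + 1) *s x = 0" using that by (simp only: scale_left_distrib scale_one)
    then show ?thesis by simp
  qed
  have 00: "\<beta> (e 0) (e 0) = 0" by (rule dbl) (use inv[OF HL ee(1,1)] ee(3) in simp)
  have 11: "\<beta> (e 1) (e 1) = 0"
  proof -
    have "\<beta> ((-1) *s e 1) (e 1) = - \<beta> (e 1) (e 1)" "\<beta> (e 1) ((-1) *s e 1) = - \<beta> (e 1) (e 1)"
      by (simp_all add: \<beta>_def br_neg_r br_neg_l)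
    then have "- \<beta> (e 1) (e 1) + - \<beta> (e 1) (e 1) = 0"
      using inv[OF HL ee(2,2)] unfolding ee(4) by (simp only:)
    then have "- \<beta> (e 1) (e 1) = 0" by (rule dbl)
    then show ?thesis by simp
  qed
  have 10: "\<beta> (e 1) (e 0) = 0" by (rule dbl) (use inv[OF FL ee(1,1)] e(4) \<beta>s[OF ee(1,2)] in simp)
  have 01: "\<beta> (e 0) (e 1) = 0" using 10 \<beta>s[OF ee(1,2)] by simp
  have e01: "e ` {..1} = {e 0, e 1}" by (auto simp: le_Suc_eq)
  have "V c = bracket_span (V t) (V i)" using br_span[OF I(1,2)] VV_I I c by simp
  also have "\<dots> \<subseteq> bracket_span {t0} (e ` {..1})" unfolding t0(3) e(3) a1 by (rule bracket_span_span)
  also have "\<dots> \<subseteq> span {bracket t0 (e 0), bracket t0 (e 1)}"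
    unfolding e01 by (rule bracket_span_least[OF subspace_span]) (auto intro: span_base)
  finally have Vc: "V c \<subseteq> span {bracket t0 (e 0), bracket t0 (e 1)}" .
  have "V (br c i) = bracket_span (V c) (V i)" using br_span[OF I(3,2)] VV_I I by simp
  also have "\<dots> \<subseteq> bracket_span (span {bracket t0 (e 0), bracket t0 (e 1)}) (span (e ` {..1}))"
    unfolding bracket_span_def[of "V c"] by (rule span_minimal[OF _ bracket_span_subspace]) (use Vc e(3) a1 in \<open>auto intro!: bracket_span_mem\<close>)
  also have "\<dots> \<subseteq> bracket_span {bracket t0 (e 0), bracket t0 (e 1)} (e ` {..1})" by (rule bracket_span_span)
  also have "\<dots> \<subseteq> {0}" unfolding e01
    by (rule bracket_span_least[OF subspace_single_0]) (use 00 01 10 11 in \<open>auto simp: \<beta>_def\<close>)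
  finally show False using Vne[OF I(4)] subspace_zero_mem[OF Vs[OF I(4)]] by blast
qed

lemma sl2_false: assumes s: "sum d I \<le> 11" shows False
proof -
  have "bracket_table I br d"
  proof (intro bracket_table.intro table_base bracket_table_axioms.intro)
    show "i = j" if "card I \<ge> 5" "i \<in> I" "j \<in> I" "\<And>l. br i l = 0" "\<And>l. br j l = 0" for i j
      using br_central_uniq that .
    show "d i = d j" if "br i j \<noteq> 0" "d (br i j) = 1" for i j
      using br_triv_dual_le[OF that] br_triv_dual_le[of j i] that br_comm[of i j] by simp
    show "br (br l i) j = p" if "br (br i j) l = p" "p \<noteq> 0" "d (br i j) = 1" "d l \<ge> 2" "br j l = 0 \<or> d (br j l) = 1" for i j l p
      using br_jac_triv that .
    show "d (br c i) \<noteq> 1" if "d i = 2" "d t = 1" "br t i = c" "c \<noteq> 0" "br t (br i i) = 0" "br c i \<noteq> 0" for i t c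
      using br_sym_triv that .
    show "br c a = 0" if "d a = 2" "d b = 2" "br a a = t" "br a b = s" "d t = 1" "d s = 1"
       "br t b = c" "br s a = c" "c \<noteq> 0" "br (br t a) b = 0" for a b t s c
      using br_cubic_triv that .
  qed (use br_triv_act br_parity br_sq_odd br_sq_two br_sq_triv s in blast)+
  then show False by (rule bracket_table.bracket_table_false)
qed

end

section \<open>Larger Levi subalgebras and the conclusion\<close>

context levi_setting begin

text \<open>With only the dimensions 1 and 3, the rules that rested on weights become elementary:
  parity is automatic, \<open>sym_triv\<close> is void, and squares of three-dimensional summands
  fall under \<open>br_sq_three\<close>.\<close>

lemma odd_false: assumes d: "\<And>i. i \<in> I \<Longrightarrow> d i = 1 \<or> d i = 3" and s: "sum d I \<le> 10" shows False
proof -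
  have m: "i \<in> I" "j \<in> I" "br i j \<in> I" if "br i j \<noteq> 0" for i j using br_dom[OF that] br_in[OF that] by blast+
  have "bracket_table I br d"
  proof (intro bracket_table.intro table_base bracket_table_axioms.intro)
    show "i = j" if "card I \<ge> 5" "i \<in> I" "j \<in> I" "\<And>l. br i l = 0" "\<And>l. br j l = 0" for i j
      using br_central_uniq that .
    show "d i = d j" if n: "br i j \<noteq> 0" "d (br i j) = 1" for i j
    proof -
      have "br j i \<noteq> 0" "d (br j i) = 1" using n br_comm[of i j] by simp_all
      then show ?thesis using br_triv_act[of i j] br_triv_act[of j i] n d[OF m(1)[OF n(1)]] d[OF m(2)[OF n(1)]] by auto
    qed
    show "odd (d i + d j + d (br i j))" if n: "br i j \<noteq> 0" for i j
      using d[OF m(1)[OF n]] d[OF m(2)[OF n]] d[OF m(3)[OF n]] by auto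
    show "d (br i i) \<noteq> 1" if n: "br i i \<noteq> 0" "odd (d i)" for i
      using d[OF m(1)[OF n(1)]] br_sq_triv[of i] br_sq_three[OF n(1)] n by auto
    show "br (br l i) j = p" if "br (br i j) l = p" "p \<noteq> 0" "d (br i j) = 1" "d l \<ge> 2" "br j l = 0 \<or> d (br j l) = 1" for i j l p
      using br_jac_triv that .
    show "d (br c i) \<noteq> 1" if "d i = 2" "d t = 1" "br t i = c" "c \<noteq> 0" "br t (br i i) = 0" "br c i \<noteq> 0" for i t c
      using d[of i] m(2)[of t i] that by auto
    show "br c a = 0" if "d a = 2" "d b = 2" "br a a = t" "br a b = s" "d t = 1" "d s = 1"
       "br t b = c" "br s a = c" "c \<noteq> 0" "br (br t a) b = 0" for a b t s c
      using br_cubic_triv that .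
    show "sum d I \<le> 11" using s by simp
  qed (use br_triv_act br_sq_two br_sq_triv in blast)+
  then show False by (rule bracket_table.bracket_table_false)
qed

theorem dim_ge_15: "dim UNIV \<ge> 15"
proof (rule ccontr)
  assume "\<not> ?thesis"
  then have le: "dim L + sum d I \<le> 14" using dim_total by linarith
  show False
  proof (cases "dim L = 3")
    case True
    obtain H E F where "H \<in> L" "E \<in> L" "F \<in> L" "bracket H E = 2 *s E" "bracket H F = (-2) *s F" "bracket E F = H" "L = span {F, H, E}"
      using sl2_triple_ex[OF True] by blast
    then interpret sl2_setting scale bracket Basis L h k V H E F by unfold_locales
    show False using sl2_false le True by simp
  next
    case False
    \<comment> \<open>Here \<open>dim L\<close> is at least 4, which leaves 14 - 4 = 10 dimensions
      for \<open>h\<close>, and \<open>two_dim_L\<close> excludes planes.\<close>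
    then have s: "sum d I \<le> 10" using dim_L_ge le by linarith
    have "d i \<noteq> 2" if "i \<in> I" for i using two_dim_L[OF that] False by blast
    then have "d i = 1 \<or> d i = 3" if "i \<in> I" for i
      using bracket_table_base.odd_dims[OF table_base _ s that] by blast
    then show False using odd_false s by blast
  qed
qed

end

theorem theorem3p33:
  fixes scale :: "complex \<Rightarrow> 'a::ab_group_add \<Rightarrow> 'a"
    and bracket :: "'a \<Rightarrow> 'a \<Rightarrow> 'a"
    and gL h :: "'a set"
    and k :: nat
    and V :: "nat \<Rightarrow> 'a set"
  assumes "fin_dim_lie_algebra scale bracket"
    and "lie_algebra.sympathetic scale bracket"
    and "\<not> lie_algebra.semisimple scale bracket UNIV"
    and "lie_algebra.levi_decomposition scale bracket gL h"
    and "lie_algebra.simple scale bracket gL"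
    and "lie_algebra.direct_sum scale {1..k} V h"
    and "\<And>i. i \<in> {1..k} \<Longrightarrow> lie_algebra.simple_module scale bracket gL (V i)"
    and "\<And>i j. i \<in> {1..k} \<Longrightarrow> j \<in> {1..k} \<Longrightarrow>
           lie_algebra.bracket_span scale bracket (V i) (V j) \<noteq> {0} \<Longrightarrow>
           \<exists>!p. p \<in> {1..k} \<and> lie_algebra.bracket_span scale bracket (V i) (V j) = V p"
    and "k \<ge> 5 \<Longrightarrow> lie_algebra.simple_module scale bracket gL (lie_algebra.center bracket h)"
  shows "vector_space.dim scale (UNIV :: 'a set) \<ge> 15"
proof -
  interpret fin_dim_lie_algebra scale bracket by fact
  obtain B0 where B0: "finite B0" "span B0 = UNIV" using finite_dimensional by blast
  obtain B where B: "B \<subseteq> B0" "independent B" "B0 \<subseteq> span B" using maximal_independent_subset by blast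
  have "span B = UNIV" using B(3) B0(2) span_minimal[OF B(3) subspace_span] by auto
  then interpret finite_dimensional_vector_space scale B
    using B B0(1) finite_subset by unfold_locales auto
  interpret fd_lie scale bracket B ..
  interpret levi_setting scale bracket B gL h k V
    using assms(2-9) by unfold_locales
  show ?thesis by (rule dim_ge_15)
qed

end
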